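(* Let $\alpha\ge0$, $n>0$, and consider the equation $$u_t+\bigl[u^n\,(u_{\theta\theta\theta}+\alpha^2u_\theta-\sin\theta)\bigr]_\theta=0,\qquad \theta\in\Omega=(-\pi,\pi),$$ with periodic boundary conditions. Set $\beta=n-\frac32$. Let $u$ be a solution of mass $M>0$ that dissipates energy and satisfies, with constants $S_0$ and $K_0$, $$\int_\Omega u(\theta,t)^{-\beta}\,d\theta\le S_0+K_0t\qquad (t\ge0),$$ and let $u^*$ be the energy-minimizing steady state of the same mass, i.e. the unique minimizer of $E$ on $C_M$. (i) If $u^*$ is strictly positive, set $\mu=(1-\alpha^2)(\min u^* )^n$ and $\varepsilon_0=\frac{(1-\alpha^2)\pi}{2}(\min u^* )^2$. For each such solution with $E(u(\cdot,0))<E(u^* )+\varepsilon_0$ there exists a constant $K_1$ such that $$\|u(\cdot,t)-u^*\|_{H^1}\le K_1e^{-\mu t}\qquad(t\ge0).$$ (ii) If $u^*$ vanishes on an interval of positive length $L$, and $n>\frac32$, then $$\|u(\cdot,t)-u^*\|_{2}\ge L^{\frac1\beta+\frac12}\bigl(S_0+K_0t\bigr)^{-\frac1\beta}\qquad(t\ge0).$$ (iii) If $u^*$ vanishes quadratically at a point, and $n>\frac52$, then there exist positive constants $K_2$ and $K_3$ such that $$\|u(\cdot,t)-u^*\|_2\ge\bigl(K_2+K_3t\bigr)^{-\frac{3}{2(\beta-1)}}\qquad(t\ge0).$$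
   Context: All functions of $\theta$ on $\Omega=(-\pi,\pi)$ are $2\pi$-periodic. The energy is $$E(u)=\frac12\int_\Omega \bigl(u_\theta^2-\alpha^2u^2\bigr)\,d\theta-\int_\Omega u\cos\theta\,d\theta ,$$ and $$C_M=\Bigl\{u\in H^1(\Omega)\ \Big|\ u\ge0,\ \int_\Omega u\,d\theta=M\Bigr\}.$$ For every $M>0$, $E$ has a unique minimizer on $C_M$; it is a time-independent solution of the equation. A solution is a nonnegative function $u$, with $u\in L^2((0,T),H^2(\Omega))$ for every $T>0$, such that $$\int_0^T\int_\Omega\Bigl\{u\phi_t-(u_{\theta\theta}+\alpha^2u+\cos\theta)\bigl(u^n\phi_\theta\bigr)_\theta\Bigr\}\,d\theta\,dt=0$$ for every smooth test function $\phi$ with compact support in $\Omega\times(0,T)$. It has mass $M$ if $u(\cdot,t)\in C_M$ for $t\ge0$. "Dissipates energy" means $$\frac{d}{dt}E(u(\cdot,t))=-\int_\Omega u^n\Bigl(\frac{\delta E}{\delta u}\Bigr)_\theta^2\,d\theta\le0,$$ where $\frac{\delta E}{\delta u}=-u_{\theta\theta}-\alpha^2u-\cos\theta$ is the $L^2$-gradient of $E$. $\|\cdot\|_2$ is the norm of $L^2(\Omega)$. "$u^*$ vanishes quadratically at a point" means that $u^*$ vanishes at a single point $\theta_0$ and behaves like a positive multiple of $(\theta-\theta_0)^2$ near $\theta_0$. *)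

theory Defs
  imports "HOL-Analysis.Analysis" "HOL-Library.Landau_Symbols"
begin

section \<open>Test functions and weak derivatives\<close>

primrec C_k :: "nat \<Rightarrow> ('a::euclidean_space \<Rightarrow> real) \<Rightarrow> bool" where
  "C_k 0 f \<longleftrightarrow> continuous_on UNIV f"
| "C_k (Suc k) f \<longleftrightarrow>
     (\<forall>x. f differentiable (at x)) \<and> (\<forall>b\<in>Basis. C_k k (\<lambda>x. frechet_derivative f (at x) b))"

definition test_function :: "('a::euclidean_space) set \<Rightarrow> ('a \<Rightarrow> real) \<Rightarrow> bool" where
  "test_function S \<phi> \<longleftrightarrow>
     (\<forall>k. C_k k \<phi>) \<and> compact (closure {x. \<phi> x \<noteq> 0}) \<and> closure {x. \<phi> x \<noteq> 0} \<subseteq> S"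

definition locally_integrable :: "real set \<Rightarrow> (real \<Rightarrow> real) \<Rightarrow> bool" where
  "locally_integrable S f \<longleftrightarrow> (\<forall>K. compact K \<and> K \<subseteq> S \<longrightarrow> f absolutely_integrable_on K)"

text \<open>Meant for open \<open>S\<close>. The values of \<open>f\<close> and \<open>g\<close> outside \<open>S\<close> play no role.\<close>

definition has_weak_deriv :: "real set \<Rightarrow> (real \<Rightarrow> real) \<Rightarrow> (real \<Rightarrow> real) \<Rightarrow> bool" where
  "has_weak_deriv S f g \<longleftrightarrow>
     locally_integrable S f \<and> locally_integrable S g \<and>
     (\<forall>\<phi>. test_function S \<phi> \<longrightarrow>
        (LINT x|lebesgue. f x * deriv \<phi> x) = - (LINT x|lebesgue. g x * \<phi> x))"

text \<open>A weak derivative is unique up to a null subset of \<open>S\<close>. It is only used under integrals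
  that do not depend on the choice of the representative.\<close>

definition weak_deriv :: "real set \<Rightarrow> (real \<Rightarrow> real) \<Rightarrow> real \<Rightarrow> real" where
  "weak_deriv S f = (SOME g. has_weak_deriv S f g)"

definition square_integrable :: "'a measure \<Rightarrow> ('a \<Rightarrow> real) \<Rightarrow> bool" where
  "square_integrable M f \<longleftrightarrow> f \<in> borel_measurable M \<and> integrable M (\<lambda>x. (f x)\<^sup>2)"

section \<open>Periodic Sobolev functions and the energy\<close>

text \<open>Functions of the angle are \<open>2\<pi>\<close>-periodic functions on the whole line, so a weak derivative
  on \<open>UNIV\<close> is a weak derivative on the circle. Integrals are over one period.\<close>

abbreviation Om :: "real set" where
  "Om \<equiv> {-pi<..<pi}"

definition periodic :: "(real \<Rightarrow> real) \<Rightarrow> bool" where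
  "periodic f \<longleftrightarrow> (\<forall>x. f (x + 2 * pi) = f x)"

text \<open>Elements of \<open>H\<^sup>1\<close> are identified with their continuous representatives, so that pointwise
  statements (nonnegativity, minimum, zero set) make sense.\<close>

definition H1 :: "(real \<Rightarrow> real) set" where
  "H1 = {f. continuous_on UNIV f \<and> periodic f \<and>
            (\<exists>g. has_weak_deriv UNIV f g \<and> square_integrable (lebesgue_on Om) g)}"

definition L2_norm :: "(real \<Rightarrow> real) \<Rightarrow> real" where
  "L2_norm f = sqrt (LINT x|lebesgue_on Om. (f x)\<^sup>2)"

definition H1_norm :: "(real \<Rightarrow> real) \<Rightarrow> real" where
  "H1_norm f = sqrt ((LINT x|lebesgue_on Om. (f x)\<^sup>2)
                   + (LINT x|lebesgue_on Om. (weak_deriv UNIV f x)\<^sup>2))"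

definition energy :: "real \<Rightarrow> (real \<Rightarrow> real) \<Rightarrow> real" where
  "energy \<alpha> f =
     1 / 2 * (LINT x|lebesgue_on Om. (weak_deriv UNIV f x)\<^sup>2 - \<alpha>\<^sup>2 * (f x)\<^sup>2)
     - (LINT x|lebesgue_on Om. f x * cos x)"

definition energy_grad :: "real \<Rightarrow> (real \<Rightarrow> real) \<Rightarrow> real \<Rightarrow> real" where
  "energy_grad \<alpha> f = (\<lambda>x. - weak_deriv UNIV (weak_deriv UNIV f) x - \<alpha>\<^sup>2 * f x - cos x)"

definition C_mass :: "real \<Rightarrow> (real \<Rightarrow> real) set" where
  "C_mass M = {f \<in> H1. (\<forall>x. 0 \<le> f x) \<and> (LINT x|lebesgue_on Om. f x) = M}"

section \<open>Solutions\<close>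

text \<open>A solution is written \<open>u t x\<close>. In the following, \<open>v\<close> and \<open>w\<close> are the first and second
  weak derivatives of \<open>u\<close> in the angle, chosen jointly measurable in time and angle.\<close>

definition in_L2_H2 ::
  "real \<Rightarrow> (real \<Rightarrow> real \<Rightarrow> real) \<Rightarrow> (real \<Rightarrow> real \<Rightarrow> real) \<Rightarrow> (real \<Rightarrow> real \<Rightarrow> real) \<Rightarrow> bool" where
  "in_L2_H2 T u v w \<longleftrightarrow>
     (AE t in lebesgue_on {0<..<T}. periodic (u t) \<and>
        has_weak_deriv UNIV (u t) (v t) \<and> has_weak_deriv UNIV (v t) (w t)) \<and>
     (\<forall>f\<in>{u, v, w}. square_integrable (lebesgue_on ({0<..<T} \<times> Om)) (\<lambda>(t, x). f t x))"

text \<open>Below, \<open>q t\<close> is the weak derivative of \<open>u\<^sup>n \<phi>\<^sub>\<theta>\<close> in the angle. The integrand is required to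
  be integrable since the Bochner integral of a non-integrable function is 0.\<close>

definition is_solution :: "real \<Rightarrow> real \<Rightarrow> (real \<Rightarrow> real \<Rightarrow> real) \<Rightarrow> bool" where
  "is_solution n \<alpha> u \<longleftrightarrow>
     (\<forall>t\<ge>0. \<forall>x. 0 \<le> u t x) \<and>
     (\<exists>v w. \<forall>T>0. in_L2_H2 T u v w \<and>
        (\<forall>\<phi>. test_function ({0<..<T} \<times> Om) \<phi> \<longrightarrow>
           (\<exists>q. (AE t in lebesgue_on {0<..<T}.
                   has_weak_deriv Om (\<lambda>x. u t x powr n * deriv (\<lambda>y. \<phi> (t, y)) x) (q t)) \<and>
                has_bochner_integral (lebesgue_on ({0<..<T} \<times> Om))
                  (\<lambda>(t, x). u t x * deriv (\<lambda>s. \<phi> (s, x)) t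
                            - (w t x + \<alpha>\<^sup>2 * u t x + cos x) * q t x) 0)))"

text \<open>The derivative of the energy gradient is taken on the open set where \<open>f\<close> is positive;
  elsewhere the factor \<open>f x powr n\<close> is 0. (Across the boundary of the zero set the second
  derivative may jump, as it does for steady states with dry regions.)\<close>

definition dissipation_density :: "real \<Rightarrow> real \<Rightarrow> (real \<Rightarrow> real) \<Rightarrow> real \<Rightarrow> real" where
  "dissipation_density n \<alpha> f =
     (\<lambda>x. f x powr n * (weak_deriv {y. 0 < f y} (energy_grad \<alpha> f) x)\<^sup>2)"

text \<open>The identity \<open>dE/dt = -D\<close> with \<open>D \<ge> 0\<close>, in the sense that the energy is locally absolutely
  continuous in time and the identity holds for almost every time, i.e. in integrated form.\<close>

definition dissipates_energy :: "real \<Rightarrow> real \<Rightarrow> (real \<Rightarrow> real \<Rightarrow> real) \<Rightarrow> bool" where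
  "dissipates_energy n \<alpha> u \<longleftrightarrow>
     (AE t in lebesgue_on {0..}.
        (\<exists>g. has_weak_deriv {y. 0 < u t y} (energy_grad \<alpha> (u t)) g) \<and>
        integrable (lebesgue_on Om) (dissipation_density n \<alpha> (u t))) \<and>
     (\<forall>t\<ge>0. ((\<lambda>s. - (LINT x|lebesgue_on Om. dissipation_density n \<alpha> (u s) x))
              has_integral (energy \<alpha> (u t) - energy \<alpha> (u 0))) {0..t})"

text \<open>\<open>y\<^sup>-\<^sup>\<beta>\<close> for \<open>y \<ge> 0\<close>, with the value \<open>\<infinity>\<close> at 0 if \<open>\<beta> > 0\<close> (whereas \<open>0 powr -\<beta> = 0\<close>),
  and \<open>0\<^sup>0 = 1\<close>.\<close>

definition neg_power :: "real \<Rightarrow> real \<Rightarrow> ennreal" where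
  "neg_power \<beta> y =
     (if \<beta> = 0 then 1 else if y = 0 \<and> 0 < \<beta> then \<infinity> else ennreal (y powr (- \<beta>)))"

definition vanishes_quadratically_at_point :: "(real \<Rightarrow> real) \<Rightarrow> bool" where
  "vanishes_quadratically_at_point f \<longleftrightarrow>
     (\<exists>x0 c. 0 < c \<and> {x \<in> {-pi<..pi}. f x = 0} = {x0} \<and>
             f \<sim>[at x0] (\<lambda>x. c * (x - x0)\<^sup>2))"

end

theory Submission
  imports Defs "HOL-Computational_Algebra.Polynomial" "HOL-Complex_Analysis.Great_Picard"
begin

text \<open>
  For the lower bounds, a bound on the integral of \<open>u\<^sup>-\<^sup>\<beta>\<close> forces the \<open>L\<^sup>2\<close> mass of \<open>u\<close> on a set \<open>J\<close>
  to be at least a power of the measure of \<open>J\<close>. One takes for \<open>J\<close> the dry interval of \<open>u\<^sup>*\<close>, or a short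
  interval next to its touchdown point.

  For the convergence, the weak form of the evolution equation is not needed. The condition on \<open>\<epsilon>\<^sub>0\<close>
  rules out \<open>\<alpha> \<ge> 1\<close>, and for \<open>\<alpha> < 1\<close> the energy is strictly convex on \<open>C\<^sub>M\<close>. The dissipation \<open>D\<close> is
  integrable in time, so \<open>(1 + t) D(t)\<close> is arbitrarily small at suitable times. Together with the
  linear bound for the integral of \<open>u\<^sup>-\<^sup>\<beta>\<close>, the Cauchy-Schwarz inequality makes the integral of
  \<open>u\<^sup>3\<^sup>/\<^sup>4 \<bar>p'\<bar>\<close> small, where \<open>p\<close> is the pressure. This forces uniform limits of \<open>u\<close> along such times to
  be stationary with zero contact angle, and \<open>u\<^sup>*\<close> is the only such profile of mass \<open>M\<close>. Hence \<open>u\<close> comes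
  uniformly close to \<open>u\<^sup>*\<close>, where the dissipation dominates the excess energy, first with a rate
  below the sharp one, then with rates that tend to the sharp one exponentially fast.
\<close>

section \<open>Smooth test functions on the line\<close>

text \<open>Where the film is thin, the mobility \<open>u\<^sup>n\<close> hides the pressure
  gradient from the dissipation, so no rate is available before \<open>u\<close> is known to stay
  away from 0. The proof needs one late time at which it does, and finds it by compactness. Linear
  growth of the integral of u^-\<beta> is just affordable, because 1/(1 + t) has infinite integral.
  The exponent 3/4 is below 1, so u^(-3/4) is integrable in the height, and this makes the contact
  angles of the limit vanish. A limit might a priori consist of several droplets with different
  pressures. Symmetry about the midpoint of a droplet shows that each is centred at a multiple of 2
  pi, so there is one per period. It then satisfies the variational inequality of the convex problem
  and so equals \<open>ustar\<close>. In this way \<open>ustar\<close> inherits the Euler-Lagrange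
  equation from the limit; it is not derived from minimality. The excess energy is quadratic in the
  distance to \<open>ustar\<close>, hence it decays at twice the rate of the norm. It also controls
  the sup norm, so the lower bound for \<open>u\<close> improves along the decay.\<close>

lemma C_k_real_Suc:
  fixes f :: "real \<Rightarrow> real"
  shows "C_k (Suc k) f \<longleftrightarrow> (\<exists>f'. (\<forall>x. (f has_real_derivative f' x) (at x)) \<and> C_k k f')"
proof -
  \<comment> \<open>\<open>C_k\<close> is defined by Frechet derivatives along basis vectors. The
    line has the single basis vector 1, so each level reduces to one ordinary derivative.\<close>
  have *: "(\<lambda>x. frechet_derivative f (at x) 1) = f'"
    if "\<And>x. (f has_real_derivative f' x) (at x)" for f'
  proof
    fix x
    have "(f has_derivative (*) (f' x)) (at x)"
      using that by (simp add: has_field_derivative_def)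
    then have "frechet_derivative f (at x) = (*) (f' x)"
      using frechet_derivative_at by metis
    then show "frechet_derivative f (at x) 1 = f' x" by simp
  qed
  show ?thesis
  proof
    assume L: "C_k (Suc k) f"
    then have "(f has_real_derivative deriv f x) (at x)" for x
      using DERIV_deriv_iff_real_differentiable by auto
    moreover from this have "(\<lambda>x. frechet_derivative f (at x) 1) = deriv f"
      by (rule *)
    ultimately show "\<exists>f'. (\<forall>x. (f has_real_derivative f' x) (at x)) \<and> C_k k f'"
      using L by (intro exI[of _ "deriv f"]) auto
  next
    assume "\<exists>f'. (\<forall>x. (f has_real_derivative f' x) (at x)) \<and> C_k k f'"
    then obtain f' where f': "\<And>x. (f has_real_derivative f' x) (at x)" "C_k k f'" by blast
    then show "C_k (Suc k) f"
      using * real_differentiable_def by auto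
  qed
qed

lemma C_k_SucI:
  fixes f :: "real \<Rightarrow> real"
  assumes "\<And>x. (f has_real_derivative f' x) (at x)" "C_k k f'"
  shows "C_k (Suc k) f"
  using assms C_k_real_Suc by blast

lemma C_k_real_pred: "C_k (Suc k) (f :: real \<Rightarrow> real) \<Longrightarrow> C_k k f"
proof (induction k arbitrary: f)
  case 0
  then obtain f' where "\<And>x. (f has_real_derivative f' x) (at x)"
    using C_k_real_Suc by blast
  then show ?case
    by (auto intro!: continuous_at_imp_continuous_on DERIV_isCont)
next
  case (Suc k)
  then show ?case
    by (metis C_k_real_Suc)
qed

lemma C_k_const: "C_k k (\<lambda>x :: real. c :: real)"
proof (induction k arbitrary: c)
  case (Suc k)
  show ?case by (rule C_k_SucI[of _ "\<lambda>_. 0"]) (auto simp: Suc)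
qed auto

lemma C_k_add:
  fixes f g :: "real \<Rightarrow> real"
  shows "C_k k f \<Longrightarrow> C_k k g \<Longrightarrow> C_k k (\<lambda>x. f x + g x)"
proof (induction k arbitrary: f g)
  case 0
  then show ?case by (auto intro: continuous_intros)
next
  case (Suc k)
  obtain f' g' where "\<And>x. (f has_real_derivative f' x) (at x)" "C_k k f'"
      "\<And>x. (g has_real_derivative g' x) (at x)" "C_k k g'"
    using Suc.prems unfolding C_k_real_Suc by blast
  then show ?case
    by (intro C_k_SucI[of _ "\<lambda>x. f' x + g' x"] Suc.IH) (auto intro!: derivative_eq_intros)
qed

lemma C_k_mult:
  fixes f g :: "real \<Rightarrow> real"
  shows "C_k k f \<Longrightarrow> C_k k g \<Longrightarrow> C_k k (\<lambda>x. f x * g x)"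
proof (induction k arbitrary: f g)
  case 0
  then show ?case by (auto intro: continuous_intros)
next
  case (Suc k)
  obtain f' g' where "\<And>x. (f has_real_derivative f' x) (at x)" "C_k k f'"
      "\<And>x. (g has_real_derivative g' x) (at x)" "C_k k g'"
    using Suc.prems unfolding C_k_real_Suc by blast
  moreover have "C_k k f" "C_k k g"
    by (rule C_k_real_pred[OF Suc.prems(1)], rule C_k_real_pred[OF Suc.prems(2)])
  ultimately show ?case
    by (intro C_k_SucI[of _ "\<lambda>x. f' x * g x + f x * g' x"] C_k_add Suc.IH)
       (auto intro!: derivative_eq_intros)
qed

lemma C_k_power: "C_k k (f :: real \<Rightarrow> real) \<Longrightarrow> C_k k (\<lambda>x. f x ^ j)"
  by (induction j) (auto intro: C_k_const C_k_mult)

lemma C_k_affine: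
  fixes f :: "real \<Rightarrow> real"
  shows "C_k k f \<Longrightarrow> C_k k (\<lambda>x. f (c * x + d))"
proof (induction k arbitrary: f)
  case 0
  then have "continuous_on UNIV f" by simp
  then have "continuous_on UNIV (\<lambda>x. f (c * x + d))"
    by (rule continuous_on_compose2) (auto intro!: continuous_intros)
  then show ?case by simp
next
  case (Suc k)
  obtain f' where f': "\<And>x. (f has_real_derivative f' x) (at x)" "C_k k f'"
    using Suc.prems unfolding C_k_real_Suc by blast
  show ?case
  proof (rule C_k_SucI[of _ "\<lambda>x. f' (c * x + d) * c"])
    show "((\<lambda>x. f (c * x + d)) has_real_derivative f' (c * x + d) * c) (at x)" for x
      by (rule DERIV_chain2[OF f'(1)]) (auto intro!: derivative_eq_intros)
    show "C_k k (\<lambda>x. f' (c * x + d) * c)"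
      by (intro C_k_mult C_k_const Suc.IH f')
  qed
qed

section \<open>A smooth bump function built from exp (- 1/x)\<close>

lemma poly_exp_neg_tendsto_0: "((\<lambda>y :: real. poly P y * exp (- y)) \<longlongrightarrow> 0) at_top"
proof -
  have "((\<lambda>y :: real. \<Sum>i\<le>degree P. coeff P i * (y ^ i / exp y)) \<longlongrightarrow> (\<Sum>i\<le>degree P. coeff P i * 0)) at_top"
    by (intro tendsto_intros tendsto_power_div_exp_0)
  then show ?thesis
    by (simp add: poly_altdef exp_minus sum_divide_distrib field_simps)
qed

text \<open>For \<open>P = 1\<close> this is the classical smooth function that is flat at 0. The
  polynomial in 1/x makes the family closed under differentiation, so smoothness follows by one
  induction.\<close>

definition flat :: "real poly \<Rightarrow> real \<Rightarrow> real" where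
  "flat P x = (if 0 < x then poly P (1 / x) * exp (- (1 / x)) else 0)"

text \<open>By the chain rule the new polynomial is y^2 (P(y) - P'(y)) at y = 1/x. At 0 both
  one-sided difference quotients tend to 0, since the exponential beats every polynomial.\<close>

lemma has_real_derivative_flat:
  "(flat P has_real_derivative flat ([:0, 0, 1:] * (P - pderiv P)) x) (at x)"
proof -
  consider "x < 0" | "x = 0" | "0 < x" by linarith
  then show ?thesis
  proof cases
    case 1
    have "((\<lambda>x. 0) has_real_derivative flat ([:0, 0, 1:] * (P - pderiv P)) x) (at x)"
      using 1 by (simp add: flat_def)
    then show ?thesis
      by (rule has_field_derivative_transform_within_open[where S = "{..<0}"])
         (use 1 in \<open>auto simp: flat_def\<close>)
  next
    case 2
    have "((\<lambda>h. flat P h / h) \<longlongrightarrow> 0) (at 0)"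
    proof (rule filterlim_split_at)
      show "((\<lambda>h. flat P h / h) \<longlongrightarrow> 0) (at_left 0)"
        by (rule tendsto_eventually) (auto simp: flat_def eventually_at_filter)
      \<comment> \<open>The additional factor y of the polynomial absorbs the 1/h of the difference
        quotient.\<close>
      have "((\<lambda>h. poly ([:0, 1:] * P) (inverse h) * exp (- inverse h)) \<longlongrightarrow> 0) (at_right (0 :: real))"
        by (rule filterlim_compose[OF poly_exp_neg_tendsto_0 filterlim_inverse_at_top_right])
      moreover have "eventually (\<lambda>h. poly ([:0, 1:] * P) (inverse h) * exp (- inverse h) = flat P h / h)
          (at_right (0 :: real))"
        by (auto simp: flat_def eventually_at_filter field_simps)
      ultimately show "((\<lambda>h. flat P h / h) \<longlongrightarrow> 0) (at_right 0)"
        by (rule Lim_transform_eventually)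
    qed
    then show ?thesis
      using 2 by (simp add: DERIV_def flat_def)
  next
    case 3
    have d: "((\<lambda>x. 1 / x) has_real_derivative - (1 / x * (1 / x))) (at x)"
      using 3 by (auto intro!: derivative_eq_intros)
    have "((\<lambda>x. poly P (1 / x) * exp (- (1 / x))) has_real_derivative
        (poly (pderiv P) (1 / x) * - (1 / x * (1 / x))) * exp (- (1 / x))
        + (exp (- (1 / x)) * - (- (1 / x * (1 / x)))) * poly P (1 / x)) (at x)"
      by (intro DERIV_mult DERIV_chain2[OF poly_DERIV d] DERIV_chain2[OF DERIV_exp DERIV_minus[OF d]])
    also have "(poly (pderiv P) (1 / x) * - (1 / x * (1 / x))) * exp (- (1 / x))
        + (exp (- (1 / x)) * - (- (1 / x * (1 / x)))) * poly P (1 / x)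
        = flat ([:0, 0, 1:] * (P - pderiv P)) x"
      using 3 by (simp add: flat_def algebra_simps)
    finally have "((\<lambda>x. poly P (1 / x) * exp (- (1 / x))) has_real_derivative
            flat ([:0, 0, 1:] * (P - pderiv P)) x) (at x)" .
    then show ?thesis
      by (rule has_field_derivative_transform_within_open[where S = "{0<..}"])
         (use 3 in \<open>auto simp: flat_def\<close>)
  qed
qed

lemma C_k_flat: "C_k k (flat P)"
proof (induction k arbitrary: P)
  case 0
  then show ?case
    by (auto intro!: continuous_at_imp_continuous_on DERIV_isCont[OF has_real_derivative_flat])
next
  case (Suc k)
  show ?case by (rule C_k_SucI[OF has_real_derivative_flat Suc])
qed

definition bump :: "real \<Rightarrow> real \<Rightarrow> real \<Rightarrow> real" where
  "bump a b x = flat 1 (x - a) * flat 1 (b - x)"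

lemma C_k_bump: "C_k k (bump a b)"
proof -
  have "C_k k (\<lambda>x. flat 1 (1 * x + (- a)) * flat 1 (- 1 * x + b))"
    by (intro C_k_mult C_k_affine C_k_flat)
  then show ?thesis
    by (simp add: bump_def [abs_def])
qed

lemma flat_1_nonneg: "0 \<le> flat 1 x" and flat_1_less: "flat 1 x < 1"
  by (auto simp: flat_def)

lemma bump_pos: "a < x \<Longrightarrow> x < b \<Longrightarrow> 0 < bump a b x"
  and bump_eq_0: "x \<notin> {a<..<b} \<Longrightarrow> bump a b x = 0"
  and bump_nonneg: "0 \<le> bump a b x"
  by (auto simp: bump_def flat_def)

text \<open>Together with positivity inside the interval this makes 1 - (1 - bump)^j tend to the
  indicator of the open interval, which is how \<open>du_Bois_Reymond\<close> reaches
  indicators.\<close>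

lemma bump_less_1: "bump a b x < 1"
proof -
  have "flat 1 (x - a) * flat 1 (b - x) \<le> flat 1 (x - a) * 1"
    by (intro mult_left_mono flat_1_nonneg less_imp_le flat_1_less)
  then show ?thesis
    using flat_1_less[of "x - a"] by (simp add: bump_def)
qed

lemma test_functionI:
  fixes \<phi> :: "real \<Rightarrow> real"
  assumes "\<And>k. C_k k \<phi>" and "\<And>x. x \<notin> {a..b} \<Longrightarrow> \<phi> x = 0" and "{a..b} \<subseteq> S"
  shows "test_function S \<phi>"
proof -
  have "closure {x. \<phi> x \<noteq> 0} \<subseteq> {a..b}"
    using assms(2) by (intro closure_minimal closed_atLeastAtMost) blast
  moreover from this have "compact (closure {x. \<phi> x \<noteq> 0})"
    by (meson bounded_closed_interval bounded_subset closed_closure compact_eq_bounded_closed)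
  ultimately show ?thesis
    using assms unfolding test_function_def by auto
qed

lemma test_functionD:
  fixes \<phi> :: "real \<Rightarrow> real"
  assumes "test_function S \<phi>"
  obtains a b where "a < b" "\<And>x. x \<notin> {a<..<b} \<Longrightarrow> \<phi> x = 0"
    "\<And>x. (\<phi> has_real_derivative deriv \<phi> x) (at x)" "continuous_on UNIV (deriv \<phi>)"
    "\<And>x. x \<notin> {a<..<b} \<Longrightarrow> deriv \<phi> x = 0"
proof -
  have C: "C_k (Suc 0) \<phi>" and cpt: "compact (closure {x. \<phi> x \<noteq> 0})"
    using assms unfolding test_function_def by blast+
  obtain f' where f': "\<And>x. (\<phi> has_real_derivative f' x) (at x)" "C_k 0 f'"
    using C unfolding C_k_real_Suc by blast
  have "deriv \<phi> = f'" using f'(1) DERIV_imp_deriv by blast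
  with f' have d: "(\<phi> has_real_derivative deriv \<phi> x) (at x)" and c: "continuous_on UNIV (deriv \<phi>)" for x
    by auto
  obtain R where R: "R > 0" "\<And>x. x \<in> closure {x. \<phi> x \<noteq> 0} \<Longrightarrow> norm x \<le> R"
    using compact_imp_bounded[OF cpt] bounded_pos by blast
  have z: "\<phi> x = 0" if "x \<notin> {-R..R}" for x
    using R(2)[of x] that closure_subset[of "{x. \<phi> x \<noteq> 0}"] by (cases "\<phi> x = 0") auto
  have dz: "deriv \<phi> x = 0" if "x \<notin> {-R..R}" for x
  proof -
    have "open (- {-R..R})" by auto
    then have "((\<lambda>x. 0) has_real_derivative deriv \<phi> x) (at x)"
      using has_field_derivative_transform_within_open[OF d[of x], of "- {-R..R}" "\<lambda>x. 0"] that z by auto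
    then show ?thesis
      using DERIV_unique DERIV_const by blast
  qed
  \<comment> \<open>The radius is enlarged so that \<phi> and its derivative vanish at the endpoints
    as well; this removes all boundary terms later.\<close>
  show ?thesis
    by (rule that[of "-(R + 1)" "R + 1"]) (use R z dz d c in auto)
qed

section \<open>Indefinite integrals of integrable functions\<close>

text \<open>Densities and product measures are handled with Borel functions on
  \<open>lborel\<close>, while the gauge integral sees Lebesgue measurable functions. This lemma
  passes from one to the other at the price of a null set.\<close>

lemma absolutely_integrable_on_borel_version:
  fixes h :: "real \<Rightarrow> real"
  assumes "h absolutely_integrable_on S"
  obtains h' N where "integrable lborel h'" "negligible N"
    "\<And>x. x \<notin> N \<Longrightarrow> h' x = (if x \<in> S then h x else 0)"
proof -
  let ?F = "\<lambda>x. if x \<in> S then h x else 0"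
  have F: "integrable lebesgue ?F"
    using assms absolutely_integrable_restrict_UNIV[where S = S and f = h]
      absolutely_integrable_imp_integrable[where f = ?F and S = UNIV]
    by (simp add: lebesgue_on_UNIV_eq)
  then obtain h' where h': "h' \<in> borel_measurable lborel" "AE x in lborel. ?F x = h' x"
    using completion_ex_borel_measurable_real[of ?F lborel] by auto
  have ae: "AE x in lebesgue. ?F x = h' x"
    using h'(2) by (rule AE_completion)
  have "integrable lebesgue h'"
    by (rule Bochner_Integration.integrable_cong_AE_imp[OF F])
       (use h' ae in \<open>auto simp: measurable_completion\<close>)
  then have "integrable lborel h'"
    using integrable_completion[of h' lborel] h'(1) by auto
  moreover obtain N where "negligible N" "{x. ?F x \<noteq> h' x} \<subseteq> N"
    using ae eventually_ae_filter_negligible[of "\<lambda>x. ?F x = h' x"] by auto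
  ultimately show ?thesis
    using that[of h' N] by (metis (mono_tags, lifting) mem_Collect_eq subsetD)
qed

lemma integral_borel_version:
  fixes h :: "real \<Rightarrow> real"
  assumes "integrable lborel h'" "negligible N" "\<And>x. x \<notin> N \<Longrightarrow> h' x = (if x \<in> S then h x else 0)"
    and "T \<in> sets borel" "T \<inter> S = R"
  shows "(LINT x|lborel. indicator T x * h' x) = integral R h"
proof -
  have "integrable lborel (\<lambda>x. indicator T x * h' x)"
    using integrable_mult_indicator[of T lborel h'] assms by simp
  then have "(LINT x|lborel. indicator T x * h' x) = integral UNIV (\<lambda>x. indicator T x * h' x)"
    by (simp add: integral_lborel)
  also have "\<dots> = integral UNIV (\<lambda>x. if x \<in> R then h x else 0)"
    by (rule integral_spike[OF assms(2)]) (use assms in \<open>auto simp: indicator_def\<close>)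
  also have "\<dots> = integral R h"
    by (simp add: integral_restrict_UNIV)
  finally show ?thesis .
qed

lemma absolutely_integrable_on_Icc_subset:
  fixes g :: "real \<Rightarrow> real"
  assumes "g absolutely_integrable_on {a..b}" "{c..d} \<subseteq> {a..b}"
  shows "g absolutely_integrable_on {c..d}"
  using absolutely_integrable_on_subcbox[where f = g and S = "cbox a b" and a = c and b = d] assms by simp

lemma integral_Icc_diff:
  fixes g :: "real \<Rightarrow> real"
  assumes "g absolutely_integrable_on {a..b}" "a \<le> c" "c \<le> d" "d \<le> b"
  shows "integral {a..d} g - integral {a..c} g = integral {c..d} g"
proof -
  have "g integrable_on {a..d}"
    using absolutely_integrable_on_Icc_subset[OF assms(1), of a d] assms(4)
    by (simp add: absolutely_integrable_on_def)
  then show ?thesis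
    using Henstock_Kurzweil_Integration.integral_combine[of a c d g] assms by simp
qed

text \<open>The positive and the negative part of \<open>h\<close> are densities of two finite
  measures that agree on all half-lines, hence agree. Uniqueness of densities makes the two parts
  equal almost everywhere, and since one of them is always 0, both vanish.\<close>

lemma indefinite_integral_0_imp_negligible:
  fixes h :: "real \<Rightarrow> real"
  assumes h: "h absolutely_integrable_on {a..b}"
    and 0: "\<And>x. x \<in> {a..b} \<Longrightarrow> integral {a..x} h = 0"
  shows "negligible {x \<in> {a..b}. h x \<noteq> 0}"
proof -
  obtain h' N where h': "integrable lborel h'" "negligible N"
    "\<And>x. x \<notin> N \<Longrightarrow> h' x = (if x \<in> {a..b} then h x else 0)"
    using absolutely_integrable_on_borel_version[OF h] by blast
  have [measurable]: "h' \<in> borel_measurable borel"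
    using h'(1) by auto
  have z: "(LINT x|lborel. indicator {t<..} x * h' x) = 0" for t
  proof -
    have "(LINT x|lborel. indicator {t<..} x * h' x) = integral ({t<..} \<inter> {a..b}) h"
      by (rule integral_borel_version[OF h']) auto
    also have "\<dots> = integral {max a t..b} h"
      by (rule integral_spike_set; rule negligible_subset[of "{t}"]) auto
    also have "\<dots> = 0"
    proof (cases "max a t \<le> b")
      case True
      then show ?thesis
        using integral_Icc_diff[OF h, of "max a t" b] 0[of b] 0[of "max a t"] by auto
    qed auto
    finally show ?thesis .
  qed
  define p where "p x = max 0 (h' x)" for x
  define m where "m x = max 0 (- h' x)" for x
  have [measurable]: "p \<in> borel_measurable borel" "m \<in> borel_measurable borel"
    by (auto simp: p_def[abs_def] m_def[abs_def])
  have i: "integrable lborel p" "integrable lborel m"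
    using h'(1) by (auto simp: p_def[abs_def] m_def[abs_def])
  have it: "integrable lborel (\<lambda>x. indicator {t<..} x * p x)" "integrable lborel (\<lambda>x. indicator {t<..} x * m x)" for t
    using integrable_mult_indicator[OF _ i(1), of "{t<..}"] integrable_mult_indicator[OF _ i(2), of "{t<..}"] by auto
  have e: "emeasure (density lborel (\<lambda>x. ennreal (f x))) {t<..} = ennreal (LINT x|lborel. indicator {t<..} x * f x)"
    if "f = p \<or> f = m" for t f
  proof -
    have [measurable]: "f \<in> borel_measurable borel" using that by auto
    have fn: "0 \<le> f x" for x using that by (auto simp: p_def m_def)
    have "emeasure (density lborel (\<lambda>x. ennreal (f x))) {t<..} = (\<integral>\<^sup>+x. ennreal (f x) * indicator {t<..} x \<partial>lborel)"
      by (subst emeasure_density) auto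
    also have "\<dots> = (\<integral>\<^sup>+x. ennreal (indicator {t<..} x * f x) \<partial>lborel)"
      by (rule nn_integral_cong) (auto simp: indicator_def)
    also have "\<dots> = ennreal (LINT x|lborel. indicator {t<..} x * f x)"
      by (rule nn_integral_eq_integral) (use it that fn in auto)
    finally show ?thesis .
  qed
  have pm: "(LINT x|lborel. indicator {t<..} x * p x) = (LINT x|lborel. indicator {t<..} x * m x)" for t
  proof -
    have "(LINT x|lborel. indicator {t<..} x * p x) - (LINT x|lborel. indicator {t<..} x * m x)
        = (LINT x|lborel. indicator {t<..} x * p x - indicator {t<..} x * m x)"
      using it by simp
    also have "\<dots> = (LINT x|lborel. indicator {t<..} x * h' x)"
      by (rule Bochner_Integration.integral_cong) (auto simp: p_def m_def max_def indicator_def)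
    finally show ?thesis using z by simp
  qed
  have "density lborel (\<lambda>x. ennreal (p x)) = density lborel (\<lambda>x. ennreal (m x))"
    by (rule measure_eqI_lessThan) (use e[of p] e[of m] pm in auto)
  then have "AE x in lborel. ennreal (p x) = ennreal (m x)"
    by (intro sigma_finite_measure.density_unique[OF lborel.sigma_finite_measure_axioms]) auto
  then have "AE x in lebesgue. ennreal (p x) = ennreal (m x)"
    by (rule AE_completion)
  then obtain N' where N': "negligible N'" "{x. ennreal (p x) \<noteq> ennreal (m x)} \<subseteq> N'"
    using eventually_ae_filter_negligible[of "\<lambda>x. ennreal (p x) = ennreal (m x)"] by auto
  have "{x \<in> {a..b}. h x \<noteq> 0} \<subseteq> N \<union> N'"
  proof (clarify)
    fix x assume x: "x \<in> {a..b}" "h x \<noteq> 0" "x \<notin> N'"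
    show "x \<in> N"
    proof (rule ccontr)
      assume "x \<notin> N"
      then have "h' x = h x" using h'(3) x by auto
      moreover have "ennreal (p x) = ennreal (m x)" using N'(2) x by blast
      ultimately show False using x by (auto simp: p_def m_def max_def split: if_splits)
    qed
  qed
  then show ?thesis
    using h'(2) N'(1) negligible_Un negligible_subset by blast
qed

text \<open>This says that \<open>f\<close> is absolutely continuous on the interval and that
  \<open>g\<close> represents its derivative; \<open>g\<close> may be changed on null sets. All weak
  derivatives are converted to this form, in which they can be multiplied, restricted and glued. For
  \<open>b < a\<close> it holds trivially, which saves side conditions.\<close>

definition primitive :: "real \<Rightarrow> real \<Rightarrow> (real \<Rightarrow> real) \<Rightarrow> (real \<Rightarrow> real) \<Rightarrow> bool" where
  "primitive a b f g \<longleftrightarrow> g absolutely_integrable_on {a..b} \<and> (\<forall>x\<in>{a..b}. f x = f a + integral {a..x} g)"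

lemma primitiveD:
  assumes "primitive a b f g"
  shows "g absolutely_integrable_on {a..b}" "g integrable_on {a..b}"
    "\<And>x. x \<in> {a..b} \<Longrightarrow> f x = f a + integral {a..x} g" "continuous_on {a..b} f"
    "\<And>x y. a \<le> x \<Longrightarrow> x \<le> y \<Longrightarrow> y \<le> b \<Longrightarrow> f y - f x = integral {x..y} g"
proof -
  show 1: "g absolutely_integrable_on {a..b}" and 2: "g integrable_on {a..b}"
    and 3: "\<And>x. x \<in> {a..b} \<Longrightarrow> f x = f a + integral {a..x} g"
    using assms unfolding primitive_def absolutely_integrable_on_def by blast+
  have "continuous_on {a..b} (\<lambda>x. f a + integral {a..x} g)"
    by (intro continuous_intros indefinite_integral_continuous_1 2)
  then show "continuous_on {a..b} f"
    by (rule continuous_on_eq) (rule 3[symmetric])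
  show "f y - f x = integral {x..y} g" if "a \<le> x" "x \<le> y" "y \<le> b" for x y
  proof -
    have "f y = f a + integral {a..y} g" "f x = f a + integral {a..x} g"
      by (rule 3; use that in simp)+
    then show ?thesis using integral_Icc_diff[OF 1, of x y] that by simp
  qed
qed

lemma primitive_subinterval:
  assumes "primitive a b f g" "a \<le> c" "d \<le> b"
  shows "primitive c d f g"
proof (cases "c \<le> d")
  case True
  show ?thesis
    unfolding primitive_def
  proof (intro conjI ballI)
    show "g absolutely_integrable_on {c..d}"
      using absolutely_integrable_on_Icc_subset[OF primitiveD(1)[OF assms(1)]] assms by auto
    show "f x = f c + integral {c..x} g" if "x \<in> {c..d}" for x
      using primitiveD(5)[OF assms(1), of c x] assms that by auto
  qed
qed (auto simp: primitive_def)

lemma primitive_unique: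
  assumes "primitive a b f g" "primitive a b f k"
  shows "negligible {x \<in> {a..b}. g x \<noteq> k x}"
proof -
  have "negligible {x \<in> {a..b}. g x - k x \<noteq> 0}"
  proof (rule indefinite_integral_0_imp_negligible)
    show "(\<lambda>x. g x - k x) absolutely_integrable_on {a..b}"
      using primitiveD(1)[OF assms(1)] primitiveD(1)[OF assms(2)] by (rule set_integral_diff)
    show "integral {a..x} (\<lambda>x. g x - k x) = 0" if x: "x \<in> {a..b}" for x
    proof -
      have "g integrable_on {a..x}" "k integrable_on {a..x}"
        using primitiveD(2)[OF primitive_subinterval[OF assms(1), of a x]]
          primitiveD(2)[OF primitive_subinterval[OF assms(2), of a x]] x by auto
      then show ?thesis
        using primitiveD(3)[OF assms(1) x] primitiveD(3)[OF assms(2) x]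
        by (simp add: Henstock_Kurzweil_Integration.integral_diff)
    qed
  qed
  then show ?thesis by simp
qed

lemma primitive_cong_ae:
  assumes "primitive a b f g" "negligible {x \<in> {a..b}. g x \<noteq> k x}"
  shows "primitive a b f k"
  unfolding primitive_def
proof (intro conjI ballI)
  show "k absolutely_integrable_on {a..b}"
    by (rule absolutely_integrable_spike[OF primitiveD(1)[OF assms(1)] assms(2)]) auto
  show "f x = f a + integral {a..x} k" if "x \<in> {a..b}" for x
  proof -
    have "integral {a..x} g = integral {a..x} k"
      by (rule integral_spike[OF assms(2)]) (use that in auto)
    then show ?thesis using primitiveD(3)[OF assms(1) that] by simp
  qed
qed

lemma primitive_add:
  assumes "primitive a b f g" "primitive a b h k"
  shows "primitive a b (\<lambda>x. f x + h x) (\<lambda>x. g x + k x)"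
  unfolding primitive_def
proof (intro conjI ballI)
  show "(\<lambda>x. g x + k x) absolutely_integrable_on {a..b}"
    using primitiveD(1)[OF assms(1)] primitiveD(1)[OF assms(2)] by (rule set_integral_add)
  show "f x + h x = f a + h a + integral {a..x} (\<lambda>x. g x + k x)" if x: "x \<in> {a..b}" for x
  proof -
    have "g integrable_on {a..x}" "k integrable_on {a..x}"
      using primitiveD(2)[OF primitive_subinterval[OF assms(1), of a x]]
        primitiveD(2)[OF primitive_subinterval[OF assms(2), of a x]] x by auto
    then show ?thesis
      using primitiveD(3)[OF assms(1) x] primitiveD(3)[OF assms(2) x]
      by (simp add: Henstock_Kurzweil_Integration.integral_add)
  qed
qed

lemma primitive_cmult:
  assumes "primitive a b f g"
  shows "primitive a b (\<lambda>x. c * f x) (\<lambda>x. c * g x)"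
  unfolding primitive_def
proof (intro conjI ballI)
  show "(\<lambda>x. c * g x) absolutely_integrable_on {a..b}"
    using primitiveD(1)[OF assms(1)] by simp
  show "c * f x = c * f a + integral {a..x} (\<lambda>x. c * g x)" if "x \<in> {a..b}" for x
    using primitiveD(3)[OF assms(1) that] by (simp add: algebra_simps)
qed

lemma primitive_diff:
  assumes "primitive a b f g" "primitive a b h k"
  shows "primitive a b (\<lambda>x. f x - h x) (\<lambda>x. g x - k x)"
  using primitive_add[OF assms(1) primitive_cmult[OF assms(2), of "-1"]] by simp

lemma primitive_const: "primitive a b (\<lambda>x. c) (\<lambda>x. 0)"
  by (simp add: primitive_def)

lemma primitiveI_C1:
  assumes "\<And>x. x \<in> {a..b} \<Longrightarrow> (f has_real_derivative g x) (at x within {a..b})" "continuous_on {a..b} g"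
  shows "primitive a b f g"
  unfolding primitive_def
proof (intro conjI ballI)
  show "g absolutely_integrable_on {a..b}"
    using assms(2) by (rule absolutely_integrable_continuous_real)
  show "f x = f a + integral {a..x} g" if x: "x \<in> {a..b}" for x
  proof -
    have "(g has_integral (f x - f a)) {a..x}"
      by (rule fundamental_theorem_of_calculus)
         (use x in \<open>auto intro!: has_vector_derivative_within_subset[OF assms(1)[unfolded has_real_derivative_iff_has_vector_derivative]]\<close>)
    then show ?thesis by (auto simp: integral_unique)
  qed
qed

text \<open>Fubini's theorem on the two triangles of the square \<open>[a, b]\<^sup>2\<close>.\<close>

lemma integral_parts_indefinite:
  fixes g k :: "real \<Rightarrow> real"
  assumes "a \<le> b" and g: "g absolutely_integrable_on {a..b}" and k: "k absolutely_integrable_on {a..b}"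
  shows "integral {a..b} (\<lambda>x. integral {a..x} g * k x) + integral {a..b} (\<lambda>x. g x * integral {a..x} k)
    = integral {a..b} g * integral {a..b} k"
proof -
  obtain g' N where g': "integrable lborel g'" "negligible N"
    "\<And>x. x \<notin> N \<Longrightarrow> g' x = (if x \<in> {a..b} then g x else 0)"
    using absolutely_integrable_on_borel_version[OF g] by blast
  obtain k' N' where k': "integrable lborel k'" "negligible N'"
    "\<And>x. x \<notin> N' \<Longrightarrow> k' x = (if x \<in> {a..b} then k x else 0)"
    using absolutely_integrable_on_borel_version[OF k] by blast
  have [measurable]: "g' \<in> borel_measurable borel" "k' \<in> borel_measurable borel"
    using g'(1) k'(1) by auto
  \<comment> \<open>Integrating over this triangle first in y produces the integral of
    \<open>k\<close> up to x; first in x it produces the integral of \<open>g\<close> from y on.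
    Equating the two is the claim.\<close>
  let ?T = "{z :: real \<times> real. snd z \<le> fst z}"
  have T: "?T \<in> sets borel"
    by (intro borel_closed closed_Collect_le continuous_intros)
  then have [measurable]: "?T \<in> sets (borel \<Otimes>\<^sub>M borel)"
    unfolding borel_prod .
  have int: "integrable (lborel \<Otimes>\<^sub>M lborel) (\<lambda>(x, y). g' x * k' y)"
  proof (rule lborel_pair.Fubini_integrable)
    show "integrable lborel (\<lambda>x. LINT y|lborel. norm (case (x, y) of (x, y) \<Rightarrow> g' x * k' y))"
      using g'(1) by (simp add: abs_mult)
    show "AE x in lborel. integrable lborel (\<lambda>y. case (x, y) of (x, y) \<Rightarrow> g' x * k' y)"
      using k'(1) by simp
  qed auto
  have "integrable (lborel \<Otimes>\<^sub>M lborel) (\<lambda>z. indicator ?T z *\<^sub>R (case z of (x, y) \<Rightarrow> g' x * k' y))"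
    by (rule integrable_mult_indicator) (use int T in \<open>auto simp: lborel_prod\<close>)
  then have intT: "integrable (lborel \<Otimes>\<^sub>M lborel) (\<lambda>(x, y). indicator {..x} y * (g' x * k' y))"
    by (rule Bochner_Integration.integrable_cong[THEN iffD1, rotated -1]) (auto simp: indicator_def)
  have in1: "integrable lborel (\<lambda>x. LINT y|lborel. indicator {..x} y * (g' x * k' y))"
    and in2: "(LINT y|lborel. LINT x|lborel. indicator {..x} y * (g' x * k' y))
      = (LINT x|lborel. LINT y|lborel. indicator {..x} y * (g' x * k' y))"
    using lborel_pair.integrable_fst[OF intT] lborel_pair.Fubini_integral[OF intT] by auto
  have in3: "integrable lborel (\<lambda>y. LINT x|lborel. indicator {..x} y * (g' x * k' y))"
    using lborel_pair.integrable_snd[OF intT] by auto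
  have ig: "integrable lborel (\<lambda>x. indicator A x * g' x)" if "A \<in> sets borel" for A
    using integrable_mult_indicator[OF _ g'(1), of A] that by simp
  have e1: "(LINT y|lborel. indicator {..x} y * (g' x * k' y)) = g' x * (LINT y|lborel. indicator {..x} y * k' y)" for x
  proof -
    have "(LINT y|lborel. indicator {..x} y * (g' x * k' y)) = (LINT y|lborel. g' x * (indicator {..x} y * k' y))"
      by (rule Bochner_Integration.integral_cong) (auto simp: algebra_simps)
    then show ?thesis by simp
  qed
  have e1': "(LINT y|lborel. indicator {..x} y * k' y) = integral {a..x} k" if "x \<in> {a..b}" for x
    by (rule integral_borel_version[OF k']) (use that in auto)
  have e2: "(LINT x|lborel. indicator {..x} y * (g' x * k' y)) = k' y * (LINT x|lborel. indicator {y..} x * g' x)" for y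
  proof -
    have "(LINT x|lborel. indicator {..x} y * (g' x * k' y)) = (LINT x|lborel. k' y * (indicator {y..} x * g' x))"
      by (rule Bochner_Integration.integral_cong) (auto simp: algebra_simps indicator_def)
    then show ?thesis by simp
  qed
  have e2': "(LINT x|lborel. indicator {y..} x * g' x) = integral {a..b} g - integral {a..y} g" if "y \<in> {a..b}" for y
  proof -
    have "(LINT x|lborel. indicator {y..} x * g' x) = integral {y..b} g"
      by (rule integral_borel_version[OF g']) (use that in auto)
    then show ?thesis using integral_Icc_diff[OF g, of y b] that by auto
  qed
  have gk: "(\<lambda>x. integral {a..x} g * k x) integrable_on {a..b}" "(\<lambda>x. g x * integral {a..x} k) integrable_on {a..b}"
  proof -
    have c: "continuous_on {a..b} (\<lambda>x. integral {a..x} g)" "continuous_on {a..b} (\<lambda>x. integral {a..x} k)"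
      using g k by (auto intro!: indefinite_integral_continuous_1 simp: absolutely_integrable_on_def)
    have *: "(\<lambda>x. f x * h x) absolutely_integrable_on {a..b}"
      if "continuous_on {a..b} f" "h absolutely_integrable_on {a..b}" for f h :: "real \<Rightarrow> real"
      by (rule absolutely_integrable_bounded_measurable_product_real)
         (use that in \<open>auto intro!: continuous_imp_measurable_on_sets_lebesgue compact_imp_bounded compact_continuous_image\<close>)
    show "(\<lambda>x. integral {a..x} g * k x) integrable_on {a..b}"
      using *[OF c(1) k] by (simp add: absolutely_integrable_on_def)
    have "(\<lambda>x. integral {a..x} k * g x) integrable_on {a..b}"
      using *[OF c(2) g] by (simp add: absolutely_integrable_on_def)
    then show "(\<lambda>x. g x * integral {a..x} k) integrable_on {a..b}"
      by (simp add: mult.commute)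
  qed
  have "(LINT x|lborel. LINT y|lborel. indicator {..x} y * (g' x * k' y))
      = integral UNIV (\<lambda>x. LINT y|lborel. indicator {..x} y * (g' x * k' y))"
    using in1 by (simp add: integral_lborel)
  also have "\<dots> = integral UNIV (\<lambda>x. if x \<in> {a..b} then g x * integral {a..x} k else 0)"
    unfolding e1 by (rule integral_spike[OF g'(2)]) (auto simp: e1' g'(3))
  also have "\<dots> = integral {a..b} (\<lambda>x. g x * integral {a..x} k)"
    by (simp only: integral_restrict_UNIV)
  finally have L: "(LINT x|lborel. LINT y|lborel. indicator {..x} y * (g' x * k' y)) =
    integral {a..b} (\<lambda>x. g x * integral {a..x} k)" .
  have "(LINT y|lborel. LINT x|lborel. indicator {..x} y * (g' x * k' y))
      = integral UNIV (\<lambda>y. LINT x|lborel. indicator {..x} y * (g' x * k' y))"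
    using in3 by (simp add: integral_lborel)
  also have "\<dots> = integral UNIV (\<lambda>x. if x \<in> {a..b} then k x * (integral {a..b} g - integral {a..x} g) else 0)"
    unfolding e2 by (rule integral_spike[OF k'(2)]) (auto simp: e2' k'(3))
  also have "\<dots> = integral {a..b} (\<lambda>x. k x * (integral {a..b} g - integral {a..x} g))"
    by (simp only: integral_restrict_UNIV)
  also have "\<dots> = integral {a..b} (\<lambda>x. integral {a..b} g * k x - integral {a..x} g * k x)"
    by (simp add: algebra_simps)
  also have "\<dots> = integral {a..b} g * integral {a..b} k - integral {a..b} (\<lambda>x. integral {a..x} g * k x)"
    using gk k by (subst Henstock_Kurzweil_Integration.integral_diff)
      (auto simp: absolutely_integrable_on_def integrable_on_mult_right)
  finally show ?thesis using L in2 by linarith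
qed

lemma absolutely_integrable_continuous_mult:
  fixes f h :: "real \<Rightarrow> real"
  assumes "continuous_on {a..b} f" "h absolutely_integrable_on {a..b}"
  shows "(\<lambda>x. f x * h x) absolutely_integrable_on {a..b}"
  by (rule absolutely_integrable_bounded_measurable_product_real)
     (use assms in \<open>auto intro!: continuous_imp_measurable_on_sets_lebesgue compact_imp_bounded compact_continuous_image\<close>)

text \<open>After the values \<open>f a\<close> and \<open>h a\<close> are split off, the product
  rule becomes the Fubini identity \<open>integral_parts_indefinite\<close>; the remaining terms are
  linear.\<close>

lemma primitive_mult:
  assumes f: "primitive a b f g" and h: "primitive a b h k"
  shows "primitive a b (\<lambda>x. f x * h x) (\<lambda>x. f x * k x + h x * g x)"
  unfolding primitive_def
proof (intro conjI ballI)
  show ai: "(\<lambda>x. f x * k x + h x * g x) absolutely_integrable_on {a..b}"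
    by (intro set_integral_add absolutely_integrable_continuous_mult primitiveD[OF f] primitiveD[OF h])
  fix x assume x: "x \<in> {a..b}"
  note f' = primitive_subinterval[OF f, of a x] and h' = primitive_subinterval[OF h, of a x]
  let ?G = "\<lambda>y. integral {a..y} g" and ?K = "\<lambda>y. integral {a..y} k"
  have fx: "primitive a x f g" "primitive a x h k" using f' h' x by auto
  have gi: "g absolutely_integrable_on {a..x}" "k absolutely_integrable_on {a..x}"
    using primitiveD(1)[OF fx(1)] primitiveD(1)[OF fx(2)] .
  have c: "continuous_on {a..x} ?G" "continuous_on {a..x} ?K"
    using primitiveD(2)[OF fx(1)] primitiveD(2)[OF fx(2)] by (auto intro!: indefinite_integral_continuous_1)
  have i: "(\<lambda>y. ?G y * k y) integrable_on {a..x}" "(\<lambda>y. ?K y * g y) integrable_on {a..x}"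
    using absolutely_integrable_continuous_mult[OF c(1) gi(2)] absolutely_integrable_continuous_mult[OF c(2) gi(1)]
    by (auto simp: absolutely_integrable_on_def)
  have gk: "g integrable_on {a..x}" "k integrable_on {a..x}" using gi by (auto simp: absolutely_integrable_on_def)
  have fy: "f y * k y + h y * g y = (?G y * k y + ?K y * g y) + (f a * k y + h a * g y)"
    if "y \<in> {a..x}" for y
    using primitiveD(3)[OF fx(1) that] primitiveD(3)[OF fx(2) that] by (simp add: algebra_simps)
  have "integral {a..x} (\<lambda>y. f y * k y + h y * g y)
      = integral {a..x} (\<lambda>y. (?G y * k y + ?K y * g y) + (f a * k y + h a * g y))"
    by (rule Henstock_Kurzweil_Integration.integral_cong) (rule fy)
  also have "\<dots> = (integral {a..x} (\<lambda>y. ?G y * k y) + integral {a..x} (\<lambda>y. ?K y * g y))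
      + (f a * ?K x + h a * ?G x)"
    using i gk by (simp add: Henstock_Kurzweil_Integration.integral_add integrable_add integrable_on_mult_right)
  also have "\<dots> = ?G x * ?K x + (f a * ?K x + h a * ?G x)"
    using integral_parts_indefinite[OF _ gi] x by (auto simp: mult.commute)
  also have "\<dots> = f x * h x - f a * h a"
    using primitiveD(3)[OF f x] primitiveD(3)[OF h x] by (simp add: algebra_simps)
  finally show "f x * h x = f a * h a + integral {a..x} (\<lambda>x. f x * k x + h x * g x)" by simp
qed

section \<open>Weak derivatives in one dimension\<close>

lemma continuous_on_ae_0_imp_0:
  fixes f :: "real \<Rightarrow> real"
  assumes "a < b" "continuous_on {a..b} f" "negligible {x \<in> {a..b}. f x \<noteq> 0}" "x \<in> {a..b}"
  shows "f x = 0"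
proof -
  have "open ({a<..<b} \<inter> f -` (- {0}))"
    by (rule continuous_open_preimage) (use assms(2) in \<open>auto intro: continuous_on_subset\<close>)
  moreover have "negligible ({a<..<b} \<inter> f -` (- {0}))"
    by (rule negligible_subset[OF assms(3)]) auto
  ultimately have 0: "f y = 0" if "y \<in> {a<..<b}" for y
    using open_not_negligible that by blast
  have "f x = 0" if "x \<in> closure {a<..<b}"
    by (rule continuous_constant_on_closure[of "{a<..<b}" f 0]) (use assms(1,2) 0 that in auto)
  then show ?thesis using assms(1,4) by simp
qed

text \<open>Subtracting the indefinite integral of \<open>g\<close> leaves an \<open>h\<close> that
  is orthogonal to all derivatives of test functions, that is, to all test functions of mean zero.
  Hence \<open>h - c\<close> is orthogonal to every test function for a suitable constant, and
  approximating indicators of subintervals shows that \<open>h = c\<close> almost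
  everywhere.\<close>

lemma du_Bois_Reymond:
  fixes f g :: "real \<Rightarrow> real"
  assumes "a < b" and f: "f absolutely_integrable_on {a..b}" and g: "g absolutely_integrable_on {a..b}"
    and H: "\<And>\<phi> \<phi>'. \<lbrakk>\<And>k. C_k k \<phi>; \<And>x. x \<notin> {a<..<b} \<Longrightarrow> \<phi> x = 0;
        \<And>x. (\<phi> has_real_derivative \<phi>' x) (at x); continuous_on UNIV \<phi>'\<rbrakk>
      \<Longrightarrow> integral {a..b} (\<lambda>x. f x * \<phi>' x) = - integral {a..b} (\<lambda>x. g x * \<phi> x)"
  shows "\<exists>F. primitive a b F g \<and> negligible {x \<in> {a..b}. f x \<noteq> F x}"
proof -
  define G where "G x = integral {a..x} g" for x
  have G: "primitive a b G g"
    using g by (auto simp: primitive_def G_def)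
  define h where "h x = f x - G x" for x
  have Gai: "G absolutely_integrable_on {a..b}"
    by (rule absolutely_integrable_continuous_real[OF primitiveD(4)[OF G]])
  have h: "h absolutely_integrable_on {a..b}"
    unfolding h_def [abs_def] using f Gai by (rule set_integral_diff)
  have hm: "(\<lambda>x. q x * p x) integrable_on {a..b}"
    if "continuous_on UNIV p" "q absolutely_integrable_on {a..b}" for p q :: "real \<Rightarrow> real"
    using absolutely_integrable_continuous_mult[of a b p q] that continuous_on_subset
    by (fastforce simp: absolutely_integrable_on_def mult.commute)
  have h0: "integral {a..b} (\<lambda>x. h x * \<phi>' x) = 0"
    if \<phi>: "\<And>k. C_k k \<phi>" "\<And>x. x \<notin> {a<..<b} \<Longrightarrow> \<phi> x = 0"
      "\<And>x. (\<phi> has_real_derivative \<phi>' x) (at x)" "continuous_on UNIV \<phi>'" for \<phi> \<phi>'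
  proof -
    have c\<phi>: "continuous_on UNIV \<phi>" using \<phi>(1)[of 0] by simp
    have "primitive a b \<phi> \<phi>'"
      by (rule primitiveI_C1[OF has_field_derivative_at_within[OF \<phi>(3)] continuous_on_subset[OF \<phi>(4)]]) auto
    from primitiveD(5)[OF primitive_mult[OF G this], of a b]
    have "integral {a..b} (\<lambda>x. G x * \<phi>' x + \<phi> x * g x) = 0"
      using \<open>a < b\<close> \<phi>(2)[of a] \<phi>(2)[of b] by simp
    moreover have "integral {a..b} (\<lambda>x. G x * \<phi>' x + \<phi> x * g x)
      = integral {a..b} (\<lambda>x. G x * \<phi>' x) + integral {a..b} (\<lambda>x. g x * \<phi> x)"
      by (subst Henstock_Kurzweil_Integration.integral_add[symmetric])
         (use hm[OF \<phi>(4) Gai] hm[OF c\<phi> g] in \<open>auto simp: mult.commute\<close>)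
    moreover have "integral {a..b} (\<lambda>x. h x * \<phi>' x)
      = integral {a..b} (\<lambda>x. f x * \<phi>' x) - integral {a..b} (\<lambda>x. G x * \<phi>' x)"
      by (subst Henstock_Kurzweil_Integration.integral_diff[symmetric])
         (use hm[OF \<phi>(4) Gai] hm[OF \<phi>(4) f] in \<open>auto simp: h_def algebra_simps\<close>)
    ultimately show ?thesis using H[OF \<phi>] by simp
  qed
  define I where "I = integral {a..b} (bump a b)"
  have cb: "continuous_on UNIV (bump a b)" using C_k_bump[of 0 a b] by simp
  then have bi: "bump a b integrable_on {a..b}"
    by (meson continuous_on_subset integrable_continuous_real top_greatest)
  have "I \<noteq> 0"
  proof
    assume "I = 0"
    then have "\<forall>x\<in>{a..b}. bump a b x = 0"
      using integral_eq_0_iff[of a b "bump a b"] cb \<open>a < b\<close> bump_nonneg continuous_on_subset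
      unfolding I_def by blast
    then show False using bump_pos[of a "(a + b) / 2" b] \<open>a < b\<close> by force
  qed
  \<comment> \<open>The constant for which \<open>h - c\<close> is orthogonal to the bump. Every
    test function is a multiple of the bump plus one of mean zero, so orthogonality to all of them
    follows.\<close>
  define c where "c = integral {a..b} (\<lambda>x. h x * bump a b x) / I"
  have hc: "integral {a..b} (\<lambda>x. (h x - c) * \<psi> x) = 0"
    if \<psi>: "\<And>k. C_k k \<psi>" "\<And>x. x \<notin> {a<..<b} \<Longrightarrow> \<psi> x = 0" for \<psi>
  proof -
    define s where "s = integral {a..b} \<psi>"
    define \<eta> where "\<eta> x = \<psi> x + (- s / I) * bump a b x" for x
    have C\<eta>: "C_k k \<eta>" for k
      unfolding \<eta>_def [abs_def] by (intro C_k_add C_k_mult C_k_const C_k_bump \<psi>)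
    have \<eta>0: "\<eta> x = 0" if "x \<notin> {a<..<b}" for x
      using that \<psi>(2) bump_eq_0 by (simp add: \<eta>_def)
    have c\<eta>: "continuous_on T \<eta>" for T
      using C\<eta>[of 0] continuous_on_subset by auto
    have c\<psi>: "continuous_on UNIV \<psi>" using \<psi>(1)[of 0] by simp
    then have i\<psi>: "\<psi> integrable_on {a..b}"
      by (meson continuous_on_subset integrable_continuous_real top_greatest)
    have int\<eta>: "integral {a..b} \<eta> = 0"
    proof -
      have "integral {a..b} \<eta> = s + integral {a..b} (\<lambda>x. (- s / I) * bump a b x)"
        unfolding \<eta>_def s_def
        by (rule Henstock_Kurzweil_Integration.integral_add) (rule i\<psi>, rule integrable_on_mult_right[OF bi])
      also have "\<dots> = s + (- s / I) * I"
        unfolding I_def by (subst integral_mult_right) simp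
      finally show ?thesis using \<open>I \<noteq> 0\<close> by simp
    qed
    \<comment> \<open>The lower limit lies to the left of \<open>a\<close>, so that the derivative
      at \<open>a\<close> is already two-sided.\<close>
    define \<phi> where "\<phi> x = integral {a - 1..x} \<eta>" for x
    have \<phi>lt: "\<phi> x = 0" if "x \<le> a" for x
    proof -
      have "\<phi> x = integral {a - 1..x} (\<lambda>x. 0)"
        unfolding \<phi>_def by (rule Henstock_Kurzweil_Integration.integral_cong) (use \<eta>0 that in auto)
      then show ?thesis by simp
    qed
    have \<phi>ge: "\<phi> x = 0" if "b \<le> x" for x
    proof -
      have "\<phi> x = integral {a..b} \<eta>"
        unfolding \<phi>_def by (rule integral_spike_set; rule negligible_subset[OF negligible_empty])
          (use \<eta>0 that in force)+
      then show ?thesis using int\<eta> by simp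
    qed
    have d\<phi>: "(\<phi> has_real_derivative \<eta> x) (at x)" for x
    proof (cases "x < a")
      case True
      have "((\<lambda>x. 0) has_real_derivative \<eta> x) (at x)"
        using \<eta>0 True by auto
      then show ?thesis
        by (rule has_field_derivative_transform_within_open[where S = "{..<a}"]) (use True \<phi>lt in auto)
    next
      case False
      have "((\<lambda>x. integral {a - 1..x} \<eta>) has_real_derivative \<eta> x) (at x within {a - 1..x + 1})"
        by (rule integral_has_real_derivative) (use False c\<eta> in auto)
      then show ?thesis
        using at_within_interior[of x "{a - 1..x + 1}"] False unfolding \<phi>_def by auto
    qed
    have C\<phi>: "C_k k \<phi>" for k
    proof (cases k)
      case 0
      then show ?thesis using d\<phi> by (auto intro!: continuous_at_imp_continuous_on DERIV_isCont)
    next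
      case (Suc j)
      then show ?thesis using C_k_SucI[OF d\<phi> C\<eta>[of j]] by blast
    qed
    have "integral {a..b} (\<lambda>x. h x * \<eta> x) = 0"
      by (rule h0[OF C\<phi> _ d\<phi> c\<eta>]) (use \<phi>lt \<phi>ge in force)
    moreover have "integral {a..b} (\<lambda>x. h x * \<eta> x)
        = integral {a..b} (\<lambda>x. h x * \<psi> x + (- s / I) * (h x * bump a b x))"
      by (simp add: \<eta>_def algebra_simps)
    moreover have "\<dots> = integral {a..b} (\<lambda>x. h x * \<psi> x) + (- s / I) * integral {a..b} (\<lambda>x. h x * bump a b x)"
      by (subst Henstock_Kurzweil_Integration.integral_add)
         (rule hm[OF c\<psi> h], rule integrable_on_mult_right[OF hm[OF cb h]], simp)
    ultimately have "integral {a..b} (\<lambda>x. h x * \<psi> x) = c * s"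
      unfolding c_def by (simp add: field_simps)
    moreover have "integral {a..b} (\<lambda>x. (h x - c) * \<psi> x)
        = integral {a..b} (\<lambda>x. h x * \<psi> x - c * \<psi> x)"
      by (simp add: algebra_simps)
    moreover have "\<dots> = integral {a..b} (\<lambda>x. h x * \<psi> x) - c * s"
      unfolding s_def
      by (subst Henstock_Kurzweil_Integration.integral_diff)
         (use hm[OF c\<psi> h] i\<psi> in \<open>auto intro: integrable_on_mult_right simp: integral_mult_right\<close>)
    ultimately show ?thesis by simp
  qed
  have hcai: "(\<lambda>x. h x - c) absolutely_integrable_on {a..b}"
    using h by (intro set_integral_diff) auto
  have "integral {a..x} (\<lambda>y. h y - c) = 0" if x: "x \<in> {a..b}" for x
  proof -
    \<comment> \<open>A polynomial in the bump without constant term, hence again a test function.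
      Its values lie between 0 and 1, so \<bar>h - c\<bar> dominates the integrands.\<close>
    define \<psi> where "\<psi> j y = 1 + (- 1) * (1 + (- 1) * bump a x y) ^ j" for j :: nat and y
    have C\<psi>: "C_k k (\<psi> j)" for k j
      unfolding \<psi>_def [abs_def] by (intro C_k_add C_k_mult C_k_const C_k_bump C_k_power)
    have "(\<lambda>j. integral {a..b} (\<lambda>y. (h y - c) * \<psi> j y)) \<longlonglongrightarrow>
        integral {a..b} (\<lambda>y. if y \<in> {a<..<x} then h y - c else 0)"
    proof (rule dominated_convergence(2))
      show "(\<lambda>y. (h y - c) * \<psi> j y) integrable_on {a..b}" for j
        by (rule hm[OF _ hcai]) (use C\<psi>[of 0 j] in simp)
      show "(\<lambda>y. \<bar>h y - c\<bar>) integrable_on {a..b}"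
        using hcai by (simp add: absolutely_integrable_on_def)
      show "norm ((h y - c) * \<psi> j y) \<le> \<bar>h y - c\<bar>" for j y
      proof -
        have "(1 - bump a x y) ^ j \<le> 1" "0 \<le> (1 - bump a x y) ^ j"
          using bump_nonneg[of a x y] bump_less_1[of a x y] by (auto intro: power_le_one)
        then have "\<bar>\<psi> j y\<bar> \<le> 1" by (simp add: \<psi>_def)
        then show ?thesis by (simp add: abs_mult mult_left_le)
      qed
      show "(\<lambda>j. (h y - c) * \<psi> j y) \<longlonglongrightarrow> (if y \<in> {a<..<x} then h y - c else 0)" for y
      proof (cases "y \<in> {a<..<x}")
        case True
        have "(\<lambda>j. (h y - c) * (1 + (- 1) * (1 + (- 1) * bump a x y) ^ j)) \<longlonglongrightarrow> (h y - c) * (1 + (- 1) * 0)"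
          by (intro tendsto_intros LIMSEQ_realpow_zero)
             (use bump_pos[of a y x] bump_less_1[of a x y] True in auto)
        then show ?thesis using True by (simp add: \<psi>_def)
      qed (auto simp: \<psi>_def bump_eq_0)
    qed
    moreover have "integral {a..b} (\<lambda>y. (h y - c) * \<psi> j y) = 0" for j
    proof (rule hc)
      show "\<psi> j y = 0" if "y \<notin> {a<..<b}" for y
      proof -
        have "y \<notin> {a<..<x}" using that x by auto
        then show ?thesis by (simp add: \<psi>_def bump_eq_0)
      qed
    qed (rule C\<psi>)
    ultimately have "integral {a..b} (\<lambda>y. if y \<in> {a<..<x} then h y - c else 0) = 0"
      by (simp add: LIMSEQ_const_iff)
    also have "integral {a..b} (\<lambda>y. if y \<in> {a<..<x} then h y - c else 0) = integral {a<..<x} (\<lambda>y. h y - c)"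
    proof -
      have "{a<..<x} \<inter> {a..b} = {a<..<x}" using x by auto
      then show ?thesis
        using integral_restrict_Int[of "{a..b}" "{a<..<x}" "\<lambda>y. h y - c"] by simp
    qed
    also have "\<dots> = integral {a..x} (\<lambda>y. h y - c)"
      using integral_open_interval_real[of a x "\<lambda>y. h y - c"] by simp
    finally show ?thesis .
  qed
  then have "negligible {x \<in> {a..b}. h x - c \<noteq> 0}"
    by (rule indefinite_integral_0_imp_negligible[OF hcai])
  moreover have "primitive a b (\<lambda>x. G x + c) g"
    using primitive_add[OF G primitive_const[of a b c]] by simp
  ultimately show ?thesis
    by (intro exI[of _ "\<lambda>x. G x + c"]) (auto simp: h_def algebra_simps)
qed

lemma LINT_lebesgue_restrict:
  fixes F :: "real \<Rightarrow> real"
  assumes "F absolutely_integrable_on T" "\<And>x. x \<notin> T \<Longrightarrow> F x = 0"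
  shows "(LINT x|lebesgue. F x) = integral T F"
proof -
  have "(LINT x|lebesgue. F x) = (LINT x:T|lebesgue. F x)"
    unfolding set_lebesgue_integral_def
    by (rule Bochner_Integration.integral_cong) (use assms(2) in \<open>auto simp: indicator_def\<close>)
  then show ?thesis
    using set_lebesgue_integral_eq_integral(2)[OF assms(1)] by simp
qed

lemma locally_integrable_Icc:
  "locally_integrable S f \<Longrightarrow> {a..b} \<subseteq> S \<Longrightarrow> f absolutely_integrable_on {a..b}"
  unfolding locally_integrable_def by simp

lemma has_weak_deriv_imp_primitive_ae:
  assumes "has_weak_deriv S f g" "a < b" "{a..b} \<subseteq> S"
  shows "\<exists>F. primitive a b F g \<and> negligible {x \<in> {a..b}. f x \<noteq> F x}"
proof (rule du_Bois_Reymond[OF assms(2)])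
  show f: "f absolutely_integrable_on {a..b}" and g: "g absolutely_integrable_on {a..b}"
    using assms locally_integrable_Icc unfolding has_weak_deriv_def by blast+
  fix \<phi> \<phi>' :: "real \<Rightarrow> real"
  assume \<phi>: "\<And>k. C_k k \<phi>" "\<And>x. x \<notin> {a<..<b} \<Longrightarrow> \<phi> x = 0"
    "\<And>x. (\<phi> has_real_derivative \<phi>' x) (at x)" "continuous_on UNIV \<phi>'"
  have "test_function S \<phi>"
    by (rule test_functionI[of \<phi> a b]) (use \<phi> assms(3) in auto)
  moreover have "deriv \<phi> = \<phi>'" using \<phi>(3) DERIV_imp_deriv by blast
  ultimately have "(LINT x|lebesgue. f x * \<phi>' x) = - (LINT x|lebesgue. g x * \<phi> x)"
    using assms(1) unfolding has_weak_deriv_def by auto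
  moreover have "\<phi>' x = 0" if "x \<notin> {a..b}" for x
  proof -
    have "((\<lambda>x. 0) has_real_derivative \<phi>' x) (at x)"
      by (rule has_field_derivative_transform_within_open[OF \<phi>(3)[of x], of "- {a..b}"]) (use \<phi>(2) that in auto)
    then show ?thesis using DERIV_unique DERIV_const by blast
  qed
  moreover have "continuous_on {a..b} \<phi>" "continuous_on {a..b} \<phi>'"
    using \<phi>(1)[of 0] \<phi>(4) continuous_on_subset by auto
  moreover have "\<phi> x = 0" if "x \<notin> {a..b}" for x
    using \<phi>(2)[of x] that by auto
  ultimately show "integral {a..b} (\<lambda>x. f x * \<phi>' x) = - integral {a..b} (\<lambda>x. g x * \<phi> x)"
    using LINT_lebesgue_restrict[where F = "\<lambda>x. f x * \<phi>' x" and T = "{a..b}"]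
      LINT_lebesgue_restrict[where F = "\<lambda>x. g x * \<phi> x" and T = "{a..b}"]
      absolutely_integrable_continuous_mult[of a b \<phi>' f] absolutely_integrable_continuous_mult[of a b \<phi> g] f g \<phi>(2)
    by (auto simp: mult.commute)
qed

text \<open>The absolutely continuous representative and the continuous \<open>f\<close> agree
  almost everywhere, hence everywhere, because a null set contains no interval.\<close>

lemma has_weak_deriv_imp_primitive:
  assumes "has_weak_deriv S f g" "{a..b} \<subseteq> S" "continuous_on {a..b} f"
  shows "primitive a b f g"
proof (cases "a < b")
  case True
  then obtain F where F: "primitive a b F g" "negligible {x \<in> {a..b}. f x \<noteq> F x}"
    using has_weak_deriv_imp_primitive_ae assms by blast
  have fF: "f x - F x = 0" if "x \<in> {a..b}" for x
    by (rule continuous_on_ae_0_imp_0[OF True _ _ that])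
       (use F(2) in \<open>auto intro!: continuous_on_diff[OF assms(3) primitiveD(4)[OF F(1)]]\<close>)
  show ?thesis
    unfolding primitive_def
  proof (intro conjI ballI)
    show "f x = f a + integral {a..x} g" if "x \<in> {a..b}" for x
      using fF[OF that] fF[of a] primitiveD(3)[OF F(1) that] that by auto
  qed (rule primitiveD(1)[OF F(1)])
next
  case False
  have "g absolutely_integrable_on {a..b}"
    using assms locally_integrable_Icc unfolding has_weak_deriv_def by blast
  then show ?thesis using False by (cases "a = b") (auto simp: primitive_def)
qed

lemma has_weak_deriv_UNIV_I:
  assumes "\<And>a b. a < b \<Longrightarrow> primitive a b f g"
  shows "has_weak_deriv UNIV f g"
  unfolding has_weak_deriv_def
proof (intro conjI allI impI)
  have *: "locally_integrable UNIV h" if "\<And>a b. a < b \<Longrightarrow> h absolutely_integrable_on {a..b}" for h :: "real \<Rightarrow> real"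
    unfolding locally_integrable_def
  proof (intro allI impI)
    fix K :: "real set" assume K: "compact K \<and> K \<subseteq> UNIV"
    then obtain R where R: "R > 0" "\<And>x. x \<in> K \<Longrightarrow> norm x \<le> R"
      using compact_imp_bounded bounded_pos by metis
    have "K \<subseteq> {-R..R}" using R(2) by force
    moreover have "K \<in> sets lebesgue" using K fmeasurableD lmeasurable_compact by metis
    ultimately show "h absolutely_integrable_on K"
      using set_integrable_subset[OF that[of "-R" R]] R(1) by auto
  qed
  show "locally_integrable UNIV f"
    by (rule *) (use assms primitiveD(4) absolutely_integrable_continuous_real in blast)
  show "locally_integrable UNIV g"
    by (rule *) (use assms primitiveD(1) in blast)
  fix \<phi> :: "real \<Rightarrow> real" assume "test_function UNIV \<phi>"
  then obtain a b where ab: "a < b" "\<And>x. x \<notin> {a<..<b} \<Longrightarrow> \<phi> x = 0"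
    "\<And>x. (\<phi> has_real_derivative deriv \<phi> x) (at x)" "continuous_on UNIV (deriv \<phi>)"
    "\<And>x. x \<notin> {a<..<b} \<Longrightarrow> deriv \<phi> x = 0"
    by (rule test_functionD) blast
  have p: "primitive a b \<phi> (deriv \<phi>)"
    by (rule primitiveI_C1[OF has_field_derivative_at_within[OF ab(3)] continuous_on_subset[OF ab(4)]]) auto
  note f = assms[OF ab(1)]
  have ai: "(\<lambda>x. f x * deriv \<phi> x) absolutely_integrable_on {a..b}" "(\<lambda>x. g x * \<phi> x) absolutely_integrable_on {a..b}"
    using absolutely_integrable_continuous_mult[OF primitiveD(4)[OF f] primitiveD(1)[OF p]]
      absolutely_integrable_continuous_mult[OF primitiveD(4)[OF p] primitiveD(1)[OF f]]
    by (auto simp: mult.commute)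
  have "integral {a..b} (\<lambda>x. f x * deriv \<phi> x + \<phi> x * g x) = 0"
    using primitiveD(5)[OF primitive_mult[OF f p], of a b] ab by simp
  moreover have "integral {a..b} (\<lambda>x. f x * deriv \<phi> x + \<phi> x * g x)
    = integral {a..b} (\<lambda>x. f x * deriv \<phi> x) + integral {a..b} (\<lambda>x. g x * \<phi> x)"
    by (subst Henstock_Kurzweil_Integration.integral_add[symmetric])
       (use ai in \<open>auto simp: absolutely_integrable_on_def mult.commute\<close>)
  moreover have "deriv \<phi> x = 0" "\<phi> x = 0" if "x \<notin> {a..b}" for x
    using ab(2)[of x] ab(5)[of x] that by auto
  ultimately show "(LINT x|lebesgue. f x * deriv \<phi> x) = - (LINT x|lebesgue. g x * \<phi> x)"
    using LINT_lebesgue_restrict[OF ai(1)] LINT_lebesgue_restrict[OF ai(2)] by simp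
qed

text \<open>Needed because a solution comes with its own choice \<open>v\<close> of the first
  derivative, while the energy and its gradient use \<open>weak_deriv\<close>; the two agree only
  almost everywhere.\<close>

lemma has_weak_deriv_cong_ae:
  assumes f: "has_weak_deriv UNIV f g" and h: "locally_integrable UNIV h"
    and "\<And>a b. a < b \<Longrightarrow> negligible {x \<in> {a..b}. f x \<noteq> h x}"
  shows "has_weak_deriv UNIV h g"
  unfolding has_weak_deriv_def
proof (intro conjI allI impI h)
  show "locally_integrable UNIV g" using f unfolding has_weak_deriv_def by blast
  fix \<phi> :: "real \<Rightarrow> real" assume t: "test_function UNIV \<phi>"
  then obtain a b where ab: "a < b" "\<And>x. x \<notin> {a<..<b} \<Longrightarrow> \<phi> x = 0"
    "\<And>x. (\<phi> has_real_derivative deriv \<phi> x) (at x)" "continuous_on UNIV (deriv \<phi>)"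
    "\<And>x. x \<notin> {a<..<b} \<Longrightarrow> deriv \<phi> x = 0"
    by (rule test_functionD) blast
  have ai: "(\<lambda>x. q x * deriv \<phi> x) absolutely_integrable_on {a..b}" if "locally_integrable UNIV q" for q
    using absolutely_integrable_continuous_mult[OF _ locally_integrable_Icc[OF that], of a b "deriv \<phi>"]
      continuous_on_subset[OF ab(4)] by (auto simp: mult.commute)
  have f': "locally_integrable UNIV f" using f unfolding has_weak_deriv_def by blast
  have "(LINT x|lebesgue. h x * deriv \<phi> x) = integral {a..b} (\<lambda>x. h x * deriv \<phi> x)"
    by (rule LINT_lebesgue_restrict[OF ai[OF h]]) (use ab in auto)
  also have "\<dots> = integral {a..b} (\<lambda>x. f x * deriv \<phi> x)"
    by (rule integral_spike[OF assms(3)[OF ab(1)]]) auto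
  also have "\<dots> = (LINT x|lebesgue. f x * deriv \<phi> x)"
    by (rule LINT_lebesgue_restrict[OF ai[OF f'], symmetric]) (use ab in auto)
  finally show "(LINT x|lebesgue. h x * deriv \<phi> x) = - (LINT x|lebesgue. g x * \<phi> x)"
    using f t unfolding has_weak_deriv_def by simp
qed

section \<open>The Poincare-Wirtinger inequality\<close>

text \<open>Absolute integrability is included because it supplies measurability, which
  integrability of the square alone does not give.\<close>

definition L2_on :: "real \<Rightarrow> real \<Rightarrow> (real \<Rightarrow> real) \<Rightarrow> bool" where
  "L2_on a b g \<longleftrightarrow> g absolutely_integrable_on {a..b} \<and> (\<lambda>x. (g x)\<^sup>2) integrable_on {a..b}"

lemma L2_onD:
  assumes "L2_on a b g"
  shows "g absolutely_integrable_on {a..b}" "g integrable_on {a..b}" "(\<lambda>x. (g x)\<^sup>2) integrable_on {a..b}"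
  using assms by (auto simp: L2_on_def absolutely_integrable_on_def)

lemma L2_on_continuous: "continuous_on {a..b} g \<Longrightarrow> L2_on a b g"
  unfolding L2_on_def
  by (intro conjI absolutely_integrable_continuous_real integrable_continuous_real continuous_intros)

lemma L2_on_subinterval:
  assumes "L2_on a b g" "a \<le> c" "d \<le> b"
  shows "L2_on c d g"
  unfolding L2_on_def
proof
  show "g absolutely_integrable_on {c..d}"
    using absolutely_integrable_on_Icc_subset[OF L2_onD(1)[OF assms(1)]] assms by auto
  show "(\<lambda>x. (g x)\<^sup>2) integrable_on {c..d}"
    by (rule integrable_on_subinterval[OF L2_onD(3)[OF assms(1)]]) (use assms in auto)
qed

lemma L2_on_mult:
  assumes "L2_on a b g" "L2_on a b k"
  shows "(\<lambda>x. g x * k x) absolutely_integrable_on {a..b}" "(\<lambda>x. g x * k x) integrable_on {a..b}"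
proof -
  show 1: "(\<lambda>x. g x * k x) absolutely_integrable_on {a..b}"
  proof (rule measurable_bounded_by_integrable_imp_absolutely_integrable)
    show "(\<lambda>x. g x * k x) \<in> borel_measurable (lebesgue_on {a..b})"
      using L2_onD(1)[OF assms(1)] L2_onD(1)[OF assms(2)]
      by (intro borel_measurable_times absolutely_integrable_imp_borel_measurable) auto
    show "(\<lambda>x. (g x)\<^sup>2 + (k x)\<^sup>2) integrable_on {a..b}"
      by (intro integrable_add L2_onD assms)
    show "norm (g x * k x) \<le> (g x)\<^sup>2 + (k x)\<^sup>2" for x
    proof -
      have "2 * \<bar>g x * k x\<bar> \<le> (g x)\<^sup>2 + (k x)\<^sup>2"
        using sum_squares_bound[of "\<bar>g x\<bar>" "\<bar>k x\<bar>"] by (simp add: abs_mult)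
      then show ?thesis by simp
    qed
  qed auto
  then show "(\<lambda>x. g x * k x) integrable_on {a..b}"
    by (simp add: absolutely_integrable_on_def)
qed

lemma L2_on_add:
  assumes "L2_on a b g" "L2_on a b k"
  shows "L2_on a b (\<lambda>x. g x + k x)"
  unfolding L2_on_def
proof
  show "(\<lambda>x. g x + k x) absolutely_integrable_on {a..b}"
    by (intro set_integral_add L2_onD(1) assms)
  have "(\<lambda>x. (g x)\<^sup>2 + (k x)\<^sup>2 + 2 * (g x * k x)) integrable_on {a..b}"
    by (intro integrable_add L2_onD(3) assms integrable_on_mult_right L2_on_mult)
  then show "(\<lambda>x. (g x + k x)\<^sup>2) integrable_on {a..b}"
    by (simp add: power2_sum algebra_simps)
qed

lemma L2_on_cmult:
  assumes "L2_on a b g"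
  shows "L2_on a b (\<lambda>x. c * g x)"
  unfolding L2_on_def
proof
  show "(\<lambda>x. c * g x) absolutely_integrable_on {a..b}" using L2_onD(1)[OF assms] by simp
  show "(\<lambda>x. (c * g x)\<^sup>2) integrable_on {a..b}"
    unfolding power_mult_distrib by (rule integrable_on_mult_right[OF L2_onD(3)[OF assms]])
qed

lemma L2_on_diff: "L2_on a b g \<Longrightarrow> L2_on a b k \<Longrightarrow> L2_on a b (\<lambda>x. g x - k x)"
  using L2_on_add[OF _ L2_on_cmult[of a b k "-1"], of g] by simp

lemma L2_on_cong_ae:
  assumes "L2_on a b g" "negligible {x \<in> {a..b}. g x \<noteq> k x}"
  shows "L2_on a b k" "integral {a..b} (\<lambda>x. (k x)\<^sup>2) = integral {a..b} (\<lambda>x. (g x)\<^sup>2)"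
proof -
  show "L2_on a b k"
    unfolding L2_on_def
  proof
    show "k absolutely_integrable_on {a..b}"
      by (rule absolutely_integrable_spike[OF L2_onD(1)[OF assms(1)] assms(2)]) auto
    show "(\<lambda>x. (k x)\<^sup>2) integrable_on {a..b}"
      by (rule integrable_spike[OF L2_onD(3)[OF assms(1)] assms(2)]) auto
  qed
  show "integral {a..b} (\<lambda>x. (k x)\<^sup>2) = integral {a..b} (\<lambda>x. (g x)\<^sup>2)"
    by (rule integral_spike[OF assms(2)]) auto
qed

lemma quadratic_nonneg_imp_discriminant:
  fixes A B C :: real
  assumes "\<And>t. 0 \<le> A * t\<^sup>2 + 2 * C * t + B" "0 \<le> A"
  shows "C\<^sup>2 \<le> A * B"
proof (cases "A = 0")
  case True
  have "C = 0"
  proof (rule ccontr)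
    assume "C \<noteq> 0"
    then show False using assms(1)[of "- (B + 1) / (2 * C)"] True by (simp add: field_simps)
  qed
  then show ?thesis using True by simp
next
  case False
  then have "A > 0" using assms(2) by simp
  have "0 \<le> A * (A * (- C / A)\<^sup>2 + 2 * C * (- C / A) + B)"
    using assms(1)[of "- C / A"] \<open>A > 0\<close> by simp
  also have "\<dots> = A * B - C\<^sup>2"
    using \<open>A > 0\<close> by (simp add: field_simps power2_eq_square)
  finally show ?thesis by simp
qed

lemma Cauchy_Schwarz_integral_Icc:
  assumes g: "L2_on a b g" and k: "L2_on a b k"
  shows "(integral {a..b} (\<lambda>x. g x * k x))\<^sup>2 \<le> integral {a..b} (\<lambda>x. (g x)\<^sup>2) * integral {a..b} (\<lambda>x. (k x)\<^sup>2)"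
proof (rule quadratic_nonneg_imp_discriminant)
  show "0 \<le> integral {a..b} (\<lambda>x. (g x)\<^sup>2)"
    by (rule integral_nonneg) (auto intro: L2_onD g)
  fix t
  have "0 \<le> integral {a..b} (\<lambda>x. (t * g x + k x)\<^sup>2)"
    by (rule integral_nonneg[OF L2_onD(3)[OF L2_on_add[OF L2_on_cmult[OF g] k]]]) simp
  also have "\<dots> = integral {a..b} (\<lambda>x. (t\<^sup>2 * (g x)\<^sup>2 + (2 * t) * (g x * k x)) + (k x)\<^sup>2)"
    by (simp add: power2_eq_square algebra_simps)
  also have "\<dots> = (t\<^sup>2 * integral {a..b} (\<lambda>x. (g x)\<^sup>2) + (2 * t) * integral {a..b} (\<lambda>x. g x * k x))
      + integral {a..b} (\<lambda>x. (k x)\<^sup>2)"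
    using L2_onD(3)[OF g] L2_onD(3)[OF k] L2_on_mult(2)[OF g k]
    by (simp only: Henstock_Kurzweil_Integration.integral_add integrable_add integrable_on_mult_right integral_mult_right)
  finally show "0 \<le> integral {a..b} (\<lambda>x. (g x)\<^sup>2) * t\<^sup>2 + 2 * integral {a..b} (\<lambda>x. g x * k x) * t
      + integral {a..b} (\<lambda>x. (k x)\<^sup>2)"
    by (simp add: algebra_simps)
qed

lemma integral_square_subinterval:
  assumes "L2_on a b g" "a \<le> c" "d \<le> b"
  shows "integral {c..d} (\<lambda>x. (g x)\<^sup>2) \<le> integral {a..b} (\<lambda>x. (g x)\<^sup>2)"
  by (rule integral_subset_le) (use assms L2_on_subinterval[OF assms] in \<open>auto intro: L2_onD\<close>)

lemma primitive_Hoelder: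
  assumes f: "primitive a b f g" and g: "L2_on a b g" and "x \<in> {a..b}" "y \<in> {a..b}"
  shows "(f x - f y)\<^sup>2 \<le> \<bar>x - y\<bar> * integral {a..b} (\<lambda>x. (g x)\<^sup>2)"
proof -
  have *: "(f y - f x)\<^sup>2 \<le> \<bar>x - y\<bar> * integral {a..b} (\<lambda>x. (g x)\<^sup>2)"
    if xy: "x \<le> y" "x \<in> {a..b}" "y \<in> {a..b}" for x y
  proof -
    have g': "L2_on x y g" using L2_on_subinterval[OF g] xy by auto
    have "(f y - f x)\<^sup>2 = (integral {x..y} (\<lambda>x. 1 * g x))\<^sup>2"
      using primitiveD(5)[OF f, of x y] xy by simp
    also have "\<dots> \<le> integral {x..y} (\<lambda>x. 1\<^sup>2) * integral {x..y} (\<lambda>x. (g x)\<^sup>2)"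
      by (rule Cauchy_Schwarz_integral_Icc[OF L2_on_continuous g']) simp
    also have "\<dots> \<le> \<bar>x - y\<bar> * integral {a..b} (\<lambda>x. (g x)\<^sup>2)"
      using xy integral_square_subinterval[OF g, of x y] by (auto intro!: mult_left_mono)
    finally show ?thesis .
  qed
  show ?thesis
  proof (cases "x \<le> y")
    case True
    then show ?thesis using *[of x y] assms by (simp add: power2_commute)
  next
    case False
    then show ?thesis using *[of y x] assms by (simp add: abs_minus_commute)
  qed
qed

text \<open>If T' = q + T^2, then (g + f T)^2 >= 0 says that g^2 - q f^2 is at least the derivative
  of - f^2 T. With a tangent for T this gives sharp one-dimensional inequalities without Fourier
  series.\<close>

lemma Riccati_inequality:
  assumes f: "primitive c d f g" and g: "L2_on c d g" and "c \<le> d"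
    and T: "\<And>x. x \<in> {c..d} \<Longrightarrow> (T has_real_derivative q + (T x)\<^sup>2) (at x)"
  shows "integral {c..d} (\<lambda>x. (g x)\<^sup>2 - q * (f x)\<^sup>2) \<ge> (f c)\<^sup>2 * T c - (f d)\<^sup>2 * T d"
proof -
  have cT: "continuous_on {c..d} T"
    using T by (meson DERIV_isCont continuous_at_imp_continuous_on)
  have pT: "primitive c d T (\<lambda>x. q + (T x)\<^sup>2)"
    by (rule primitiveI_C1) (use T cT in \<open>auto intro!: continuous_intros intro: has_field_derivative_at_within\<close>)
  have P: "primitive c d (\<lambda>x. f x * f x * T x) (\<lambda>x. f x * f x * (q + (T x)\<^sup>2) + T x * (f x * g x + f x * g x))"
    by (rule primitive_mult[OF primitive_mult[OF f f] pT])
  have "- integral {c..d} (\<lambda>x. f x * f x * (q + (T x)\<^sup>2) + T x * (f x * g x + f x * g x))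
    = integral {c..d} (\<lambda>x. - (f x * f x * (q + (T x)\<^sup>2) + T x * (f x * g x + f x * g x)))"
    by (rule Henstock_Kurzweil_Integration.integral_neg[symmetric])
  also have "\<dots> \<le> integral {c..d} (\<lambda>x. (g x)\<^sup>2 - q * (f x)\<^sup>2)"
  proof (rule integral_le)
    show "(\<lambda>x. - (f x * f x * (q + (T x)\<^sup>2) + T x * (f x * g x + f x * g x))) integrable_on {c..d}"
      by (rule integrable_neg[OF primitiveD(2)[OF P]])
    show "(\<lambda>x. (g x)\<^sup>2 - q * (f x)\<^sup>2) integrable_on {c..d}"
      by (intro integrable_diff L2_onD(3)[OF g] integrable_on_mult_right L2_onD(3) L2_on_continuous primitiveD(4)[OF f])
    show "- (f x * f x * (q + (T x)\<^sup>2) + T x * (f x * g x + f x * g x)) \<le> (g x)\<^sup>2 - q * (f x)\<^sup>2" for x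
      using zero_le_power2[of "g x + f x * T x"] by (simp add: power2_eq_square algebra_simps)
  qed
  finally show ?thesis
    using primitiveD(5)[OF P, of c d] \<open>c \<le> d\<close> by (simp add: power2_eq_square)
qed

lemma has_real_derivative_scaled_tan:
  fixes \<kappa> \<theta> x :: real
  assumes "\<bar>\<kappa> * (x - \<theta>)\<bar> < pi / 2"
  shows "((\<lambda>x. \<kappa> * tan (\<kappa> * (x - \<theta>))) has_real_derivative \<kappa>\<^sup>2 + (\<kappa> * tan (\<kappa> * (x - \<theta>)))\<^sup>2) (at x)"
proof -
  have c: "cos (\<kappa> * (x - \<theta>)) \<noteq> 0"
    using cos_gt_zero_pi[of "\<kappa> * (x - \<theta>)"] assms by linarith
  have "((\<lambda>x. \<kappa> * tan (\<kappa> * (x - \<theta>))) has_real_derivative \<kappa> * (inverse ((cos (\<kappa> * (x - \<theta>)))\<^sup>2) * \<kappa>)) (at x)"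
    using c by (auto intro!: derivative_eq_intros DERIV_chain2[OF DERIV_tan])
  also have "inverse ((cos (\<kappa> * (x - \<theta>)))\<^sup>2) = 1 + (tan (\<kappa> * (x - \<theta>)))\<^sup>2"
    using tan_sec[OF c] by (simp add: power_inverse)
  also have "\<kappa> * ((1 + (tan (\<kappa> * (x - \<theta>)))\<^sup>2) * \<kappa>) = \<kappa>\<^sup>2 + (\<kappa> * tan (\<kappa> * (x - \<theta>)))\<^sup>2"
    by (simp add: power2_eq_square algebra_simps)
  finally show ?thesis .
qed

text \<open>A periodic \<open>f\<close> takes equal values at some \<open>a\<close> and \<open>a + \<pi>\<close>; after subtracting this value, the
  Dirichlet inequality holds on both half circles.\<close>

theorem Poincare_Wirtinger:
  assumes f: "primitive (-pi) pi f g" and g: "L2_on (-pi) pi g" and per: "f (-pi) = f pi"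
    and mean: "integral {-pi..pi} f = 0"
  shows "integral {-pi..pi} (\<lambda>x. (f x)\<^sup>2) \<le> integral {-pi..pi} (\<lambda>x. (g x)\<^sup>2)"
proof -
  have cf: "continuous_on {-pi..pi} f" using primitiveD(4)[OF f] .
  obtain a where a: "a \<in> {-pi..0}" "f (a + pi) = f a"
  proof -
    define d where "d x = f (x + pi) - f x" for x
    have cd: "continuous_on {-pi..0} d"
      unfolding d_def by (intro continuous_intros continuous_on_compose2[OF cf] continuous_on_subset[OF cf]) auto
    have "d (-pi) = - d 0" using per by (simp add: d_def)
    then have "\<exists>x\<in>{-pi..0}. d x = 0"
      using IVT'[of d "-pi" 0 0] IVT2'[of d 0 0 "-pi"] cd pi_ge_zero
      by (cases "d 0 \<ge> 0") (auto simp: Bex_def)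
    then show ?thesis using that by (auto simp: d_def)
  qed
  define h where "h x = f x - f a" for x
  have h: "primitive (-pi) pi h g"
    using primitive_diff[OF f primitive_const[of "-pi" pi "f a"]] by (simp add: h_def [abs_def])
  have ch: "continuous_on {-pi..pi} h" using primitiveD(4)[OF h] .
  have ih2: "(\<lambda>x. (h x)\<^sup>2) integrable_on {-pi..pi}" "(\<lambda>x. (f x)\<^sup>2) integrable_on {-pi..pi}" "f integrable_on {-pi..pi}"
    using ch cf by (auto intro!: integrable_continuous_real continuous_intros)
  have "integral {-pi..pi} (\<lambda>x. (h x)\<^sup>2) = integral {-pi..pi} (\<lambda>x. ((f x)\<^sup>2 - 2 * f a * f x) + (f a)\<^sup>2)"
    by (simp add: h_def power2_diff algebra_simps)
  also have "\<dots> = (integral {-pi..pi} (\<lambda>x. (f x)\<^sup>2) - 2 * f a * integral {-pi..pi} f) + integral {-pi..pi} (\<lambda>x. (f a)\<^sup>2)"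
    using ih2 by (simp only: Henstock_Kurzweil_Integration.integral_add Henstock_Kurzweil_Integration.integral_diff
        integrable_add integrable_diff integrable_on_mult_right integral_mult_right integrable_const_ivl)
  finally have fh: "integral {-pi..pi} (\<lambda>x. (f x)\<^sup>2) \<le> integral {-pi..pi} (\<lambda>x. (h x)\<^sup>2)"
    using mean by simp
  \<comment> \<open>A factor below 1 keeps the tangent away from its poles on intervals of
    half-length pi/2. The factor is sent to 1 at the end.\<close>
  have "z * integral {-pi..pi} (\<lambda>x. (h x)\<^sup>2) \<le> integral {-pi..pi} (\<lambda>x. (g x)\<^sup>2)" if z: "0 < z" "z < 1" for z
  proof -
    define \<kappa> where "\<kappa> = sqrt z"
    have \<kappa>: "0 < \<kappa>" "\<kappa> < 1" "\<kappa>\<^sup>2 = z" using z by (auto simp: \<kappa>_def)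
    define F where "F x = (g x)\<^sup>2 - \<kappa>\<^sup>2 * (h x)\<^sup>2" for x
    have iF: "F integrable_on {-pi..pi}"
      unfolding F_def by (intro integrable_diff L2_onD(3)[OF g] integrable_on_mult_right ih2)
    have R: "integral {c..d} F \<ge> (h c)\<^sup>2 * (\<kappa> * tan (\<kappa> * (c - \<theta>))) - (h d)\<^sup>2 * (\<kappa> * tan (\<kappa> * (d - \<theta>)))"
      if "-pi \<le> c" "c \<le> d" "d \<le> pi" "\<theta> - pi / 2 \<le> c" "d \<le> \<theta> + pi / 2" for c d \<theta>
      unfolding F_def
    proof (rule Riccati_inequality[OF primitive_subinterval[OF h] L2_on_subinterval[OF g]])
      fix x assume x: "x \<in> {c..d}"
      then have "c \<le> x" "x \<le> d" by auto
      then have "\<bar>x - \<theta>\<bar> \<le> pi / 2" using that by (intro abs_leI) linarith+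
      then have "\<kappa> * \<bar>x - \<theta>\<bar> \<le> \<kappa> * (pi / 2)" using \<kappa>(1) by (intro mult_left_mono) auto
      also have "\<dots> < pi / 2" using \<kappa>(2) by simp
      finally have "\<bar>\<kappa> * (x - \<theta>)\<bar> < pi / 2" using \<kappa>(1) by (simp add: abs_mult)
      then show "((\<lambda>x. \<kappa> * tan (\<kappa> * (x - \<theta>))) has_real_derivative \<kappa>\<^sup>2 + (\<kappa> * tan (\<kappa> * (x - \<theta>)))\<^sup>2) (at x)"
        by (rule has_real_derivative_scaled_tan)
    qed (use that in auto)
    have h0: "h a = 0" "h (a + pi) = 0" using a by (auto simp: h_def)
    have hpi: "h pi = h (-pi)" using per by (simp add: h_def)
    \<comment> \<open>The tangents on the two outer pieces are centred at \<open>a - pi / 2\<close>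
      and \<open>a + 3 * pi / 2\<close>, which differ by 2 pi. By periodicity their boundary terms
      at -pi and pi cancel, as if the second half circle were one interval.\<close>
    have "integral {-pi..a} F \<ge> (h (-pi))\<^sup>2 * (\<kappa> * tan (\<kappa> * (-pi - (a - pi / 2))))"
      using R[of "-pi" a "a - pi / 2"] a h0 by auto
    moreover have "integral {a..a + pi} F \<ge> 0"
      using R[of a "a + pi" "a + pi / 2"] a h0 by auto
    moreover have "integral {a + pi..pi} F \<ge> - ((h pi)\<^sup>2 * (\<kappa> * tan (\<kappa> * (pi - (a + 3 * pi / 2)))))"
      using R[of "a + pi" pi "a + 3 * pi / 2"] a h0 by auto
    moreover have "-pi - (a - pi / 2) = pi - (a + 3 * pi / 2)" by simp
    moreover have "integral {-pi..pi} F = integral {-pi..a} F + (integral {a..a + pi} F + integral {a + pi..pi} F)"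
      using Henstock_Kurzweil_Integration.integral_combine[of "-pi" a pi F]
        Henstock_Kurzweil_Integration.integral_combine[of a "a + pi" pi F]
        integrable_on_subinterval[OF iF, of a pi] iF a by auto
    ultimately have "integral {-pi..pi} F \<ge> 0" using hpi by simp
    moreover have "integral {-pi..pi} F = integral {-pi..pi} (\<lambda>x. (g x)\<^sup>2) - \<kappa>\<^sup>2 * integral {-pi..pi} (\<lambda>x. (h x)\<^sup>2)"
      unfolding F_def using ih2 L2_onD(3)[OF g]
      by (simp only: Henstock_Kurzweil_Integration.integral_diff integrable_on_mult_right integral_mult_right)
    ultimately show ?thesis using \<kappa>(3) by simp
  qed
  then have "integral {-pi..pi} (\<lambda>x. (h x)\<^sup>2) \<le> integral {-pi..pi} (\<lambda>x. (g x)\<^sup>2)"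
    by (rule field_le_mult_one_interval)
  with fh show ?thesis by linarith
qed

lemma mean_zero_imp_zero:
  fixes f :: "real \<Rightarrow> real"
  assumes "a < b" "continuous_on {a..b} f" "integral {a..b} f = 0"
  shows "\<exists>z\<in>{a..b}. f z = 0"
proof (rule ccontr)
  assume no: "\<not> ?thesis"
  have "(\<forall>x\<in>{a..b}. f x > 0) \<or> (\<forall>x\<in>{a..b}. f x < 0)"
  proof (rule ccontr)
    assume "\<not> ((\<forall>x\<in>{a..b}. f x > 0) \<or> (\<forall>x\<in>{a..b}. f x < 0))"
    then obtain x y where "x \<in> {a..b}" "y \<in> {a..b}" "f x \<le> 0" "f y \<ge> 0" by force
    moreover have "connected (f ` {a..b})"
      by (rule connected_continuous_image[OF assms(2)]) simp
    ultimately have "0 \<in> f ` {a..b}"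
      unfolding connected_iff_interval by blast
    then show False using no by force
  qed
  moreover have "integral {a..b} f \<noteq> 0" if "\<forall>x\<in>{a..b}. f x > 0"
    using integral_eq_0_iff[OF assms(2,1)] that assms(1) by fastforce
  moreover have "integral {a..b} f \<noteq> 0" if "\<forall>x\<in>{a..b}. f x < 0"
  proof -
    have "integral {a..b} (\<lambda>x. - f x) \<noteq> 0"
      using integral_eq_0_iff[OF continuous_on_minus[OF assms(2)] assms(1)] that assms(1) by fastforce
    then show ?thesis by simp
  qed
  ultimately show False using assms(3) by blast
qed

text \<open>A continuous function of mean zero has a zero, and the constant 2 pi bounds the distance
  from x to it in the Hoelder estimate.\<close>

lemma sup_bound_mean_zero:
  assumes f: "primitive (-pi) pi f g" and g: "L2_on (-pi) pi g" and "integral {-pi..pi} f = 0" "x \<in> {-pi..pi}"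
  shows "(f x)\<^sup>2 \<le> 2 * pi * integral {-pi..pi} (\<lambda>x. (g x)\<^sup>2)"
proof -
  obtain z where z: "z \<in> {-pi..pi}" "f z = 0"
    using mean_zero_imp_zero[OF _ primitiveD(4)[OF f] assms(3)] pi_gt_zero by auto
  have "(f x)\<^sup>2 \<le> \<bar>x - z\<bar> * integral {-pi..pi} (\<lambda>x. (g x)\<^sup>2)"
    using primitive_Hoelder[OF f g assms(4) z(1)] z(2) by simp
  also have "\<dots> \<le> 2 * pi * integral {-pi..pi} (\<lambda>x. (g x)\<^sup>2)"
    using z assms(4) by (intro mult_right_mono integral_nonneg L2_onD(3)[OF g]) (auto simp: abs_le_iff)
  finally show ?thesis .
qed

section \<open>Sobolev functions and the energy\<close>

lemma LINT_Om:
  fixes F :: "real \<Rightarrow> real"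
  assumes "F absolutely_integrable_on {-pi..pi}"
  shows "integrable (lebesgue_on Om) F" "(LINT x|lebesgue_on Om. F x) = integral {-pi..pi} F"
proof -
  have "F absolutely_integrable_on Om"
    using assms absolutely_integrable_on_Icc_iff_Ioo[where f = F and a = "-pi" and b = pi] by simp
  then show 1: "integrable (lebesgue_on Om) F"
    by (rule absolutely_integrable_imp_integrable) auto
  show "(LINT x|lebesgue_on Om. F x) = integral {-pi..pi} F"
    using lebesgue_integral_eq_integral[OF 1] integral_open_interval_real[of "-pi" pi F] by simp
qed

lemma integrable_Om_imp:
  fixes F :: "real \<Rightarrow> real"
  assumes "integrable (lebesgue_on Om) F"
  shows "F absolutely_integrable_on {-pi..pi}"
proof -
  have "F integrable_on Om" "(\<lambda>x. norm (F x)) integrable_on Om"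
    using assms integrable_on_lebesgue_on[of Om F] integrable_on_lebesgue_on[of Om "\<lambda>x. norm (F x)"]
    by auto
  then have "F absolutely_integrable_on Om"
    by (simp add: absolutely_integrable_on_def)
  then show ?thesis
    using absolutely_integrable_on_Icc_iff_Ioo[where f = F and a = "-pi" and b = pi] by simp
qed

text \<open>Since \<open>weak_deriv\<close> is a choice, square integrability is first known only
  for some weak derivative; uniqueness up to null sets carries it over to the chosen one.\<close>

lemma H1D:
  assumes "f \<in> H1"
  shows "has_weak_deriv UNIV f (weak_deriv UNIV f)" "primitive a b f (weak_deriv UNIV f)"
    "L2_on (-pi) pi (weak_deriv UNIV f)" "continuous_on S f" "f (x + 2 * pi) = f x" "f (-pi) = f pi"
proof -
  obtain g where g: "has_weak_deriv UNIV f g" "square_integrable (lebesgue_on Om) g"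
    using assms unfolding H1_def by blast
  show wd: "has_weak_deriv UNIV f (weak_deriv UNIV f)"
    unfolding weak_deriv_def by (rule someI[of "has_weak_deriv UNIV f", OF g(1)])
  show c: "continuous_on S f" for S using assms continuous_on_subset unfolding H1_def by blast
  show p: "primitive a b f (weak_deriv UNIV f)" for a b
    by (rule has_weak_deriv_imp_primitive[OF wd _ c]) simp
  have pg: "primitive (-pi) pi f g"
    by (rule has_weak_deriv_imp_primitive[OF g(1) _ c]) simp
  have "(\<lambda>x. (g x)\<^sup>2) absolutely_integrable_on {-pi..pi}"
    using g(2) integrable_Om_imp unfolding square_integrable_def by blast
  then have "L2_on (-pi) pi g"
    using primitiveD(1)[OF pg] by (simp add: L2_on_def absolutely_integrable_on_def)
  then show "L2_on (-pi) pi (weak_deriv UNIV f)"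
    using L2_on_cong_ae(1) primitive_unique[OF pg p] by blast
  show per: "f (x + 2 * pi) = f x" for x
    using assms unfolding H1_def periodic_def by blast
  show "f (-pi) = f pi" using per[of "-pi"] by simp
qed

lemma H1I:
  assumes "periodic f" "\<And>a b. primitive a b f g" "L2_on (-pi) pi g"
  shows "f \<in> H1"
proof -
  have "continuous (at x) f" for x
    using primitiveD(4)[OF assms(2)[of "x - 1" "x + 1"]] continuous_on_interior[of "{x - 1..x + 1}" f x] by simp
  then have "continuous_on UNIV f"
    by (simp add: continuous_at_imp_continuous_on)
  moreover have "has_weak_deriv UNIV f g"
    by (rule has_weak_deriv_UNIV_I) (rule assms)
  moreover have "square_integrable (lebesgue_on Om) g"
  proof -
    have "(\<lambda>x. (g x)\<^sup>2) absolutely_integrable_on {-pi..pi}"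
      using L2_onD(3)[OF assms(3)] by (intro nonnegative_absolutely_integrable_1) auto
    moreover have "g \<in> borel_measurable (lebesgue_on Om)"
      using LINT_Om(1)[OF L2_onD(1)[OF assms(3)]] by auto
    ultimately show ?thesis unfolding square_integrable_def using LINT_Om(1) by blast
  qed
  ultimately show ?thesis using assms(1) unfolding H1_def by blast
qed

lemma weak_deriv_unique_ae:
  assumes "f \<in> H1" "primitive (-pi) pi f g"
  shows "negligible {x \<in> {-pi..pi}. weak_deriv UNIV f x \<noteq> g x}" "L2_on (-pi) pi g"
    "integral {-pi..pi} (\<lambda>x. (weak_deriv UNIV f x)\<^sup>2) = integral {-pi..pi} (\<lambda>x. (g x)\<^sup>2)"
proof -
  show n: "negligible {x \<in> {-pi..pi}. weak_deriv UNIV f x \<noteq> g x}"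
    by (rule primitive_unique[OF H1D(2)[OF assms(1)] assms(2)])
  show "L2_on (-pi) pi g" "integral {-pi..pi} (\<lambda>x. (weak_deriv UNIV f x)\<^sup>2) = integral {-pi..pi} (\<lambda>x. (g x)\<^sup>2)"
    using L2_on_cong_ae[OF H1D(3)[OF assms(1)] n] by auto
qed

lemma H1_diff:
  assumes "f \<in> H1" "h \<in> H1"
  shows "(\<lambda>x. f x - h x) \<in> H1"
proof (rule H1I)
  show "periodic (\<lambda>x. f x - h x)"
    unfolding periodic_def using H1D(5)[OF assms(1)] H1D(5)[OF assms(2)] by simp
  show "primitive a b (\<lambda>x. f x - h x) (\<lambda>x. weak_deriv UNIV f x - weak_deriv UNIV h x)" for a b
    by (rule primitive_diff[OF H1D(2)[OF assms(1)] H1D(2)[OF assms(2)]])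
  show "L2_on (-pi) pi (\<lambda>x. weak_deriv UNIV f x - weak_deriv UNIV h x)"
    by (rule L2_on_diff[OF H1D(3)[OF assms(1)] H1D(3)[OF assms(2)]])
qed

lemma continuous_Om:
  fixes F :: "real \<Rightarrow> real"
  assumes "continuous_on {-pi..pi} F"
  shows "F integrable_on {-pi..pi}" "(LINT x|lebesgue_on Om. F x) = integral {-pi..pi} F"
  using assms by (auto intro!: integrable_continuous_real LINT_Om absolutely_integrable_continuous_real)

lemma LINT_L2:
  assumes "L2_on (-pi) pi g"
  shows "(LINT x|lebesgue_on Om. (g x)\<^sup>2) = integral {-pi..pi} (\<lambda>x. (g x)\<^sup>2)"
  by (rule LINT_Om, rule nonnegative_absolutely_integrable_1[OF L2_onD(3)[OF assms]]) simp

lemma H1_norm_eq: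
  assumes "f \<in> H1" "primitive (-pi) pi f g"
  shows "H1_norm f = sqrt (integral {-pi..pi} (\<lambda>x. (f x)\<^sup>2) + integral {-pi..pi} (\<lambda>x. (g x)\<^sup>2))"
  unfolding H1_norm_def LINT_L2[OF H1D(3)[OF assms(1)]] LINT_L2[OF L2_on_continuous[OF H1D(4)[OF assms(1)]]]
    weak_deriv_unique_ae(3)[OF assms] ..

lemma energy_eq:
  assumes "f \<in> H1" "primitive (-pi) pi f g"
  shows "energy \<alpha> f = 1 / 2 * (integral {-pi..pi} (\<lambda>x. (g x)\<^sup>2) - \<alpha>\<^sup>2 * integral {-pi..pi} (\<lambda>x. (f x)\<^sup>2))
     - integral {-pi..pi} (\<lambda>x. f x * cos x)"
proof -
  let ?D = "weak_deriv UNIV f"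
  have D: "L2_on (-pi) pi ?D" and f: "L2_on (-pi) pi f"
    using H1D(3)[OF assms(1)] L2_on_continuous[OF H1D(4)[OF assms(1)]] .
  have "(\<lambda>x. (?D x)\<^sup>2 - \<alpha>\<^sup>2 * (f x)\<^sup>2) absolutely_integrable_on {-pi..pi}"
    by (rule set_integral_diff(1)[OF nonnegative_absolutely_integrable_1 absolutely_integrable_continuous_real])
       (use L2_onD(3)[OF D] H1D(4)[OF assms(1)] in \<open>auto intro!: continuous_intros\<close>)
  then have "(LINT x|lebesgue_on Om. (?D x)\<^sup>2 - \<alpha>\<^sup>2 * (f x)\<^sup>2)
      = integral {-pi..pi} (\<lambda>x. (?D x)\<^sup>2 - \<alpha>\<^sup>2 * (f x)\<^sup>2)"
    by (rule LINT_Om)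
  also have "\<dots> = integral {-pi..pi} (\<lambda>x. (?D x)\<^sup>2) - \<alpha>\<^sup>2 * integral {-pi..pi} (\<lambda>x. (f x)\<^sup>2)"
    using L2_onD(3)[OF D] L2_onD(3)[OF f]
    by (simp only: Henstock_Kurzweil_Integration.integral_diff integrable_on_mult_right integral_mult_right)
  finally show ?thesis
    unfolding energy_def weak_deriv_unique_ae(3)[OF assms]
    by (subst continuous_Om(2)) (use H1D(4)[OF assms(1)] in \<open>auto intro!: continuous_intros\<close>)
qed

lemma C_massD:
  assumes "f \<in> C_mass M"
  shows "f \<in> H1" "0 \<le> f x" "integral {-pi..pi} f = M"
  using assms continuous_Om(2)[of f] H1D(4)[of f] unfolding C_mass_def by auto

lemma C_massI:
  assumes "f \<in> H1" "\<And>x. 0 \<le> f x" "integral {-pi..pi} f = M"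
  shows "f \<in> C_mass M"
  using assms continuous_Om(2)[of f] H1D(4)[of f] unfolding C_mass_def by auto

text \<open>The energy is quadratic plus linear, so its second order Taylor formula at
  \<open>h\<close> is exact. The first integral is the first variation at \<open>h\<close> in the
  direction \<open>f - h\<close>.\<close>

lemma energy_expand:
  assumes f: "f \<in> H1" "primitive (-pi) pi f f'" and h: "h \<in> H1" "primitive (-pi) pi h h'"
  shows "energy \<alpha> f = energy \<alpha> h
    + integral {-pi..pi} (\<lambda>x. h' x * (f' x - h' x) - \<alpha>\<^sup>2 * h x * (f x - h x) - (f x - h x) * cos x)
    + 1 / 2 * (integral {-pi..pi} (\<lambda>x. (f' x - h' x)\<^sup>2) - \<alpha>\<^sup>2 * integral {-pi..pi} (\<lambda>x. (f x - h x)\<^sup>2))"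
proof -
  have L: "L2_on (-pi) pi f'" "L2_on (-pi) pi h'" "L2_on (-pi) pi f" "L2_on (-pi) pi h" "L2_on (-pi) pi cos"
    using weak_deriv_unique_ae(2)[OF f] weak_deriv_unique_ae(2)[OF h]
      L2_on_continuous[OF H1D(4)[OF f(1)]] L2_on_continuous[OF H1D(4)[OF h(1)]]
      L2_on_continuous[OF continuous_on_cos[OF continuous_on_id]] by auto
  have I: "(\<lambda>x. (f' x)\<^sup>2) integrable_on {-pi..pi}" "(\<lambda>x. (h' x)\<^sup>2) integrable_on {-pi..pi}"
    "(\<lambda>x. (f x)\<^sup>2) integrable_on {-pi..pi}" "(\<lambda>x. (h x)\<^sup>2) integrable_on {-pi..pi}"
    "(\<lambda>x. h' x * f' x) integrable_on {-pi..pi}" "(\<lambda>x. h x * f x) integrable_on {-pi..pi}"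
    "(\<lambda>x. f x * cos x) integrable_on {-pi..pi}" "(\<lambda>x. h x * cos x) integrable_on {-pi..pi}"
    using L by (auto intro: L2_onD L2_on_mult)
  have 1: "integral {-pi..pi} (\<lambda>x. h' x * (f' x - h' x) - \<alpha>\<^sup>2 * h x * (f x - h x) - (f x - h x) * cos x)
    = (integral {-pi..pi} (\<lambda>x. h' x * f' x) - integral {-pi..pi} (\<lambda>x. (h' x)\<^sup>2))
      - (\<alpha>\<^sup>2 * integral {-pi..pi} (\<lambda>x. h x * f x) - \<alpha>\<^sup>2 * integral {-pi..pi} (\<lambda>x. (h x)\<^sup>2))
      - (integral {-pi..pi} (\<lambda>x. f x * cos x) - integral {-pi..pi} (\<lambda>x. h x * cos x))"
    (is "_ = ?R")
  proof -
    have "((\<lambda>x. (h' x * f' x - (h' x)\<^sup>2) - (\<alpha>\<^sup>2 * (h x * f x) - \<alpha>\<^sup>2 * (h x)\<^sup>2)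
      - (f x * cos x - h x * cos x)) has_integral ?R) {-pi..pi}"
      by (intro has_integral_diff has_integral_mult_right integrable_integral I)
    then have "integral {-pi..pi} (\<lambda>x. (h' x * f' x - (h' x)\<^sup>2) - (\<alpha>\<^sup>2 * (h x * f x) - \<alpha>\<^sup>2 * (h x)\<^sup>2)
      - (f x * cos x - h x * cos x)) = ?R"
      by (rule integral_unique)
    moreover have "integral {-pi..pi} (\<lambda>x. h' x * (f' x - h' x) - \<alpha>\<^sup>2 * h x * (f x - h x) - (f x - h x) * cos x)
      = integral {-pi..pi} (\<lambda>x. (h' x * f' x - (h' x)\<^sup>2)
      - (\<alpha>\<^sup>2 * (h x * f x) - \<alpha>\<^sup>2 * (h x)\<^sup>2)
      - (f x * cos x - h x * cos x))"
      by (intro arg_cong[where f = "integral {-pi..pi}"] ext) algebra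
    ultimately show ?thesis by (rule trans[rotated])
  qed
  have 2: "integral {-pi..pi} (\<lambda>x. (p x - q x)\<^sup>2) =
    (integral {-pi..pi} (\<lambda>x. (p x)\<^sup>2) - 2 * integral {-pi..pi} (\<lambda>x. q x * p x)) + integral {-pi..pi} (\<lambda>x. (q x)\<^sup>2)"
    (is "_ = ?R")
    if "(\<lambda>x. (p x)\<^sup>2) integrable_on {-pi..pi}" "(\<lambda>x. (q x)\<^sup>2) integrable_on {-pi..pi}"
      "(\<lambda>x. q x * p x) integrable_on {-pi..pi}" for p q :: "real \<Rightarrow> real"
  proof -
    have "((\<lambda>x. ((p x)\<^sup>2 - 2 * (q x * p x)) + (q x)\<^sup>2) has_integral ?R) {-pi..pi}"
      by (intro has_integral_diff has_integral_add has_integral_mult_right integrable_integral that)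
    then have "integral {-pi..pi} (\<lambda>x. ((p x)\<^sup>2 - 2 * (q x * p x)) + (q x)\<^sup>2) = ?R"
      by (rule integral_unique)
    moreover have "integral {-pi..pi} (\<lambda>x. (p x - q x)\<^sup>2) =
        integral {-pi..pi} (\<lambda>x. ((p x)\<^sup>2 - 2 * (q x * p x)) + (q x)\<^sup>2)"
      by (intro arg_cong[where f = "integral {-pi..pi}"] ext) algebra
    ultimately show ?thesis by (rule trans[rotated])
  qed
  show ?thesis
    unfolding energy_eq[OF f] energy_eq[OF h] 1 2[OF I(1,2,5)] 2[OF I(3,4,6)]
    by (simp add: algebra_simps)
qed

lemma energy_coercive:
  assumes w: "primitive (-pi) pi w w'" and "L2_on (-pi) pi w'" "w (-pi) = w pi" "integral {-pi..pi} w = 0"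
  shows "(1 - \<alpha>\<^sup>2) * integral {-pi..pi} (\<lambda>x. (w' x)\<^sup>2)
    \<le> integral {-pi..pi} (\<lambda>x. (w' x)\<^sup>2) - \<alpha>\<^sup>2 * integral {-pi..pi} (\<lambda>x. (w x)\<^sup>2)"
  using mult_left_mono[OF Poincare_Wirtinger[OF assms], of "\<alpha>\<^sup>2"] by (simp add: algebra_simps)

section \<open>Regularity of the first derivative and of the pressure\<close>

lemma primitive_cong:
  assumes "primitive a b f g" "\<And>x. x \<in> {a..b} \<Longrightarrow> f x = h x"
  shows "primitive a b h g"
  unfolding primitive_def
proof (intro conjI ballI)
  show "g absolutely_integrable_on {a..b}" by (rule primitiveD(1)[OF assms(1)])
  fix x assume x: "x \<in> {a..b}"
  then have "a \<in> {a..b}" by auto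
  then show "h x = h a + integral {a..x} g"
    using primitiveD(3)[OF assms(1) x] assms(2)[OF x] assms(2)[of a] by argo
qed

lemma primitive_imp_has_real_derivative:
  assumes "primitive a b f g" "continuous_on {a..b} g" "x \<in> {a<..<b}"
  shows "(f has_real_derivative g x) (at x)"
proof -
  have "((\<lambda>x. f a + integral {a..x} g) has_real_derivative g x) (at x within {a..b})"
    using integral_has_real_derivative[OF assms(2), of x] assms(3) by (auto intro!: derivative_eq_intros)
  then have "((\<lambda>x. f a + integral {a..x} g) has_real_derivative g x) (at x)"
    using at_within_interior[of x "{a..b}"] assms(3) by simp
  then show ?thesis
    by (rule has_field_derivative_transform_within_open[where S = "{a<..<b}"])
       (use assms(3) in \<open>auto intro!: primitiveD(3)[OF assms(1), symmetric]\<close>)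
qed

text \<open>The first weak derivative has an absolutely continuous representative on every interval.
  Integrating it recovers \<open>u\<close>, so \<open>u\<close> is continuously differentiable and
  \<open>deriv u\<close> is that representative.\<close>

lemma H2_imp_C1:
  assumes u: "u \<in> H1" and v: "has_weak_deriv UNIV u v" and w: "has_weak_deriv UNIV v w"
  shows "(u has_real_derivative deriv u x) (at x)"
    "primitive a b (deriv u) (weak_deriv UNIV (weak_deriv UNIV u))"
proof -
  define V where "V = weak_deriv UNIV u"
  define W where "W = weak_deriv UNIV V"
  have uV: "has_weak_deriv UNIV u V" "primitive a b u V" for a b
    using H1D(1,2)[OF u] by (auto simp: V_def)
  have "has_weak_deriv UNIV V w"
  proof (rule has_weak_deriv_cong_ae[OF w])
    show "locally_integrable UNIV V" using uV(1) unfolding has_weak_deriv_def by blast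
    show "negligible {x \<in> {a..b}. v x \<noteq> V x}" for a b
      by (rule primitive_unique[OF has_weak_deriv_imp_primitive[OF v _ H1D(4)[OF u]] uV(2)]) simp
  qed
  then have VW: "has_weak_deriv UNIV V W"
    unfolding W_def weak_deriv_def by (rule someI[of "has_weak_deriv UNIV V"])
  have *: "\<exists>F. primitive a b F W \<and> (\<forall>x\<in>{a<..<b}. (u has_real_derivative F x) (at x))" if ab: "a < b" for a b
  proof -
    obtain F where F: "primitive a b F W" "negligible {x \<in> {a..b}. V x \<noteq> F x}"
      using has_weak_deriv_imp_primitive_ae[OF VW ab] by auto
    have "primitive a b u F"
      by (rule primitive_cong_ae[OF uV(2) F(2)])
    then show ?thesis
      using F(1) primitive_imp_has_real_derivative primitiveD(4)[OF F(1)] by blast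
  qed
  show d: "(u has_real_derivative deriv u x) (at x)" for x
  proof -
    obtain F where "\<forall>y\<in>{x - 1<..<x + 1}. (u has_real_derivative F y) (at y)"
      using *[of "x - 1" "x + 1"] by auto
    then have "(u has_real_derivative F x) (at x)" by simp
    then show ?thesis using DERIV_imp_deriv by metis
  qed
  show "primitive a b (deriv u) (weak_deriv UNIV (weak_deriv UNIV u))"
  proof (cases "a \<le> b")
    case True
    then obtain F where F: "primitive (a - 1) (b + 1) F W" "\<forall>y\<in>{a - 1<..<b + 1}. (u has_real_derivative F y) (at y)"
      using *[of "a - 1" "b + 1"] by auto
    have "primitive a b F W" by (rule primitive_subinterval[OF F(1)]) auto
    then have "primitive a b (deriv u) W"
      by (rule primitive_cong) (rule DERIV_imp_deriv[symmetric], use F(2) in auto)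
    then show ?thesis by (simp add: W_def V_def)
  next
    case False
    then show ?thesis by (auto simp: primitive_def)
  qed
qed

text \<open>The pressure, minus the classical second derivative of \<open>u\<close> where it exists, is a continuous
  representative of the energy gradient on the wet region.\<close>

definition pressure :: "real \<Rightarrow> (real \<Rightarrow> real) \<Rightarrow> real \<Rightarrow> real" where
  "pressure \<alpha> u x = - deriv (deriv u) x - \<alpha>\<^sup>2 * u x - cos x"

text \<open>On a compact wet interval the energy gradient agrees almost everywhere with an
  absolutely continuous \<open>F\<close>. Solving for the second derivative of \<open>u\<close>
  shows that it has a continuous representative and so is classical, and \<open>F\<close> is the
  pressure.\<close>

lemma pressure_primitive:
  assumes u: "u \<in> H1" and v: "has_weak_deriv UNIV u v" and w: "has_weak_deriv UNIV v w"
    and g: "has_weak_deriv {y. 0 < u y} (energy_grad \<alpha> u) g"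
    and "\<And>x. x \<in> {a..b} \<Longrightarrow> 0 < u x" "a \<le> b"
  shows "primitive a b (pressure \<alpha> u) g"
    "x \<in> {a..b} \<Longrightarrow> (deriv u has_real_derivative - pressure \<alpha> u x - \<alpha>\<^sup>2 * u x - cos x) (at x)"
proof -
  let ?W = "weak_deriv UNIV (weak_deriv UNIV u)"
  have cu: "continuous_on S u" for S by (rule H1D(4)[OF u])
  have "open {y. 0 < u y}" by (rule open_Collect_less) (auto intro: cu)
  moreover have "a \<in> {y. 0 < u y}" "b \<in> {y. 0 < u y}" using assms by auto
  ultimately obtain d e where de: "d > 0" "cball a d \<subseteq> {y. 0 < u y}" "e > 0" "cball b e \<subseteq> {y. 0 < u y}"
    unfolding open_contains_cball by meson
  \<comment> \<open>The interval is enlarged within the wet set, so that derivatives at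
    \<open>a\<close> and \<open>b\<close> are two-sided and even the case \<open>a = b\<close> is
    meaningful.\<close>
  have pos: "{a - d..b + e} \<subseteq> {y. 0 < u y}"
  proof
    fix x assume x: "x \<in> {a - d..b + e}"
    consider "x < a" | "x \<in> {a..b}" | "b < x" by force
    then show "x \<in> {y. 0 < u y}"
    proof cases
      case 1 then have "x \<in> cball a d" using x by (auto simp: dist_real_def)
      then show ?thesis using de by blast
    next
      case 2 then show ?thesis using assms by auto
    next
      case 3 then have "x \<in> cball b e" using x by (auto simp: dist_real_def)
      then show ?thesis using de by blast
    qed
  qed
  have lt: "a - d < b + e" using de assms by auto
  obtain F where F: "primitive (a - d) (b + e) F g" "negligible {x \<in> {a - d..b + e}. energy_grad \<alpha> u x \<noteq> F x}"
    using has_weak_deriv_imp_primitive_ae[OF g lt pos] by auto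
  define C where "C x = - F x - \<alpha>\<^sup>2 * u x - cos x" for x
  have cC: "continuous_on {a - d..b + e} C"
    unfolding C_def by (intro continuous_intros primitiveD(4)[OF F(1)] cu)
  have "primitive (a - d) (b + e) (deriv u) C"
    by (rule primitive_cong_ae[OF H2_imp_C1(2)[OF u v w]], rule negligible_subset[OF F(2)])
       (auto simp: C_def energy_grad_def)
  then have d: "(deriv u has_real_derivative C x) (at x)" if "x \<in> {a - d<..<b + e}" for x
    by (rule primitive_imp_has_real_derivative[OF _ cC that])
  have pF: "pressure \<alpha> u x = F x" if "x \<in> {a..b}" for x
    using DERIV_imp_deriv[OF d[of x]] that de by (simp add: pressure_def C_def)
  have "primitive a b F g" by (rule primitive_subinterval[OF F(1)]) (use de in auto)
  then show "primitive a b (pressure \<alpha> u) g" by (rule primitive_cong) (simp add: pF)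
  show "(deriv u has_real_derivative - pressure \<alpha> u x - \<alpha>\<^sup>2 * u x - cos x) (at x)" if "x \<in> {a..b}"
    using d[of x] pF[OF that] that de by (simp add: C_def)
qed

lemma integral_le_nn_integral_Om:
  fixes h :: "real \<Rightarrow> real"
  assumes h: "continuous_on {r..s} h" "\<And>x. x \<in> {r..s} \<Longrightarrow> 0 \<le> h x" and rs: "{r..s} \<subseteq> {-pi..pi}"
    and N: "\<And>x. x \<in> {r..s} \<Longrightarrow> ennreal (h x) \<le> N x" "(\<integral>\<^sup>+x. N x \<partial>lebesgue_on Om) \<le> ennreal S" and S: "0 \<le> S"
  shows "integral {r..s} h \<le> S"
proof -
  define F where "F x = (if x \<in> {r..s} then h x else 0)" for x
  have "F absolutely_integrable_on UNIV"
    using absolutely_integrable_continuous_real[OF h(1)] absolutely_integrable_restrict_UNIV[where S = "{r..s}" and f = h]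
    by (simp add: F_def[abs_def])
  then have F: "F absolutely_integrable_on {-pi..pi}"
    by (rule set_integrable_subset) auto
  have "ennreal (LINT x|lebesgue_on Om. F x) = (\<integral>\<^sup>+x. ennreal (F x) \<partial>lebesgue_on Om)"
    by (rule nn_integral_eq_integral[symmetric, OF LINT_Om(1)[OF F]]) (auto simp: F_def h)
  also have "\<dots> \<le> (\<integral>\<^sup>+x. N x \<partial>lebesgue_on Om)"
    by (rule nn_integral_mono) (auto simp: F_def N)
  finally have "(LINT x|lebesgue_on Om. F x) \<le> S"
    using N(2) S by (metis ennreal_le_iff order_trans)
  moreover have "integral {-pi..pi} F = integral {r..s} h"
    using integral_restrict_Int[of "{-pi..pi}" "{r..s}" h]
    unfolding F_def[abs_def] Int_absorb2[OF rs] .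
  ultimately show ?thesis using LINT_Om(2)[OF F] by simp
qed

section \<open>Profiles with small dissipation\<close>

lemma periodic_int:
  assumes "\<And>x :: real. f (x + 2 * pi) = f x"
  shows "f (x + 2 * pi * of_int k) = f x"
proof (induction k rule: int_induct[of _ 0])
  case (step1 i)
  then show ?case using assms[of "x + 2 * pi * of_int i"] by (simp add: algebra_simps)
next
  case (step2 i)
  then show ?case using assms[of "x + 2 * pi * of_int (i - 1)"] by (simp add: algebra_simps)
qed simp

lemma int_shift_into_period: "\<exists>k :: int. x - 2 * pi * of_int k \<in> {-pi..pi}"
proof -
  define a :: real where "a = of_int \<lfloor>(x + pi) / (2 * pi)\<rfloor>"
  have "a \<le> (x + pi) / (2 * pi)" "(x + pi) / (2 * pi) \<le> a + 1"
    unfolding a_def by linarith+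
  then have "a * (2 * pi) \<le> x + pi" "x + pi \<le> (a + 1) * (2 * pi)"
    by (simp_all only: pos_le_divide_eq pos_divide_le_eq mult_pos_pos zero_less_numeral pi_gt_zero)
  then have "x - 2 * pi * a \<in> {-pi..pi}" by (simp add: algebra_simps)
  then show ?thesis unfolding a_def by blast
qed

text \<open>The last clause is what remains of the energy dissipation: it expresses that
  \<open>\<integral> u\<^sup>3\<^sup>/\<^sup>4 \<bar>p'\<bar> \<le> A\<close>. The exponent is the one for which the Cauchy-Schwarz inequality
  combines the dissipation with the integral of \<open>u\<^sup>-\<^sup>\<beta>\<close>, whatever \<open>n\<close> is.\<close>

definition profile :: "real \<Rightarrow> real \<Rightarrow> (real \<Rightarrow> real) \<Rightarrow> (real \<Rightarrow> real) \<Rightarrow> (real \<Rightarrow> real) \<Rightarrow> bool" where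
  "profile \<alpha> A u u1 p \<longleftrightarrow>
     (\<forall>x. u (x + 2 * pi) = u x) \<and> (\<forall>x. 0 \<le> u x) \<and>
     (\<forall>x. (u has_real_derivative u1 x) (at x)) \<and> continuous_on UNIV u1 \<and>
     (\<forall>x. 0 < u x \<longrightarrow> (u1 has_real_derivative - p x - \<alpha>\<^sup>2 * u x - cos x) (at x)) \<and>
     0 \<le> A \<and>
     (\<forall>r s y. -pi \<le> r \<and> r \<le> s \<and> s \<le> pi \<and> 0 < y \<and> (\<forall>x\<in>{r..s}. y \<le> u x) \<longrightarrow>
        \<bar>p r - p s\<bar> \<le> A * y powr (- 3 / 4))"

lemma profileD:
  assumes "profile \<alpha> A u u1 p"
  shows "u (x + 2 * pi) = u x" "0 \<le> u x" "(u has_real_derivative u1 x) (at x)" "continuous_on UNIV u1"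
    "0 < u x \<Longrightarrow> (u1 has_real_derivative - p x - \<alpha>\<^sup>2 * u x - cos x) (at x)" "0 \<le> A"
    "\<lbrakk>-pi \<le> r; r \<le> s; s \<le> pi; 0 < y; \<And>x. x \<in> {r..s} \<Longrightarrow> y \<le> u x\<rbrakk> \<Longrightarrow> \<bar>p r - p s\<bar> \<le> A * y powr (- 3 / 4)"
  using assms unfolding profile_def by blast+

lemma profile_reflect:
  assumes "profile \<alpha> A u u1 p"
  shows "profile \<alpha> A (\<lambda>x. u (- x)) (\<lambda>x. - u1 (- x)) (\<lambda>x. p (- x))"
  unfolding profile_def
proof (intro conjI allI impI)
  note P = profileD[OF assms]
  show "u (- (x + 2 * pi)) = u (- x)" for x
    using P(1)[of "- x - 2 * pi"] by simp
  show "((\<lambda>x. u (- x)) has_real_derivative - u1 (- x)) (at x)" for x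
    using DERIV_chain2[OF P(3)[of "- x"] DERIV_minus[OF DERIV_ident]] by simp
  show "continuous_on UNIV (\<lambda>x. - u1 (- x))"
    by (intro continuous_intros continuous_on_compose2[OF P(4)]) auto
  show "((\<lambda>x. - u1 (- x)) has_real_derivative - p (- x) - \<alpha>\<^sup>2 * u (- x) - cos x) (at x)" if "0 < u (- x)" for x
    using DERIV_minus[OF DERIV_chain2[OF P(5)[of "- x"] DERIV_minus[OF DERIV_ident]]] that by simp
  show "\<bar>p (- r) - p (- s)\<bar> \<le> A * y powr (- 3 / 4)"
    if "-pi \<le> r \<and> r \<le> s \<and> s \<le> pi \<and> 0 < y \<and> (\<forall>x\<in>{r..s}. y \<le> u (- x))" for r s y
  proof -
    have "\<bar>p (- s) - p (- r)\<bar> \<le> A * y powr (- 3 / 4)"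
    proof (rule P(7))
      show "y \<le> u x" if "x \<in> {- s..- r}" for x
        using bspec[of "{r..s}" "\<lambda>x. y \<le> u (- x)" "- x"] that
          \<open>-pi \<le> r \<and> r \<le> s \<and> s \<le> pi \<and> 0 < y \<and> (\<forall>x\<in>{r..s}. y \<le> u (- x))\<close> by auto
    qed (use that in auto)
    then show ?thesis by (simp add: abs_minus_commute)
  qed
qed (use profileD[OF assms] in auto)

lemma profile_periodic:
  assumes "profile \<alpha> A u u1 p"
  shows "u (x + 2 * pi * of_int k) = u x" "u1 (x + 2 * pi * of_int k) = u1 x"
    "0 < u x \<Longrightarrow> p (x + 2 * pi * of_int k) = p x"
proof -
  note P = profileD[OF assms]
  show u: "u (x + 2 * pi * of_int k) = u x" for x by (rule periodic_int[of u, OF P(1)])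
  have u1: "u1 (x + 2 * pi) = u1 x" for x
  proof -
    have "((\<lambda>x. u (x + 2 * pi)) has_real_derivative u1 (x + 2 * pi) * 1) (at x)"
      by (rule DERIV_chain2[OF P(3)]) (auto intro!: derivative_eq_intros)
    then show ?thesis using DERIV_unique[OF P(3)[of x]] by (simp add: P(1))
  qed
  show u1': "u1 (x + 2 * pi * of_int k) = u1 x" for x by (rule periodic_int[of u1, OF u1])
  show "p (x + 2 * pi * of_int k) = p x" if "0 < u x"
  proof -
    let ?T = "2 * pi * of_int k"
    have "((\<lambda>x. u1 (x + ?T)) has_real_derivative (- p (x + ?T) - \<alpha>\<^sup>2 * u (x + ?T) - cos (x + ?T)) * 1) (at x)"
      by (rule DERIV_chain2[OF P(5)]) (auto intro!: derivative_eq_intros simp: u that)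
    then have "(u1 has_real_derivative - p (x + ?T) - \<alpha>\<^sup>2 * u x - cos (x + ?T)) (at x)"
      by (simp add: u1' u)
    moreover have "cos (x + ?T) = cos x"
      using periodic_int[of cos x k] by simp
    ultimately have "(u1 has_real_derivative - p (x + ?T) - \<alpha>\<^sup>2 * u x - cos x) (at x)" by simp
    from DERIV_unique[OF P(5)[OF that] this] show ?thesis by simp
  qed
qed

text \<open>A profile controls the pressure only inside the basic period. An interval of length at
  most 2 pi, moved so that its right end lies there, crosses the cut at most once, which costs the
  factor 2.\<close>

lemma profile_variation:
  assumes prof: "profile \<alpha> A u u1 p" and "r \<le> s" "s - r \<le> 2 * pi" "0 < y" and y: "\<And>x. x \<in> {r..s} \<Longrightarrow> y \<le> u x"
  shows "\<bar>p r - p s\<bar> \<le> 2 * A * y powr (- 3 / 4)"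
proof -
  note P = profileD[OF prof] and Q = profile_periodic[OF prof]
  obtain k :: int where k: "s - 2 * pi * of_int k \<in> {-pi..pi}"
    using int_shift_into_period by blast
  define s0 r0 where "s0 = s - 2 * pi * of_int k" and "r0 = r - 2 * pi * of_int k"
  have y0: "y \<le> u x" if "x \<in> {r0..s0}" for x
    using y[of "x + 2 * pi * of_int k"] that by (auto simp: Q(1) s0_def r0_def)
  have ps: "p s = p s0" "p r = p r0"
    using Q(3)[of s0 k] Q(3)[of r0 k] y0[of s0] y0[of r0] \<open>r \<le> s\<close> \<open>0 < y\<close> by (auto simp: s0_def r0_def)
  have A0: "0 \<le> A * y powr (- 3 / 4)" using P(6) by simp
  show ?thesis
  proof (cases "-pi \<le> r0")
    case True
    have "\<bar>p r0 - p s0\<bar> \<le> A * y powr (- 3 / 4)"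
      by (rule P(7)) (use True k y0 assms in \<open>auto simp: s0_def r0_def\<close>)
    then show ?thesis using A0 ps by simp
  next
    case False
    have s0: "-pi \<le> s0" "s0 \<le> pi" using k by (auto simp: s0_def)
    have 1: "\<bar>p (-pi) - p s0\<bar> \<le> A * y powr (- 3 / 4)"
      by (rule P(7)) (use False s0 y0 assms in auto)
    have 2: "\<bar>p (r0 + 2 * pi) - p pi\<bar> \<le> A * y powr (- 3 / 4)"
    proof (rule P(7))
      show "-pi \<le> r0 + 2 * pi" using s0 assms by (auto simp: s0_def r0_def)
      show "y \<le> u x" if "x \<in> {r0 + 2 * pi..pi}" for x
        using y0[of "x - 2 * pi"] P(1)[of "x - 2 * pi"] that s0 by auto
    qed (use False assms in auto)
    have "0 < u (-pi)" using y0[of "-pi"] False s0 assms by auto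
    then have "p pi = p (-pi)" using Q(3)[of "-pi" 1] by simp
    moreover have "0 < u r0" using y0[of r0] assms by (auto simp: s0_def r0_def)
    then have "p (r0 + 2 * pi) = p r0" using Q(3)[of r0 1] by simp
    ultimately show ?thesis using 1 2 ps by linarith
  qed
qed

text \<open>Going down from \<open>c\<close> to the nearest critical point of \<open>u\<close>, the quantity \<open>u'\<^sup>2\<close>, as a function of the
  height \<open>u\<close>, has the derivative \<open>2 u''\<close>, and the singular part \<open>A u\<^sup>-\<^sup>3\<^sup>/\<^sup>4\<close> of the bound for \<open>u''\<close>
  is integrable at height 0.\<close>

lemma profile_slope_bound_aux:
  assumes prof: "profile \<alpha> A u u1 p" and c: "0 < u c" "0 < u1 c"
  shows "(u1 c)\<^sup>2 \<le> 2 * u c * (\<bar>p c\<bar> + 1 + \<alpha>\<^sup>2 * u c) + 16 * A * u c powr (1 / 4)"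
proof -
  note P = profileD[OF prof]
  define Z where "Z = {x \<in> {c - 2 * pi..c}. u1 x = 0}"
  have "closed {x. u1 x = 0}"
    by (rule closed_Collect_eq) (auto intro: P(4))
  moreover have "Z = {c - 2 * pi..c} \<inter> {x. u1 x = 0}" by (auto simp: Z_def)
  ultimately have "compact Z"
    using compact_Int_closed[OF compact_Icc] by metis
  moreover have "Z \<noteq> {}"
  proof -
    have "continuous_on S u" for S using P(3) by (meson DERIV_isCont continuous_at_imp_continuous_on)
    then obtain z where "c - 2 * pi < z" "z < c" "u1 z = 0"
      using Rolle_deriv[of "c - 2 * pi" c u "\<lambda>x h. u1 x * h"] P(1)[of "c - 2 * pi"] P(3)
      by (auto simp: has_field_derivative_def fun_eq_iff dest!: spec[of _ 1])
    then show ?thesis by (auto simp: Z_def intro!: exI[of _ z])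
  qed
  ultimately obtain x1 where x1: "x1 \<in> Z" "\<And>z. z \<in> Z \<Longrightarrow> z \<le> x1"
    using compact_attains_sup[of Z] by blast
  have x1c: "x1 < c" "c - 2 * pi \<le> x1" "u1 x1 = 0"
    using x1(1) c by (auto simp: Z_def less_le)
  have pos1: "0 < u1 x" if x: "x \<in> {x1<..c}" for x
  proof (rule ccontr)
    assume "\<not> 0 < u1 x"
    then obtain z where "x \<le> z" "z \<le> c" "u1 z = 0"
      using IVT'[of u1 x 0 c] x c continuous_on_subset[OF P(4)] by auto
    then show False using x1(2)[of z] x x1c by (auto simp: Z_def)
  qed
  have mono: "u x < u y" if "x1 \<le> x" "x < y" "y \<le> c" for x y
  proof (rule DERIV_pos_imp_increasing_open[OF that(2)])
    show "\<exists>z. (u has_real_derivative z) (at w) \<and> 0 < z" if "x < w" "w < y" for w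
      using P(3)[of w] pos1[of w] that \<open>x1 \<le> x\<close> \<open>y \<le> c\<close> by auto
    show "continuous_on {x..y} u"
      using P(3) by (meson DERIV_isCont continuous_at_imp_continuous_on)
  qed
  have upos: "0 < u x" if "x \<in> {x1<..c}" for x
    using mono[of x1 x] P(2)[of x1] that by auto
  define b where "b = \<bar>p c\<bar> + 1 + \<alpha>\<^sup>2 * u c"
  \<comment> \<open>As functions of the height u, the subtracted terms have derivatives 2 b and 4 A
    u^(-3/4), which together dominate 2 u''. Thus \<Phi> cannot increase from the critical point
    \<open>x1\<close>, where it is at most 0. The mean value theorem is used since u may vanish at
    \<open>x1\<close>.\<close>
  define \<Phi> where "\<Phi> x = (u1 x)\<^sup>2 - 2 * b * u x - 16 * A * u x powr (1 / 4)" for x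
  have cont: "continuous_on {x1..c} \<Phi>"
  proof -
    have cu: "continuous_on {x1..c} u"
      using P(3) by (meson DERIV_isCont continuous_at_imp_continuous_on)
    show ?thesis
      unfolding \<Phi>_def
      by (intro continuous_intros continuous_on_powr' cu continuous_on_subset[OF P(4)]) (auto simp: P(2))
  qed
  have der: "(\<Phi> has_real_derivative 2 * u1 x * (- p x - \<alpha>\<^sup>2 * u x - cos x) - 2 * b * u1 x
      - 4 * A * (u x powr (- 3 / 4) * u1 x)) (at x)" if "x1 < x" "x < c" for x
  proof -
    have x: "0 < u x" using upos that by auto
    have "((\<lambda>x. u x powr (1 / 4)) has_real_derivative 1 / 4 * u x powr (1 / 4 - 1) * u1 x) (at x)"
      using DERIV_fun_powr[OF P(3)[of x] x, of "1 / 4"] by simp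
    then have "((\<lambda>x. u x powr (1 / 4)) has_real_derivative 1 / 4 * u x powr (- 3 / 4) * u1 x) (at x)"
      by simp
    then have "((\<lambda>x. (u1 x)\<^sup>2 - 2 * b * u x - 16 * A * u x powr (1 / 4)) has_real_derivative
        2 * u1 x ^ (2 - 1) * (- p x - \<alpha>\<^sup>2 * u x - cos x) - 2 * b * u1 x
        - 16 * A * (1 / 4 * u x powr (- 3 / 4) * u1 x)) (at x)"
      by (intro DERIV_diff DERIV_cmult DERIV_power[OF P(5)[OF x], of 2, simplified] P(3)) 
         (auto intro!: derivative_eq_intros P(5)[OF x])
    then show ?thesis unfolding \<Phi>_def [abs_def] by (simp add: mult_ac)
  qed
  obtain l z where z: "x1 < z" "z < c" "(\<Phi> has_real_derivative l) (at z)" "\<Phi> c - \<Phi> x1 = (c - x1) * l"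
    using MVT[OF x1c(1) cont] der real_differentiable_def by metis
  have uz: "0 < u z" "u z \<le> u c" "0 < u1 z" using upos[of z] mono[of z c] pos1[of z] z x1c by auto
  have l: "l = 2 * u1 z * ((- p z - \<alpha>\<^sup>2 * u z - cos z) - b - 2 * A * u z powr (- 3 / 4))"
    using DERIV_unique[OF z(3) der[OF z(1,2)]] by (simp add: algebra_simps)
  have "\<bar>p z - p c\<bar> \<le> 2 * A * u z powr (- 3 / 4)"
  proof (rule profile_variation[OF prof])
    show "u z \<le> u x" if "x \<in> {z..c}" for x
      using mono[of z x] that z x1c by (cases "z = x") auto
  qed (use z x1c uz in auto)
  moreover have "0 \<le> \<alpha>\<^sup>2 * u z" using uz by simp
  moreover have "0 \<le> \<alpha>\<^sup>2 * u c" using c by simp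
  moreover have "- cos z \<le> 1" using cos_ge_minus_one[of z] by linarith
  ultimately have "(- p z - \<alpha>\<^sup>2 * u z - cos z) - b - 2 * A * u z powr (- 3 / 4) \<le> 0"
    unfolding b_def by linarith
  then have "l \<le> 0" unfolding l using uz by (simp add: mult_nonneg_nonpos)
  then have "\<Phi> c \<le> \<Phi> x1" using z(4) mult_nonneg_nonpos[of "c - x1" l] x1c(1) by linarith
  also have "0 \<le> b" using c by (simp add: b_def)
  then have "0 \<le> b * u x1" "0 \<le> A * u x1 powr (1 / 4)" using P(2)[of x1] P(6) by simp_all
  then have "\<Phi> x1 \<le> 0" by (simp add: \<Phi>_def x1c)
  finally show ?thesis by (simp add: \<Phi>_def b_def algebra_simps)
qed

lemma profile_slope_bound:
  assumes prof: "profile \<alpha> A u u1 p" and c: "0 < u c"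
  shows "(u1 c)\<^sup>2 \<le> 2 * u c * (\<bar>p c\<bar> + 1 + \<alpha>\<^sup>2 * u c) + 16 * A * u c powr (1 / 4)"
proof (cases "u1 c" "0 :: real" rule: linorder_cases)
  case less
  then show ?thesis
    using profile_slope_bound_aux[OF profile_reflect[OF prof], of "- c"] c by simp
next
  case equal
  have "0 \<le> 2 * u c * (\<bar>p c\<bar> + 1 + \<alpha>\<^sup>2 * u c)" "0 \<le> 16 * A * u c powr (1 / 4)"
    using c profileD(6)[OF prof] by simp_all
  then show ?thesis using equal by simp
next
  case greater
  then show ?thesis by (rule profile_slope_bound_aux[OF prof c])
qed

text \<open>Add or subtract the Taylor formulas at c + h and c - h. Applied to the difference of two
  profiles, with q the difference of their pressures at c, it turns uniform closeness of the
  profiles into closeness of pressures and slopes.\<close>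

lemma second_difference_bounds:
  fixes z z1 z2 :: "real \<Rightarrow> real"
  assumes "0 < h"
    and z: "\<And>x. x \<in> {c - h..c + h} \<Longrightarrow> (z has_real_derivative z1 x) (at x)"
    and z1: "\<And>x. x \<in> {c - h..c + h} \<Longrightarrow> (z1 has_real_derivative z2 x) (at x)"
    and \<delta>: "\<And>x. x \<in> {c - h..c + h} \<Longrightarrow> \<bar>z x\<bar> \<le> \<delta>"
    and B: "\<And>x. x \<in> {c - h..c + h} \<Longrightarrow> \<bar>z2 x + q\<bar> \<le> B"
  shows "\<bar>q\<bar> * h\<^sup>2 \<le> 4 * \<delta> + B * h\<^sup>2" "2 * h * \<bar>z1 c\<bar> \<le> 2 * \<delta> + B * h\<^sup>2"
proof -
  define diff where "diff m = (if m = 0 then z else if m = Suc 0 then z1 else z2)" for m :: nat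
  have D: "\<forall>m t. m < 2 \<and> c - h \<le> t \<and> t \<le> c + h \<longrightarrow> DERIV (diff m) t :> diff (Suc m) t"
    using z z1 by (auto simp: diff_def less_2_cases_iff)
  obtain s where s: "c < s" "s < c + h" "z (c + h) = z c + z1 c * h + z2 s / 2 * h\<^sup>2"
    using Taylor_up[of 2 diff z "c - h" "c + h" c, OF _ _ D] \<open>0 < h\<close>
    by (auto simp: diff_def lessThan_nat_numeral lessThan_Suc numeral_2_eq_2)
  obtain t where t: "c - h < t" "t < c" "z (c - h) = z c - z1 c * h + z2 t / 2 * h\<^sup>2"
    using Taylor_down[of 2 diff z "c - h" "c + h" c, OF _ _ D] \<open>0 < h\<close>
    by (auto simp: diff_def lessThan_nat_numeral lessThan_Suc numeral_2_eq_2)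
  have Bs: "\<bar>z2 s + q\<bar> \<le> B" "\<bar>z2 t + q\<bar> \<le> B" using B[of s] B[of t] s t by auto
  have half: "\<bar>a / 2 + b / 2\<bar> \<le> B" "\<bar>a / 2 - b / 2\<bar> \<le> B" if "\<bar>a\<bar> \<le> B" "\<bar>b\<bar> \<le> B" for a b
    using that by linarith+
  have d: "\<bar>z (c + h)\<bar> \<le> \<delta>" "\<bar>z (c - h)\<bar> \<le> \<delta>" "\<bar>z c\<bar> \<le> \<delta>" using \<delta> \<open>0 < h\<close> by auto
  have "q * h\<^sup>2 = ((z2 s + q) / 2 + (z2 t + q) / 2) * h\<^sup>2 - (z (c + h) + z (c - h) - 2 * z c)"
    unfolding s(3) t(3) by (simp add: field_simps)
  moreover have "\<bar>(z2 s + q) / 2 + (z2 t + q) / 2\<bar> \<le> B" using half Bs by blast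
  then have "\<bar>((z2 s + q) / 2 + (z2 t + q) / 2) * h\<^sup>2\<bar> \<le> B * h\<^sup>2"
    by (simp add: abs_mult mult_right_mono)
  ultimately have "\<bar>q * h\<^sup>2\<bar> \<le> 4 * \<delta> + B * h\<^sup>2" using d by linarith
  then show "\<bar>q\<bar> * h\<^sup>2 \<le> 4 * \<delta> + B * h\<^sup>2" by (simp add: abs_mult)
  have "2 * h * z1 c = z (c + h) - z (c - h) - ((z2 s + q) / 2 - (z2 t + q) / 2) * h\<^sup>2"
    unfolding s(3) t(3) by (simp add: field_simps)
  moreover have "\<bar>(z2 s + q) / 2 - (z2 t + q) / 2\<bar> \<le> B" using half Bs by blast
  then have "\<bar>((z2 s + q) / 2 - (z2 t + q) / 2) * h\<^sup>2\<bar> \<le> B * h\<^sup>2"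
    by (simp add: abs_mult mult_right_mono)
  ultimately have "\<bar>2 * h * z1 c\<bar> \<le> 2 * \<delta> + B * h\<^sup>2" using d by linarith
  then show "2 * h * \<bar>z1 c\<bar> \<le> 2 * \<delta> + B * h\<^sup>2" using \<open>0 < h\<close> by (simp add: abs_mult)
qed

lemma real_derivative_sequence:
  fixes f f' :: "nat \<Rightarrow> real \<Rightarrow> real"
  assumes "0 < h"
    and d: "\<And>n x. x \<in> {c - h<..<c + h} \<Longrightarrow> (f n has_real_derivative f' n x) (at x)"
    and u: "\<And>e. 0 < e \<Longrightarrow> \<forall>\<^sub>F n in sequentially. \<forall>x\<in>{c - h<..<c + h}. \<bar>f' n x - g' x\<bar> \<le> e"
    and lim: "\<And>x. x \<in> {c - h<..<c + h} \<Longrightarrow> (\<lambda>n. f n x) \<longlonglongrightarrow> g x"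
    and x: "x \<in> {c - h<..<c + h}"
  shows "(g has_real_derivative g' x) (at x)"
proof -
  let ?S = "{c - h<..<c + h}"
  have "\<exists>G. \<forall>x\<in>?S. (\<lambda>n. f n x) \<longlonglongrightarrow> G x \<and> (G has_derivative (*) (g' x)) (at x within ?S)"
  proof (rule has_derivative_sequence)
    show "(f n has_derivative (*) (f' n x)) (at x within ?S)" if "x \<in> ?S" for n x
      using has_field_derivative_at_within[OF d[OF that, of n]] unfolding has_field_derivative_def .
    show "\<forall>\<^sub>F n in sequentially. \<forall>x\<in>?S. \<forall>h. norm (f' n x * h - g' x * h) \<le> e * norm h" if "0 < e" for e
      using u[OF that] by eventually_elim (auto simp: left_diff_distrib[symmetric] abs_mult intro!: mult_right_mono)
    show "(\<lambda>n. f n x) \<longlonglongrightarrow> g x" by (rule lim[OF x])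
  qed (use x in auto)
  then obtain G where G: "\<And>x. x \<in> ?S \<Longrightarrow> (\<lambda>n. f n x) \<longlonglongrightarrow> G x"
    "\<And>x. x \<in> ?S \<Longrightarrow> (G has_derivative (*) (g' x)) (at x within ?S)" by blast
  have "(G has_real_derivative g' x) (at x)"
    using G(2)[OF x] at_within_open[OF x open_greaterThanLessThan] by (simp add: has_field_derivative_def)
  then show ?thesis
    by (rule has_field_derivative_transform_within_open[where S = ?S])
       (use x LIMSEQ_unique[OF G(1) lim] in auto)
qed

lemma convergent_if_eventually_close:
  fixes a :: "nat \<Rightarrow> real"
  assumes "0 < K" "\<And>\<eta>. 0 < \<eta> \<Longrightarrow> \<exists>N. \<forall>k\<ge>N. \<forall>j\<ge>N. \<bar>a k - a j\<bar> \<le> K * \<eta>"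
  shows "a \<longlonglongrightarrow> lim a"
proof -
  have "Cauchy a"
    unfolding Cauchy_def
  proof (intro allI impI)
    fix e :: real assume "0 < e"
    then obtain N where N: "\<forall>k\<ge>N. \<forall>j\<ge>N. \<bar>a k - a j\<bar> \<le> K * (e / (2 * K))"
      using assms(2)[of "e / (2 * K)"] assms(1) by auto
    have "K * (e / (2 * K)) < e" using assms(1) \<open>0 < e\<close> by simp
    then show "\<exists>M. \<forall>m\<ge>M. \<forall>n\<ge>M. dist (a m) (a n) < e"
      using N by (intro exI[of _ N]) (force simp: dist_real_def)
  qed
  then show ?thesis using Cauchy_convergent convergent_LIMSEQ_iff by blast
qed

text \<open>Near a wet point of the limit the pressures become constant as \<open>A\<close> tends to
  0. Second differences then make pressures and slopes Cauchy sequences, so the equation passes to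
  the limit with a locally constant multiplier.\<close>

lemma profile_limit:
  fixes u :: "real \<Rightarrow> real" and U U1 p :: "nat \<Rightarrow> real \<Rightarrow> real"
  assumes prof: "\<And>k. profile \<alpha> (A k) (U k) (U1 k) (p k)" and A: "A \<longlonglongrightarrow> 0"
    and unif: "\<And>e. 0 < e \<Longrightarrow> \<forall>\<^sub>F k in sequentially. \<forall>x. \<bar>U k x - u x\<bar> \<le> e"
    and cu: "continuous_on UNIV u"
  shows "\<exists>u1 \<Lambda>. \<forall>x. 0 < u x \<longrightarrow> (u has_real_derivative u1 x) (at x) \<and>
    (u1 has_real_derivative - \<Lambda> x - \<alpha>\<^sup>2 * u x - cos x) (at x) \<and>
    (\<Lambda> has_real_derivative 0) (at x) \<and> (u1 x)\<^sup>2 \<le> 2 * u x * (\<bar>\<Lambda> x\<bar> + 1 + \<alpha>\<^sup>2 * u x)"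
proof -
  note P = profileD[OF prof]
  have Ulim: "(\<lambda>k. U k x) \<longlonglongrightarrow> u x" for x
  proof (rule LIMSEQ_I)
    fix e :: real assume "0 < e"
    then have "\<forall>\<^sub>F k in sequentially. \<forall>x. \<bar>U k x - u x\<bar> \<le> e / 2" using unif[of "e / 2"] by simp
    then obtain N where "\<And>k. k \<ge> N \<Longrightarrow> \<bar>U k x - u x\<bar> \<le> e / 2" unfolding eventually_sequentially by blast
    then show "\<exists>no. \<forall>n\<ge>no. norm (U n x - u x) < e"
      using \<open>0 < e\<close> by (intro exI[of _ N]) (force simp: field_simps)
  qed
  have loc: "\<exists>h y. 0 < h \<and> 0 < y \<and>
      (\<forall>\<^sub>F k in sequentially. \<forall>x\<in>{c - h..c + h}. 0 < U k x \<and> \<bar>p k x - p k c\<bar> \<le> 2 * A k * y powr (- 3 / 4))"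
    if c: "0 < u c" for c
  proof -
    have "isCont u c" using cu by (simp add: continuous_on_eq_continuous_at)
    then obtain d where d: "d > 0" "\<And>x. \<bar>x - c\<bar> < d \<Longrightarrow> \<bar>u x - u c\<bar> < u c / 2"
      unfolding continuous_at_eps_delta dist_real_def using c by (meson half_gt_zero)
    define h where "h = min 1 (d / 2)"
    define y where "y = u c / 4"
    have hy: "0 < h" "h \<le> 1" "0 < y" using d c by (auto simp: h_def y_def)
    have ux: "2 * y \<le> u x" if "x \<in> {c - h..c + h}" for x
    proof -
      have "\<bar>x - c\<bar> < d" using that d(1) by (auto simp: h_def abs_less_iff)
      then have "\<bar>u x - u c\<bar> < u c / 2" by (rule d(2))
      then show ?thesis unfolding y_def by linarith
    qed
    have "\<forall>\<^sub>F k in sequentially. \<forall>x\<in>{c - h..c + h}. 0 < U k x \<and> \<bar>p k x - p k c\<bar> \<le> 2 * A k * y powr (- 3 / 4)"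
      using unif[OF hy(3)]
    proof eventually_elim
      case (elim k)
      have Uy: "y \<le> U k x" if "x \<in> {c - h..c + h}" for x
        using ux[OF that] elim[rule_format, of x] by (simp add: abs_le_iff)
      have "\<bar>p k x - p k c\<bar> \<le> 2 * A k * y powr (- 3 / 4)" if x: "x \<in> {c - h..c + h}" for x
      proof (cases "x \<le> c")
        case True
        show ?thesis
          by (rule profile_variation[OF prof True _ hy(3)]) (use Uy x hy pi_gt3 in auto)
      next
        case False
        have "\<bar>p k c - p k x\<bar> \<le> 2 * A k * y powr (- 3 / 4)"
          by (rule profile_variation[OF prof _ _ hy(3)]) (use Uy x hy pi_gt3 False in auto)
        then show ?thesis by (simp add: abs_minus_commute)
      qed
      moreover have "0 < U k x" if "x \<in> {c - h..c + h}" for x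
        using Uy[OF that] hy by simp
      ultimately show ?case by blast
    qed
    then show ?thesis using hy by blast
  qed
  have ev\<epsilon>: "\<forall>\<^sub>F k in sequentially. 2 * A k * y powr (- 3 / 4) \<le> e" if "0 < e" for e y
  proof -
    have "(\<lambda>k. 2 * A k * y powr (- 3 / 4)) \<longlonglongrightarrow> 2 * 0 * y powr (- 3 / 4)"
      by (intro tendsto_intros A)
    then have "\<forall>\<^sub>F k in sequentially. 2 * A k * y powr (- 3 / 4) < e"
      by (rule order_tendstoD(2)) (use that in simp)
    then show ?thesis by eventually_elim simp
  qed
  define u1 where "u1 x = lim (\<lambda>k. U1 k x)" for x
  define \<Lambda> where "\<Lambda> x = lim (\<lambda>k. p k x)" for x
  have conv: "(\<lambda>k. U1 k c) \<longlonglongrightarrow> u1 c" "(\<lambda>k. p k c) \<longlonglongrightarrow> \<Lambda> c" if c: "0 < u c" for c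
  proof -
    obtain h y where h: "0 < h" "0 < y"
      "\<forall>\<^sub>F k in sequentially. \<forall>x\<in>{c - h..c + h}. 0 < U k x \<and> \<bar>p k x - p k c\<bar> \<le> 2 * A k * y powr (- 3 / 4)"
      using loc[OF c] by blast
    \<comment> \<open>The sum of the constants that \<open>second_difference_bounds\<close> yields
      for pressures and slopes when \<open>\<delta> = 2 * \<eta>\<close> and
      \<open>B = (2 + 2 * \<alpha>\<^sup>2) * \<eta>\<close>.\<close>
    define K where "K = (8 + (2 + 2 * \<alpha>\<^sup>2) * h\<^sup>2) / h\<^sup>2 + (4 + (2 + 2 * \<alpha>\<^sup>2) * h\<^sup>2) / (2 * h)"
    have K1: "0 < (8 + (2 + 2 * \<alpha>\<^sup>2) * h\<^sup>2) / h\<^sup>2" "0 < (4 + (2 + 2 * \<alpha>\<^sup>2) * h\<^sup>2) / (2 * h)"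
      using h by (auto intro!: divide_pos_pos add_pos_nonneg)
    then have "0 < K" unfolding K_def by linarith
    have est: "\<exists>N. \<forall>k\<ge>N. \<forall>j\<ge>N. \<bar>p k c - p j c\<bar> \<le> K * \<eta> \<and> \<bar>U1 k c - U1 j c\<bar> \<le> K * \<eta>" if "0 < \<eta>" for \<eta>
    proof -
      have "\<forall>\<^sub>F k in sequentially. (\<forall>x. \<bar>U k x - u x\<bar> \<le> \<eta>) \<and>
          (\<forall>x\<in>{c - h..c + h}. 0 < U k x \<and> \<bar>p k x - p k c\<bar> \<le> \<eta>)"
        using unif[OF that] ev\<epsilon>[OF that, of y] h(3) by eventually_elim force
      then obtain N where N: "\<And>k x. N \<le> k \<Longrightarrow> \<bar>U k x - u x\<bar> \<le> \<eta>"
        "\<And>k x. N \<le> k \<Longrightarrow> x \<in> {c - h..c + h} \<Longrightarrow> 0 < U k x"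
        "\<And>k x. N \<le> k \<Longrightarrow> x \<in> {c - h..c + h} \<Longrightarrow> \<bar>p k x - p k c\<bar> \<le> \<eta>"
        unfolding eventually_sequentially by blast
      show ?thesis
      proof (intro exI[of _ N] allI impI)
        fix k j assume kj: "N \<le> k" "N \<le> j"
        let ?q = "p k c - p j c"
        have z: "((\<lambda>x. U k x - U j x) has_real_derivative U1 k x - U1 j x) (at x)" for x
          by (intro DERIV_diff P(3))
        have z1: "((\<lambda>x. U1 k x - U1 j x) has_real_derivative
          (- p k x - \<alpha>\<^sup>2 * U k x - cos x) - (- p j x - \<alpha>\<^sup>2 * U j x - cos x)) (at x)"
          if "x \<in> {c - h..c + h}" for x
          by (intro DERIV_diff P(5) N(2)[OF kj(1) that] N(2)[OF kj(2) that])
        have \<delta>: "\<bar>U k x - U j x\<bar> \<le> 2 * \<eta>" for x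
          using N(1)[OF kj(1), of x] N(1)[OF kj(2), of x] by linarith
        have B: "\<bar>(- p k x - \<alpha>\<^sup>2 * U k x - cos x) - (- p j x - \<alpha>\<^sup>2 * U j x - cos x) + ?q\<bar> \<le> (2 + 2 * \<alpha>\<^sup>2) * \<eta>"
          if x: "x \<in> {c - h..c + h}" for x
        proof -
          have "\<bar>\<alpha>\<^sup>2 * (U k x - U j x)\<bar> \<le> \<alpha>\<^sup>2 * (2 * \<eta>)"
            unfolding abs_mult using \<delta>[of x] by (simp add: mult_left_mono)
          then show ?thesis
            using N(3)[OF kj(1) x] N(3)[OF kj(2) x] by (simp add: algebra_simps abs_le_iff)
        qed
        note S = second_difference_bounds[OF h(1) z z1 \<delta> B]
        have "\<bar>?q\<bar> * h\<^sup>2 \<le> (8 + (2 + 2 * \<alpha>\<^sup>2) * h\<^sup>2) * \<eta>" using S(1) by (simp add: algebra_simps)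
        then have q: "\<bar>?q\<bar> \<le> (8 + (2 + 2 * \<alpha>\<^sup>2) * h\<^sup>2) / h\<^sup>2 * \<eta>" using h by (simp add: field_simps)
        have "2 * h * \<bar>U1 k c - U1 j c\<bar> \<le> (4 + (2 + 2 * \<alpha>\<^sup>2) * h\<^sup>2) * \<eta>" using S(2) by (simp add: algebra_simps)
        then have r: "\<bar>U1 k c - U1 j c\<bar> \<le> (4 + (2 + 2 * \<alpha>\<^sup>2) * h\<^sup>2) / (2 * h) * \<eta>" using h by (simp add: field_simps)
        have "(8 + (2 + 2 * \<alpha>\<^sup>2) * h\<^sup>2) / h\<^sup>2 * \<eta> \<le> K * \<eta>" "(4 + (2 + 2 * \<alpha>\<^sup>2) * h\<^sup>2) / (2 * h) * \<eta> \<le> K * \<eta>"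
          by (rule mult_right_mono; use K1 \<open>0 < \<eta>\<close> in \<open>simp add: K_def del: times_divide_eq_left\<close>)+
        then show "\<bar>?q\<bar> \<le> K * \<eta> \<and> \<bar>U1 k c - U1 j c\<bar> \<le> K * \<eta>" using q r by linarith
      qed
    qed
    show "(\<lambda>k. U1 k c) \<longlonglongrightarrow> u1 c" unfolding u1_def
      by (rule convergent_if_eventually_close[OF \<open>0 < K\<close>]) (use est in meson)
    show "(\<lambda>k. p k c) \<longlonglongrightarrow> \<Lambda> c" unfolding \<Lambda>_def
      by (rule convergent_if_eventually_close[OF \<open>0 < K\<close>]) (use est in meson)
  qed
  show ?thesis
  proof (rule exI[of _ u1], rule exI[of _ \<Lambda>], intro allI impI)
    fix c assume c: "0 < u c"
    obtain h0 y where h0: "0 < h0" "0 < y"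
      "\<forall>\<^sub>F k in sequentially. \<forall>x\<in>{c - h0..c + h0}. 0 < U k x \<and> \<bar>p k x - p k c\<bar> \<le> 2 * A k * y powr (- 3 / 4)"
      using loc[OF c] by blast
    have "isCont u c" using cu by (simp add: continuous_on_eq_continuous_at)
    then obtain d where d: "d > 0" "\<And>x. \<bar>x - c\<bar> < d \<Longrightarrow> \<bar>u x - u c\<bar> < u c"
      unfolding continuous_at_eps_delta dist_real_def using c by meson
    define h where "h = min h0 d"
    have h: "0 < h" "h \<le> h0" using d h0 by (auto simp: h_def)
    let ?I = "{c - h<..<c + h}"
    have upos: "0 < u x" if "x \<in> ?I" for x
    proof -
      have "\<bar>x - c\<bar> < d" using that by (auto simp: h_def abs_less_iff)
      then show ?thesis using d(2)[of x] by (simp add: abs_less_iff)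
    qed
    have sub: "x \<in> {c - h0..c + h0}" if "x \<in> ?I" for x using that h(2) by auto
    obtain N where N0: "\<forall>k\<ge>N. \<forall>x\<in>{c - h0..c + h0}. 0 < U k x \<and> \<bar>p k x - p k c\<bar> \<le> 2 * A k * y powr (- 3 / 4)"
      using h0(3) unfolding eventually_sequentially by blast
    have N: "\<And>k x. N \<le> k \<Longrightarrow> x \<in> ?I \<Longrightarrow> 0 < U k x"
      "\<And>k x. N \<le> k \<Longrightarrow> x \<in> ?I \<Longrightarrow> \<bar>p k x - p k c\<bar> \<le> 2 * A k * y powr (- 3 / 4)"
      using N0 sub by blast+
    have \<Lambda>c: "\<Lambda> x = \<Lambda> c" if x: "x \<in> ?I" for x
    proof -
      have "(\<lambda>k. p k x - p k c) \<longlonglongrightarrow> \<Lambda> x - \<Lambda> c"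
        by (intro tendsto_intros conv upos[OF x] c)
      moreover have "(\<lambda>k. p k x - p k c) \<longlonglongrightarrow> 0"
      proof (rule Lim_null_comparison)
        show "\<forall>\<^sub>F k in sequentially. norm (p k x - p k c) \<le> 2 * A k * y powr (- 3 / 4)"
          unfolding eventually_sequentially using N(2)[OF _ x] by auto
        have "(\<lambda>k. 2 * A k * y powr (- 3 / 4)) \<longlonglongrightarrow> 2 * 0 * y powr (- 3 / 4)"
          by (intro tendsto_intros A)
        then show "(\<lambda>k. 2 * A k * y powr (- 3 / 4)) \<longlonglongrightarrow> 0" by simp
      qed
      ultimately show ?thesis using LIMSEQ_unique by fastforce
    qed
    have cI: "c \<in> ?I" using h by simp
    have d\<Lambda>: "(\<Lambda> has_real_derivative 0) (at c)"
      by (rule has_field_derivative_transform_within_open[OF DERIV_const[of "\<Lambda> c"] open_greaterThanLessThan cI])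
         (rule \<Lambda>c[symmetric])
    let ?g = "\<lambda>x. - \<Lambda> c - \<alpha>\<^sup>2 * u x - cos x"
    let ?f = "\<lambda>k x. - p k x - \<alpha>\<^sup>2 * U k x - cos x"
    have un2: "\<forall>\<^sub>F k in sequentially. \<forall>x\<in>?I. \<bar>?f k x - ?g x\<bar> \<le> e" if "0 < e" for e
    proof -
      have e3: "0 < e / 3" "0 < e / (3 * (\<alpha>\<^sup>2 + 1))" using that by (auto intro!: divide_pos_pos add_nonneg_pos)
      have "\<forall>\<^sub>F k in sequentially. \<bar>p k c - \<Lambda> c\<bar> < e / 3"
        using tendstoD[OF conv(2)[OF c] e3(1)] by (simp add: dist_real_def)
      with unif[OF e3(2)] ev\<epsilon>[OF e3(1), of y] eventually_ge_at_top[of N] show ?thesis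
      proof eventually_elim
        case (elim k)
        show ?case
        proof
          fix x assume x: "x \<in> ?I"
          have "\<bar>\<alpha>\<^sup>2 * (U k x - u x)\<bar> \<le> \<alpha>\<^sup>2 * (e / (3 * (\<alpha>\<^sup>2 + 1)))"
            using mult_left_mono[OF elim(1)[rule_format, of x], of "\<alpha>\<^sup>2"] by (simp add: abs_mult)
          also have "\<dots> \<le> (\<alpha>\<^sup>2 + 1) * (e / (3 * (\<alpha>\<^sup>2 + 1)))" using e3 by (intro mult_right_mono) auto
          also have "\<dots> = e / 3" by (simp add: field_simps add_nonneg_eq_0_iff)
          finally have 1: "\<bar>\<alpha>\<^sup>2 * (U k x - u x)\<bar> \<le> e / 3" .
          have 2: "\<bar>p k x - p k c\<bar> \<le> e / 3" using N(2)[OF elim(3) x] elim(2) by linarith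
          have "?f k x - ?g x = - (p k x - p k c) - (p k c - \<Lambda> c) - \<alpha>\<^sup>2 * (U k x - u x)"
            by (simp add: algebra_simps)
          then show "\<bar>?f k x - ?g x\<bar> \<le> e" using 1 2 elim(4) by linarith
        qed
      qed
    qed
    have du1: "(u1 has_real_derivative ?g x) (at x)" if x: "x \<in> ?I" for x
    proof (rule real_derivative_sequence[OF h(1) _ _ _ x])
      \<comment> \<open>Derivatives are required for every index, but \<open>U k\<close> is known to
        be positive on this interval only from \<open>N\<close> on; hence the shift.\<close>
      show "(U1 (k + N) has_real_derivative ?f (k + N) x) (at x)" if "x \<in> ?I" for k x
        by (rule P(5)[OF N(1)[OF _ that]]) simp
      show "\<forall>\<^sub>F k in sequentially. \<forall>x\<in>?I. \<bar>?f (k + N) x - ?g x\<bar> \<le> e" if "0 < e" for e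
        using un2[OF that] sequentially_offset[of "\<lambda>k. \<forall>x\<in>?I. \<bar>?f k x - ?g x\<bar> \<le> e" N] by blast
      show "(\<lambda>k. U1 (k + N) x) \<longlonglongrightarrow> u1 x" if "x \<in> ?I" for x
        using LIMSEQ_ignore_initial_segment[OF conv(1)[OF upos[OF that]]] by simp
    qed
    have un1: "\<forall>\<^sub>F k in sequentially. \<forall>x\<in>?I. \<bar>U1 k x - u1 x\<bar> \<le> e" if "0 < e" for e
    proof -
      have e: "0 < e / 2" "0 < e / (2 * h)" using that h by auto
      have "\<forall>\<^sub>F k in sequentially. \<bar>U1 k c - u1 c\<bar> < e / 2"
        using tendstoD[OF conv(1)[OF c] e(1)] by (simp add: dist_real_def)
      with un2[OF e(2)] eventually_ge_at_top[of N] show ?thesis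
      proof eventually_elim
        case (elim k)
        show ?case
        proof
          fix x assume x: "x \<in> ?I"
          have "norm ((U1 k x - u1 x) - (U1 k c - u1 c)) \<le> e / (2 * h) * norm (x - c)"
          proof (rule field_differentiable_bound[of ?I "\<lambda>x. U1 k x - u1 x" "\<lambda>x. ?f k x - ?g x"])
            show "((\<lambda>x. U1 k x - u1 x) has_real_derivative ?f k z - ?g z) (at z within ?I)" if "z \<in> ?I" for z
              by (rule has_field_derivative_at_within, intro DERIV_diff P(5)[OF N(1)[OF elim(2) that]] du1[OF that])
            show "norm (?f k z - ?g z) \<le> e / (2 * h)" if "z \<in> ?I" for z
              using elim(1) that by simp
          qed (use x cI in auto)
          also have "\<dots> \<le> e / (2 * h) * h"
            using x e by (intro mult_left_mono) (auto simp: abs_le_iff)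
          also have "\<dots> = e / 2" using h by simp
          finally show "\<bar>U1 k x - u1 x\<bar> \<le> e" using elim(3) unfolding real_norm_def by linarith
        qed
      qed
    qed
    have du: "(u has_real_derivative u1 c) (at c)"
      by (rule real_derivative_sequence[OF h(1) P(3) un1 Ulim cI])
    \<comment> \<open>The singular term of the slope bound disappears with \<open>A\<close>. What
      remains forces the slope to vanish wherever the height does: zero contact angle.\<close>
    have "(u1 c)\<^sup>2 \<le> 2 * u c * (\<bar>\<Lambda> c\<bar> + 1 + \<alpha>\<^sup>2 * u c) + 16 * 0 * u c powr (1 / 4)"
    proof (rule LIMSEQ_le)
      show "(\<lambda>k. (U1 k c)\<^sup>2) \<longlonglongrightarrow> (u1 c)\<^sup>2" by (intro tendsto_intros conv c)
      show "(\<lambda>k. 2 * U k c * (\<bar>p k c\<bar> + 1 + \<alpha>\<^sup>2 * U k c) + 16 * A k * U k c powr (1 / 4)) \<longlonglongrightarrow>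
          2 * u c * (\<bar>\<Lambda> c\<bar> + 1 + \<alpha>\<^sup>2 * u c) + 16 * 0 * u c powr (1 / 4)"
        by (intro tendsto_intros conv c Ulim A) (use c in auto)
      show "\<exists>N. \<forall>k\<ge>N. (U1 k c)\<^sup>2 \<le> 2 * U k c * (\<bar>p k c\<bar> + 1 + \<alpha>\<^sup>2 * U k c) + 16 * A k * U k c powr (1 / 4)"
        using profile_slope_bound[OF prof N(1)[OF _ cI]] by blast
    qed
    then show "(u has_real_derivative u1 c) (at c) \<and> (u1 has_real_derivative - \<Lambda> c - \<alpha>\<^sup>2 * u c - cos c) (at c) \<and>
        (\<Lambda> has_real_derivative 0) (at c) \<and> (u1 c)\<^sup>2 \<le> 2 * u c * (\<bar>\<Lambda> c\<bar> + 1 + \<alpha>\<^sup>2 * u c)"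
      using du du1[OF cI] d\<Lambda> by simp
  qed
qed

section \<open>Stationary profiles\<close>

text \<open>The multiplier \<Lambda> is locally constant on the wet set, so different components may
  a priori carry different values. The bound for \<open>u1\<close> encodes zero contact
  angles.\<close>

definition stationary :: "real \<Rightarrow> (real \<Rightarrow> real) \<Rightarrow> (real \<Rightarrow> real) \<Rightarrow> (real \<Rightarrow> real) \<Rightarrow> bool" where
  "stationary \<alpha> u u1 \<Lambda> \<longleftrightarrow>
     continuous_on UNIV u \<and> (\<forall>x. u (x + 2 * pi) = u x) \<and> (\<forall>x. 0 \<le> u x) \<and>
     (\<forall>x. 0 < u x \<longrightarrow> (u has_real_derivative u1 x) (at x) \<and>
        (u1 has_real_derivative - \<Lambda> x - \<alpha>\<^sup>2 * u x - cos x) (at x) \<and>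
        (\<Lambda> has_real_derivative 0) (at x) \<and> (u1 x)\<^sup>2 \<le> 2 * u x * (\<bar>\<Lambda> x\<bar> + 1 + \<alpha>\<^sup>2 * u x))"

lemma stationaryD:
  assumes "stationary \<alpha> u u1 \<Lambda>"
  shows "continuous_on S u" "u (x + 2 * pi) = u x" "0 \<le> u x"
    "0 < u x \<Longrightarrow> (u has_real_derivative u1 x) (at x)"
    "0 < u x \<Longrightarrow> (u1 has_real_derivative - \<Lambda> x - \<alpha>\<^sup>2 * u x - cos x) (at x)"
    "0 < u x \<Longrightarrow> (\<Lambda> has_real_derivative 0) (at x)"
    "0 < u x \<Longrightarrow> (u1 x)\<^sup>2 \<le> 2 * u x * (\<bar>\<Lambda> x\<bar> + 1 + \<alpha>\<^sup>2 * u x)"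
  using assms continuous_on_subset[of UNIV u S] unfolding stationary_def by blast+

lemma MVT_interior:
  fixes f g :: "real \<Rightarrow> real"
  assumes "a < b" "continuous_on {a..b} f" "\<And>x. x \<in> {a<..<b} \<Longrightarrow> (f has_real_derivative g x) (at x)"
  obtains z where "a < z" "z < b" "f b - f a = (b - a) * g z"
proof -
  obtain z where "z \<in> {a<..<b}" "f b - f a = (*) (g z) (b - a)"
    by (rule mvt[OF assms(1,2), of "\<lambda>x. (*) (g x)"])
       (use assms(3) in \<open>auto simp: has_field_derivative_def\<close>)
  then show ?thesis using that by (auto simp: mult.commute)
qed

lemma second_derivative_nonneg_at_zero:
  fixes u v w :: "real \<Rightarrow> real"
  assumes "a < b" "continuous_on {a..b} u" "continuous_on {a..b} v" "continuous_on {a..b} w" "u a = 0" "v a = 0"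
    and u: "\<And>x. x \<in> {a<..<b} \<Longrightarrow> 0 < u x"
    and v: "\<And>x. x \<in> {a<..<b} \<Longrightarrow> (u has_real_derivative v x) (at x)"
    and w: "\<And>x. x \<in> {a<..<b} \<Longrightarrow> (v has_real_derivative w x) (at x)"
  shows "0 \<le> w a"
proof (rule ccontr)
  assume "\<not> 0 \<le> w a"
  then have neg: "w a < 0" by simp
  obtain d where d: "d > 0" "\<And>x. x \<in> {a..b} \<Longrightarrow> \<bar>x - a\<bar> < d \<Longrightarrow> \<bar>w x - w a\<bar> < - w a"
  proof -
    have "a \<in> {a..b}" "0 < - w a" using \<open>a < b\<close> neg by auto
    then obtain d where "d > 0" "\<forall>x\<in>{a..b}. dist x a < d \<longrightarrow> dist (w x) (w a) < - w a"
      using assms(4) unfolding continuous_on_iff by meson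
    then show ?thesis using that by (auto simp: dist_real_def)
  qed
  define x where "x = a + min d (b - a) / 2"
  have x: "a < x" "x < b" "x - a < d" using d(1) \<open>a < b\<close> by (auto simp: x_def min_def field_simps)
  obtain y where y: "a < y" "y < x" "u x - u a = (x - a) * v y"
    by (rule MVT_interior[OF x(1) continuous_on_subset[OF assms(2)] v]) (use x in auto)
  obtain z where z: "a < z" "z < y" "v y - v a = (y - a) * w z"
    by (rule MVT_interior[OF y(1) continuous_on_subset[OF assms(3)] w]) (use x y in auto)
  have "w z < 0" using d(2)[of z] z y x by (auto simp: abs_less_iff)
  then have "v y < 0" using z assms(6) by (simp add: mult_pos_neg)
  then have "u x < 0" using y assms(5) x by (simp add: mult_pos_neg)
  then show False using u[of x] x by auto
qed

text \<open>Let \<open>m\<close> be the midpoint of the component and \<open>\<psi>\<close> the odd solution of \<open>\<psi>'' = - \<alpha>\<^sup>2 \<psi>\<close>. Testing the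
  equation with \<open>\<psi>(x - m)\<close> gives \<open>sin m = 0\<close>, since the contact angles are zero. Testing its derivative
  gives \<open>cos m \<ge> 0\<close>, since \<open>u'' \<ge> 0\<close> at both ends.\<close>

lemma stationary_component:
  assumes st: "stationary \<alpha> u u1 \<Lambda>" and \<alpha>: "0 \<le> \<alpha>" "\<alpha> < 1"
    and ab: "a < b" "b - a \<le> 2 * pi" "u a = 0" "u b = 0" "\<And>x. x \<in> {a<..<b} \<Longrightarrow> 0 < u x"
  shows "\<exists>\<nu>. (\<forall>x\<in>{a<..<b}. \<Lambda> x = \<nu>) \<and> \<nu> \<le> - cos a \<and> \<nu> \<le> - cos b \<and>
      continuous_on {a..b} (\<lambda>x. if 0 < u x then u1 x else 0)"
    "\<exists>k :: int. (a + b) / 2 = 2 * pi * of_int k"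
proof -
  note S = stationaryD[OF st]
  have "\<exists>\<nu>. \<forall>x\<in>{a<..<b}. \<Lambda> x = \<nu>"
    by (rule has_field_derivative_zero_constant)
       (use S(6) ab(5) in \<open>auto intro: has_field_derivative_at_within\<close>)
  then obtain \<nu> where \<nu>: "\<And>x. x \<in> {a<..<b} \<Longrightarrow> \<Lambda> x = \<nu>" by blast
  \<comment> \<open>\<open>u1\<close> is unspecified at dry points. Setting it to 0 there gives a
    function that is continuous up to both ends of the component, by the slope bound.\<close>
  define W where "W x = (if 0 < u x then u1 x else 0)" for x
  define U2 where "U2 x = - \<nu> - \<alpha>\<^sup>2 * u x - cos x" for x
  have cu: "continuous_on T u" for T by (rule S(1))
  have cU2: "continuous_on T U2" for T unfolding U2_def by (intro continuous_intros cu)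
  have W0: "W a = 0" "W b = 0" using ab by (auto simp: W_def)
  have dW: "(W has_real_derivative U2 x) (at x)" if x: "x \<in> {a<..<b}" for x
  proof -
    have "(u1 has_real_derivative U2 x) (at x)" using S(5)[OF ab(5)[OF x]] \<nu>[OF x] by (simp add: U2_def)
    then show ?thesis
      by (rule has_field_derivative_transform_within_open[where S = "{a<..<b}"]) (use x ab(5) in \<open>auto simp: W_def\<close>)
  qed
  have du: "(u has_real_derivative W x) (at x)" if x: "x \<in> {a<..<b}" for x
    using S(4)[OF ab(5)[OF x]] ab(5)[OF x] by (simp add: W_def)
  have cW: "continuous_on {a..b} W"
    unfolding continuous_on_def
  proof
    fix x assume x: "x \<in> {a..b}"
    show "(W \<longlongrightarrow> W x) (at x within {a..b})"
    proof (cases "x \<in> {a<..<b}")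
      case True
      show ?thesis
        by (rule Lim_at_imp_Lim_at_within) (use DERIV_isCont[OF dW[OF True]] in \<open>simp add: isCont_def\<close>)
    next
      case False
      then have ux: "u x = 0" using x ab by (cases "x = a") auto
      define G where "G y = sqrt (2 * u y * (\<bar>\<nu>\<bar> + 1 + \<alpha>\<^sup>2 * u y))" for y
      have "continuous_on {a..b} G" unfolding G_def by (intro continuous_intros cu)
      then have "(G \<longlongrightarrow> G x) (at x within {a..b})" using x by (auto simp: continuous_on_def)
      then have G: "(G \<longlongrightarrow> 0) (at x within {a..b})" by (simp add: G_def ux)
      have "(W \<longlongrightarrow> 0) (at x within {a..b})"
      proof (rule Lim_null_comparison[OF _ G])
        have "norm (W y) \<le> G y" if "y \<in> {a..b}" for y
        proof (cases "y \<in> {a<..<b}")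
          case True
          have "(W y)\<^sup>2 \<le> 2 * u y * (\<bar>\<nu>\<bar> + 1 + \<alpha>\<^sup>2 * u y)"
            using S(7)[OF ab(5)[OF True]] \<nu>[OF True] ab(5)[OF True] by (simp add: W_def)
          then show ?thesis unfolding G_def using real_le_rsqrt[of "\<bar>W y\<bar>"] by simp
        next
          case False
          then have "y = a \<or> y = b" using that by auto
          then show ?thesis using W0 ab by (auto simp: G_def)
        qed
        then show "\<forall>\<^sub>F y in at x within {a..b}. norm (W y) \<le> G y"
          by (auto simp: eventually_at_filter)
      qed
      then show ?thesis using ux by (simp add: W_def)
    qed
  qed
  have U2a: "0 \<le> U2 a"
    by (rule second_derivative_nonneg_at_zero[OF ab(1) cu cW cU2 ab(3) W0(1) ab(5) du dW])
  have U2b: "0 \<le> U2 b"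
  proof -
    have "0 \<le> U2 (- (- b))"
    proof (rule second_derivative_nonneg_at_zero[of "- b" "- a" "\<lambda>x. u (- x)" "\<lambda>x. - W (- x)" "\<lambda>x. U2 (- x)"])
      show "continuous_on {- b..- a} (\<lambda>x. u (- x))" "continuous_on {- b..- a} (\<lambda>x. - W (- x))"
        "continuous_on {- b..- a} (\<lambda>x. U2 (- x))"
        by (intro continuous_intros continuous_on_compose2[OF cu] continuous_on_compose2[OF cW]
            continuous_on_compose2[OF cU2]; auto)+
      show "((\<lambda>x. u (- x)) has_real_derivative - W (- x)) (at x)" if "x \<in> {- b<..<- a}" for x
        using DERIV_chain2[OF du[of "- x"] DERIV_minus[OF DERIV_ident]] that by simp
      show "((\<lambda>x. - W (- x)) has_real_derivative U2 (- x)) (at x)" if "x \<in> {- b<..<- a}" for x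
        using DERIV_minus[OF DERIV_chain2[OF dW[of "- x"] DERIV_minus[OF DERIV_ident]]] that by simp
    qed (use ab W0 in auto)
    then show ?thesis by simp
  qed
  show "\<exists>\<nu>. (\<forall>x\<in>{a<..<b}. \<Lambda> x = \<nu>) \<and> \<nu> \<le> - cos a \<and> \<nu> \<le> - cos b \<and>
      continuous_on {a..b} (\<lambda>x. if 0 < u x then u1 x else 0)"
    using \<nu> U2a U2b ab cW by (intro exI[of _ \<nu>]) (auto simp: U2_def W_def [abs_def])
  define m where "m = (a + b) / 2"
  define l where "l = (b - a) / 2"
  have l: "0 < l" "l \<le> pi" "m + l = b" "m - l = a" using ab by (auto simp: l_def m_def field_simps)
  define \<psi> where "\<psi> s = (if \<alpha> = 0 then s else sin (\<alpha> * s))" for s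
  define \<psi>' where "\<psi>' s = (if \<alpha> = 0 then 1 else \<alpha> * cos (\<alpha> * s))" for s
  have d\<psi>: "(\<psi> has_real_derivative \<psi>' s) (at s)" "(\<psi>' has_real_derivative - \<alpha>\<^sup>2 * \<psi> s) (at s)" for s
    unfolding \<psi>_def [abs_def] \<psi>'_def [abs_def]
    by (cases "\<alpha> = 0"; auto intro!: derivative_eq_intros simp: power2_eq_square)+
  have \<psi>odd: "\<psi> (- s) = - \<psi> s" "\<psi>' (- s) = \<psi>' s" "\<psi> 0 = 0" for s by (auto simp: \<psi>_def \<psi>'_def)
  have \<psi>pos: "0 < \<psi> s" if "0 < s" "s \<le> pi" for s
  proof (cases "\<alpha> = 0")
    case False
    have "\<alpha> * s < pi" using \<alpha> that mult_strict_right_mono[of \<alpha> 1 s] by linarith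
    then show ?thesis using False \<alpha> that by (simp add: \<psi>_def sin_gt_zero)
  qed (use that in \<open>simp add: \<psi>_def\<close>)
  have c\<psi>: "continuous_on T \<psi>" "continuous_on T \<psi>'" for T
    using d\<psi> by (meson DERIV_isCont continuous_at_imp_continuous_on)+
  \<comment> \<open>The mean value theorem for \<Phi>(m + s) - \<Phi>(m - s). Folding at the
    midpoint leaves only the part of the derivative that is even about m.\<close>
  have key: "\<exists>s. 0 < s \<and> s < l \<and> \<Phi> b - \<Phi> a = l * ((D (m + s) + D (m - s)))"
    if c: "continuous_on {a..b} \<Phi>" and d: "\<And>x. x \<in> {a<..<b} \<Longrightarrow> (\<Phi> has_real_derivative D x) (at x)" for \<Phi> D
  proof -
    let ?f = "\<lambda>s. \<Phi> (m + s) - \<Phi> (m - s)"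
    have cf: "continuous_on {0..l} ?f"
      by (intro continuous_intros continuous_on_compose2[OF c]) (use l in auto)
    have df: "(?f has_real_derivative D (m + s) + D (m - s)) (at s)" if "0 < s" "s < l" for s
    proof -
      have "m + s \<in> {a<..<b}" "m - s \<in> {a<..<b}" using that l by auto
      then have "(?f has_real_derivative D (m + s) * 1 - D (m - s) * - 1) (at s)"
        by (intro DERIV_diff DERIV_chain2[OF d]) (auto intro!: derivative_eq_intros)
      then show ?thesis by simp
    qed
    obtain s where s: "0 < s" "s < l" "?f l - ?f 0 = (l - 0) * (D (m + s) + D (m - s))"
      by (rule MVT_interior[OF l(1) cf df]) auto
    then show ?thesis using s l by auto
  qed
  have d\<psi>m: "((\<lambda>x. \<psi> (x - m)) has_real_derivative \<psi>' (x - m)) (at x)"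
    "((\<lambda>x. \<psi>' (x - m)) has_real_derivative - \<alpha>\<^sup>2 * \<psi> (x - m)) (at x)" for x
  proof -
    have sh: "((\<lambda>x. x - m) has_real_derivative 1) (at x)" by (auto intro!: derivative_eq_intros)
    show "((\<lambda>x. \<psi> (x - m)) has_real_derivative \<psi>' (x - m)) (at x)"
      using DERIV_chain2[where g = "\<lambda>x. x - m", OF d\<psi>(1) sh] by simp
    show "((\<lambda>x. \<psi>' (x - m)) has_real_derivative - \<alpha>\<^sup>2 * \<psi> (x - m)) (at x)"
      using DERIV_chain2[where g = "\<lambda>x. x - m", OF d\<psi>(2) sh] by simp
  qed
  have c\<psi>m: "continuous_on T (\<lambda>x. \<psi> (x - m))" "continuous_on T (\<lambda>x. \<psi>' (x - m))" for T
    using d\<psi>m by (meson DERIV_isCont continuous_at_imp_continuous_on)+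
  have sinm: "sin m = 0"
  proof -
    \<comment> \<open>The Wronskian of u and \<psi>: the \<alpha>-terms cancel in its derivative and
      it vanishes at both ends. After folding, \<nu> drops out by oddness and 2 sin m sin s
      \<psi>(s) is left.\<close>
    let ?\<Phi> = "\<lambda>x. W x * \<psi> (x - m) - u x * \<psi>' (x - m)"
    have "\<exists>s. 0 < s \<and> s < l \<and> ?\<Phi> b - ?\<Phi> a = l * ((- (\<nu> + cos (m + s)) * \<psi> (m + s - m)) + (- (\<nu> + cos (m - s)) * \<psi> (m - s - m)))"
    proof (rule key)
      show "continuous_on {a..b} ?\<Phi>" by (intro continuous_intros cW cu c\<psi>m)
      show "(?\<Phi> has_real_derivative - (\<nu> + cos x) * \<psi> (x - m)) (at x)" if x: "x \<in> {a<..<b}" for x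
      proof -
        have "(?\<Phi> has_real_derivative (U2 x * \<psi> (x - m) + \<psi>' (x - m) * W x)
            - (W x * \<psi>' (x - m) + (- \<alpha>\<^sup>2 * \<psi> (x - m)) * u x)) (at x)"
          by (intro DERIV_diff DERIV_mult dW du x d\<psi>m)
        then show ?thesis by (simp add: U2_def algebra_simps)
      qed
    qed
    then obtain s where s: "0 < s" "s < l"
      "0 = l * ((- (\<nu> + cos (m + s)) * \<psi> s) + (- (\<nu> + cos (m - s)) * \<psi> (- s)))"
      using W0 ab by auto
    have "(- (\<nu> + cos (m + s)) * \<psi> s) + (- (\<nu> + cos (m - s)) * \<psi> (- s)) = 2 * (sin m * (sin s * \<psi> s))"
      by (simp add: \<psi>odd cos_add cos_diff algebra_simps)
    moreover have "0 < sin s * \<psi> s" using s l \<psi>pos[of s] sin_gt_zero[of s] by simp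
    ultimately show ?thesis using s l by auto
  qed
  have cosm: "0 \<le> cos m"
  proof -
    \<comment> \<open>The same Wronskian for u' in place of u. Now the boundary terms amount to (U2
      a + U2 b) \<psi>(l) >= 0, and folding leaves 2 cos m sin s \<psi>(s).\<close>
    let ?\<Phi> = "\<lambda>x. U2 x * \<psi> (x - m) - W x * \<psi>' (x - m)"
    have "\<exists>s. 0 < s \<and> s < l \<and> ?\<Phi> b - ?\<Phi> a = l * (sin (m + s) * \<psi> (m + s - m) + sin (m - s) * \<psi> (m - s - m))"
    proof (rule key)
      show "continuous_on {a..b} ?\<Phi>" by (intro continuous_intros cW cU2 c\<psi>m)
      show "(?\<Phi> has_real_derivative sin x * \<psi> (x - m)) (at x)" if x: "x \<in> {a<..<b}" for x
      proof -
        have dU2: "(U2 has_real_derivative - \<alpha>\<^sup>2 * W x + sin x) (at x)"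
          unfolding U2_def [abs_def] by (auto intro!: derivative_eq_intros du[OF x])
        have "(?\<Phi> has_real_derivative ((- \<alpha>\<^sup>2 * W x + sin x) * \<psi> (x - m) + \<psi>' (x - m) * U2 x)
            - (U2 x * \<psi>' (x - m) + (- \<alpha>\<^sup>2 * \<psi> (x - m)) * W x)) (at x)"
          by (intro DERIV_diff DERIV_mult dW dU2 x d\<psi>m)
        then show ?thesis by (simp add: algebra_simps)
      qed
    qed
    then obtain s where s: "0 < s" "s < l"
      "U2 b * \<psi> (b - m) - U2 a * \<psi> (a - m) = l * (sin (m + s) * \<psi> s + sin (m - s) * \<psi> (- s))"
      using W0 by auto
    have bm: "b - m = l" "a - m = - l" using l by auto
    have "U2 b * \<psi> (b - m) - U2 a * \<psi> (a - m) = (U2 b + U2 a) * \<psi> l"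
      unfolding bm \<psi>odd by (simp add: algebra_simps)
    moreover have "\<dots> \<ge> 0" using U2a U2b \<psi>pos[of l] l by simp
    moreover have "sin (m + s) * \<psi> s + sin (m - s) * \<psi> (- s) = 2 * (cos m * (sin s * \<psi> s))"
      by (simp add: \<psi>odd sin_add sin_diff algebra_simps)
    ultimately have "0 \<le> l * (2 * (cos m * (sin s * \<psi> s)))" using s(3) by simp
    moreover have "0 < sin s * \<psi> s" using s l \<psi>pos[of s] sin_gt_zero[of s] by simp
    ultimately show ?thesis using l(1) by (simp add: zero_le_mult_iff)
  qed
  have "cos m = 1" using sinm cosm sin_cos_squared_add[of m] by (auto simp: power2_eq_1_iff)
  then show "\<exists>k :: int. (a + b) / 2 = 2 * pi * of_int k"
    unfolding cos_one_2pi_int m_def by (metis mult.assoc mult.commute)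
qed

text \<open>Shifting the given zero by periods to within pi of \<open>x\<close> provides zeros on
  both sides; take the nearest ones. As \<open>a + 2 * pi\<close> is a zero too, the component is no
  longer than a period.\<close>

lemma component_exists:
  assumes st: "stationary \<alpha> u u1 \<Lambda>" and "u z = 0" "0 < u x"
  obtains a b where "a < x" "x < b" "b - a \<le> 2 * pi" "u a = 0" "u b = 0" "\<And>y. y \<in> {a<..<b} \<Longrightarrow> 0 < u y"
proof -
  note S = stationaryD[OF st]
  have per: "u (y + 2 * pi * of_int k) = u y" for y k by (rule periodic_int[of u, OF S(2)])
  obtain k :: int where k: "x - z - 2 * pi * of_int k \<in> {-pi..pi}" using int_shift_into_period by blast
  define z0 where "z0 = z + 2 * pi * of_int k"
  have z0: "u z0 = 0" "u (z0 + 2 * pi) = 0" "u (z0 - 2 * pi) = 0" "x - pi \<le> z0" "z0 \<le> x + pi"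
    using per[of z k] S(2)[of z0] S(2)[of "z0 - 2 * pi"] assms(2) k by (auto simp: z0_def)
  have cl: "closed {y. u y = 0}" by (rule closed_Collect_eq) (auto intro: S(1))
  have comp: "compact ({s..t} \<inter> {y. u y = 0})" for s t :: real
    by (rule compact_Int_closed[OF compact_Icc cl])
  have "z0 - 2 * pi \<in> {z0 - 2 * pi..x} \<inter> {y. u y = 0}" using z0 pi_gt_zero by auto
  then obtain a where a: "a \<in> {z0 - 2 * pi..x} \<inter> {y. u y = 0}" "\<And>y. y \<in> {z0 - 2 * pi..x} \<inter> {y. u y = 0} \<Longrightarrow> y \<le> a"
    using compact_attains_sup[OF comp] by blast
  have "z0 + 2 * pi \<in> {x..z0 + 2 * pi} \<inter> {y. u y = 0}" using z0 pi_gt_zero by auto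
  then obtain b where b: "b \<in> {x..z0 + 2 * pi} \<inter> {y. u y = 0}" "\<And>y. y \<in> {x..z0 + 2 * pi} \<inter> {y. u y = 0} \<Longrightarrow> b \<le> y"
    using compact_attains_inf[OF comp] by blast
  have ax: "a < x" "x < b" using a b assms(3) by (auto simp: less_le)
  have "u (a + 2 * pi) = 0" using S(2)[of a] a by simp
  then have "b \<le> a + 2 * pi"
    using a(2)[of "a + 2 * pi"] b(2)[of "a + 2 * pi"] a(1) ax pi_gt_zero b(1)
    by (cases "a + 2 * pi \<le> x"; cases "a + 2 * pi \<le> z0 + 2 * pi") auto
  moreover have "0 < u y" if y: "y \<in> {a<..<b}" for y
  proof (rule ccontr)
    assume "\<not> 0 < u y"
    then have "u y = 0" using S(3)[of y] by simp
    then show False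
      using a(2)[of y] b(2)[of y] a(1) b(1) y by (cases "y \<le> x") auto
  qed
  ultimately show ?thesis using that[of a b] ax a b by auto
qed

section \<open>Global shape and first variation of stationary profiles\<close>

lemma primitiveI_interior:
  assumes "a \<le> b" "continuous_on {a..b} f" "continuous_on {a..b} g"
    and d: "\<And>x. x \<in> {a<..<b} \<Longrightarrow> (f has_real_derivative g x) (at x)"
  shows "primitive a b f g"
  unfolding primitive_def
proof (intro conjI ballI)
  show "g absolutely_integrable_on {a..b}" by (rule absolutely_integrable_continuous_real[OF assms(3)])
  fix x assume x: "x \<in> {a..b}"
  have "(g has_integral f x - f a) {a..x}"
    by (rule fundamental_theorem_of_calculus_interior)
       (use x d continuous_on_subset[OF assms(2)] in \<open>auto simp: has_real_derivative_iff_has_vector_derivative\<close>)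
  then show "f x = f a + integral {a..x} g" by (simp add: integral_unique)
qed

lemma primitive_glue:
  assumes ab: "primitive a b f g" and bc: "primitive b c f g" and "a \<le> b" "b \<le> c"
  shows "primitive a c f g"
  unfolding primitive_def
proof (intro conjI ballI)
  show ai: "g absolutely_integrable_on {a..c}"
    using absolutely_integrable_Un[OF primitiveD(1)[OF ab] primitiveD(1)[OF bc]] assms(3,4)
    by (simp add: ivl_disj_un_two_touch)
  fix x assume x: "x \<in> {a..c}"
  show "f x = f a + integral {a..x} g"
  proof (cases "x \<le> b")
    case True
    then show ?thesis using primitiveD(3)[OF ab, of x] x by auto
  next
    case False
    then have "f x = f b + integral {b..x} g" using primitiveD(3)[OF bc, of x] x by auto
    also have "f b = f a + integral {a..b} g" using primitiveD(3)[OF ab, of b] assms(3) by auto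
    finally show ?thesis
      using integral_Icc_diff[OF ai, of b x] False x assms(3) by auto
  qed
qed

lemma primitive_of_periods:
  assumes "\<And>k :: int. primitive (2 * pi * of_int k - pi) (2 * pi * of_int k + pi) f g"
  shows "primitive a b f g"
proof -
  have N: "primitive (- (2 * pi * real j + pi)) (2 * pi * real j + pi) f g" for j :: nat
  proof (induction j)
    case 0
    then show ?case using assms[of 0] by simp
  next
    case (Suc j)
    have 1: "primitive (2 * pi * real j + pi) (2 * pi * real (Suc j) + pi) f g"
      using assms[of "int (Suc j)"] by (simp add: algebra_simps)
    have 2: "primitive (- (2 * pi * real (Suc j) + pi)) (- (2 * pi * real j + pi)) f g"
      using assms[of "- int (Suc j)"] by (simp add: algebra_simps)
    have "0 \<le> 2 * pi * real j" by simp
    moreover have "2 * pi * real (Suc j) = 2 * pi * real j + 2 * pi" by (simp add: algebra_simps)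
    ultimately show ?case
      using pi_gt_zero by (intro primitive_glue[OF primitive_glue[OF 2 Suc] 1]) linarith+
  qed
  obtain j :: nat where j: "max \<bar>a\<bar> \<bar>b\<bar> \<le> real j" using real_arch_simple by blast
  have "1 * real j \<le> 2 * pi * real j" using pi_gt3 by (intro mult_right_mono) auto
  with j have "- (2 * pi * real j + pi) \<le> a" "b \<le> 2 * pi * real j + pi"
    using pi_gt_zero by linarith+
  then show ?thesis by (rule primitive_subinterval[OF N])
qed

text \<open>All components of the positivity set are centred at multiples of \<open>2\<pi>\<close> and have length at most \<open>2\<pi>\<close>,
  hence they are translates of a single one.\<close>

lemma stationary_structure:
  assumes st: "stationary \<alpha> u u1 \<Lambda>" and \<alpha>: "0 \<le> \<alpha>" "\<alpha> < 1" and "0 < u x0"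
  shows "\<exists>W \<nu> l. 0 < l \<and> l \<le> pi \<and> (\<forall>a b. primitive a b u W) \<and> continuous_on {-pi..pi} W \<and>
    primitive (-l) l W (\<lambda>x. - \<nu> - \<alpha>\<^sup>2 * u x - cos x) \<and>
    ((W (-l) = 0 \<and> W l = 0) \<or> (l = pi \<and> W (-l) = W l)) \<and>
    (\<forall>x\<in>{-pi..pi}. l \<le> \<bar>x\<bar> \<and> l < pi \<longrightarrow> u x = 0 \<and> W x = 0 \<and> \<nu> \<le> - cos x)"
proof -
  note S = stationaryD[OF st]
  have per: "u (y + 2 * pi * of_int k) = u y" for y k by (rule periodic_int[of u, OF S(2)])
  define W where "W x = (if 0 < u x then u1 x else 0)" for x
  show ?thesis
  proof (cases "\<exists>z. u z = 0")
    \<comment> \<open>Without zeros there is no contact line: the droplet has half-width pi, and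
      periodicity of the slope replaces the contact angle condition.\<close>
    case False
    then have pos: "0 < u x" for x using S(3)[of x] less_le by metis
    have "\<exists>\<nu>. \<forall>x\<in>UNIV. \<Lambda> x = \<nu>"
      by (rule has_field_derivative_zero_constant) (use S(6) pos in auto)
    then obtain \<nu> where \<nu>: "\<And>x. \<Lambda> x = \<nu>" by blast
    have du1: "(u1 has_real_derivative - \<nu> - \<alpha>\<^sup>2 * u x - cos x) (at x)" for x
      using S(5)[OF pos] by (simp add: \<nu>)
    have cu1: "continuous_on T u1" for T
      using du1 by (meson DERIV_isCont continuous_at_imp_continuous_on)
    have "((\<lambda>x. u (x + 2 * pi)) has_real_derivative u1 (x + 2 * pi) * 1) (at x)" for x
      by (rule DERIV_chain2[OF S(4)[OF pos]]) (auto intro!: derivative_eq_intros)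
    then have "(u has_real_derivative u1 (x + 2 * pi)) (at x)" for x
      by (simp add: S(2))
    then have p1: "u1 (x + 2 * pi) = u1 x" for x
      by (rule DERIV_unique[OF _ S(4)[OF pos]])
    have 1: "primitive a b u u1" for a b
      by (rule primitiveI_C1[OF has_field_derivative_at_within[OF S(4)[OF pos]] cu1])
    have 2: "primitive (-pi) pi u1 (\<lambda>x. - \<nu> - \<alpha>\<^sup>2 * u x - cos x)"
      by (rule primitiveI_C1[OF has_field_derivative_at_within[OF du1]]) (intro continuous_intros S(1))
    show ?thesis
      by (rule exI[of _ u1], rule exI[of _ \<nu>], rule exI[of _ pi]) (use 1 2 cu1 p1[of "-pi"] in auto)
  next
    case True
    then obtain z where z: "u z = 0" by blast
    have center: "\<exists>k :: int. \<exists>l. 0 < l \<and> l \<le> pi \<and> \<bar>x - 2 * pi * of_int k\<bar> < l \<and>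
        u (2 * pi * of_int k - l) = 0 \<and> u (2 * pi * of_int k + l) = 0 \<and>
        (\<forall>y\<in>{2 * pi * of_int k - l<..<2 * pi * of_int k + l}. 0 < u y)" if x: "0 < u x" for x
    proof -
      obtain a b where ab: "a < x" "x < b" "b - a \<le> 2 * pi" "u a = 0" "u b = 0" "\<And>y. y \<in> {a<..<b} \<Longrightarrow> 0 < u y"
        using component_exists[OF st z x] by blast
      obtain k :: int where k: "(a + b) / 2 = 2 * pi * of_int k"
        using stationary_component(2)[OF st \<alpha> _ ab(3-6)] ab(1,2) by auto
      define l where "l = (b - a) / 2"
      have e: "2 * pi * of_int k - l = a" "2 * pi * of_int k + l = b"
        using k by (auto simp: l_def field_simps)
      have "0 < l" "l \<le> pi" using ab by (auto simp: l_def)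
      moreover have "\<bar>x - 2 * pi * of_int k\<bar> < l" unfolding abs_less_iff using e ab(1,2) by linarith
      ultimately show ?thesis
        using ab by (intro exI[of _ k] exI[of _ l]) (simp add: e)
    qed
    obtain k0 :: int and l where l: "0 < l" "l \<le> pi" "u (2 * pi * of_int k0 - l) = 0" "u (2 * pi * of_int k0 + l) = 0"
      "\<And>y. y \<in> {2 * pi * of_int k0 - l<..<2 * pi * of_int k0 + l} \<Longrightarrow> 0 < u y"
      using center[OF assms(4)] by blast
    have ul: "u (2 * pi * of_int k - l) = 0" "u (2 * pi * of_int k + l) = 0"
      "\<And>y. y \<in> {2 * pi * of_int k - l<..<2 * pi * of_int k + l} \<Longrightarrow> 0 < u y" for k :: int
    proof -
      have sh: "u (y + 2 * pi * of_int k) = u (y + 2 * pi * of_int k0)" for y by (simp add: per)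
      show "u (2 * pi * of_int k - l) = 0" "u (2 * pi * of_int k + l) = 0"
        using sh[of "- l"] sh[of l] l by (auto simp: algebra_simps)
      show "0 < u y" if "y \<in> {2 * pi * of_int k - l<..<2 * pi * of_int k + l}" for y
        using sh[of "y - 2 * pi * of_int k"] l(5)[of "y - 2 * pi * of_int k + 2 * pi * of_int k0"] that by auto
    qed
    \<comment> \<open>A wet point between two translates would lie in a component centred at some 2
      pi j with half-width above \<open>l\<close>; that component would contain 2 pi j + l, which is
      a zero.\<close>
    have zero: "u x = 0" if x: "2 * pi * of_int k + l \<le> x" "x \<le> 2 * pi * of_int (k + 1) - l" for k :: int and x
    proof (rule ccontr)
      assume "u x \<noteq> 0"
      then have "0 < u x" using S(3)[of x] by simp
      from center[OF this] obtain j :: int and l' where j: "0 < l'" "l' \<le> pi" "\<bar>x - 2 * pi * of_int j\<bar> < l'"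
        "\<And>y. y \<in> {2 * pi * of_int j - l'<..<2 * pi * of_int j + l'} \<Longrightarrow> 0 < u y" by blast
      have "\<bar>x - 2 * pi * of_int j\<bar> < l"
      proof (rule ccontr)
        assume "\<not> \<bar>x - 2 * pi * of_int j\<bar> < l"
        then have h: "2 * pi * of_int j + l \<in> {2 * pi * of_int j - l'<..<2 * pi * of_int j + l'}"
          using j l(1) by auto
        show False using j(4)[OF h] ul(2)[of j] by simp
      qed
      then have xl: "2 * pi * of_int j - l < x" "x < 2 * pi * of_int j + l" by auto
      have "2 * pi * of_int (k + 1) = 2 * pi * of_int k + 2 * pi" by (simp add: algebra_simps)
      then have "2 * pi * of_int k < 2 * pi * of_int j" "2 * pi * of_int j < 2 * pi * of_int (k + 1)"
        using x xl by linarith+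
      then have "k < j" "j < k + 1" using pi_gt_zero by auto
      then show False by simp
    qed
    have lam: "\<exists>\<nu>. (\<forall>x\<in>{-l<..<l}. \<Lambda> x = \<nu>) \<and> \<nu> \<le> - cos (-l) \<and> \<nu> \<le> - cos l \<and>
      continuous_on {-l..l} (\<lambda>x. if 0 < u x then u1 x else 0)"
      by (rule stationary_component(1)[OF st \<alpha>]) (use l(1,2) ul(1,2)[of 0] ul(3)[of _ 0] in auto)
    then obtain \<nu> where \<nu>: "\<And>x. x \<in> {-l<..<l} \<Longrightarrow> \<Lambda> x = \<nu>" "\<nu> \<le> - cos l" "continuous_on {-l..l} W"
      unfolding W_def by auto
    have Wu: "primitive a b u W" for a b
    proof (rule primitive_of_periods)
      fix k :: int
      let ?c = "2 * pi * of_int k"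
      have cW: "continuous_on {?c - l..?c + l} W"
        unfolding W_def
        using stationary_component(1)[OF st \<alpha> _ _ ul(1)[of k] ul(2)[of k]] ul(3)[of _ k] l(1,2) by auto
      have 0: "primitive (?c - l) (?c + l) u W"
        by (rule primitiveI_interior[OF _ S(1) cW]) (use l(1) ul(3)[of _ k] S(4) in \<open>auto simp: W_def\<close>)
      have const: "primitive c d u W" if "\<And>x. x \<in> {c..d} \<Longrightarrow> u x = 0" for c d
        by (rule primitive_cong[OF primitive_cong_ae[OF primitive_const[of c d 0]]])
           (use that in \<open>auto simp: W_def intro!: negligible_subset[OF negligible_empty]\<close>)
      have 1: "primitive (?c + l) (?c + pi) u W"
        by (rule const, rule zero[of k]) (use l(2) in \<open>auto simp: algebra_simps\<close>)
      have 2: "primitive (?c - pi) (?c - l) u W"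
        by (rule const, rule zero[of "k - 1"]) (use l(2) in \<open>auto simp: algebra_simps\<close>)
      show "primitive (?c - pi) (?c + pi) u W"
        by (rule primitive_glue[OF primitive_glue[OF 2 0] 1]) (use l in auto)
    qed
    have W0: "W x = 0 \<and> u x = 0" if "x \<in> {-pi..pi}" "l \<le> \<bar>x\<bar>" for x
    proof -
      have "u x = 0"
      proof (cases "0 \<le> x")
        case True
        then show ?thesis using zero[of 0 x] that l(2) by auto
      next
        case False
        then show ?thesis using zero[of "-1" x] that l(2) by auto
      qed
      then show ?thesis by (simp add: W_def)
    qed
    have cW: "continuous_on {-pi..pi} W"
    proof -
      have 1: "continuous_on {-pi..-l} W" "continuous_on {l..pi} W"
        using W0 l by (auto intro!: continuous_on_eq[OF continuous_on_const[of _ "0 :: real"]])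
      have "continuous_on ({-pi..-l} \<union> {-l..l} \<union> {l..pi}) W"
        by (intro continuous_on_closed_Un 1 \<nu>(3)) auto
      moreover have "{-pi..-l} \<union> {-l..l} \<union> {l..pi} = {-pi..pi}" using l by auto
      ultimately show ?thesis by simp
    qed
    have dW: "primitive (-l) l W (\<lambda>x. - \<nu> - \<alpha>\<^sup>2 * u x - cos x)"
    proof (rule primitiveI_interior[OF _ \<nu>(3)])
      show "continuous_on {-l..l} (\<lambda>x. - \<nu> - \<alpha>\<^sup>2 * u x - cos x)" by (intro continuous_intros S(1))
      fix x assume x: "x \<in> {-l<..<l}"
      have up: "0 < u y" if "y \<in> {-l<..<l}" for y using ul(3)[of y 0] that by auto
      have "(u1 has_real_derivative - \<nu> - \<alpha>\<^sup>2 * u x - cos x) (at x)"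
        using S(5)[OF up[OF x]] \<nu>(1)[OF x] by simp
      then show "(W has_real_derivative - \<nu> - \<alpha>\<^sup>2 * u x - cos x) (at x)"
        by (rule has_field_derivative_transform_within_open[where S = "{-l<..<l}"]) (use x up in \<open>auto simp: W_def\<close>)
    qed (use l in simp)
    have cosl: "\<nu> \<le> - cos x" if "x \<in> {-pi..pi}" "l \<le> \<bar>x\<bar>" for x
    proof -
      have "cos \<bar>x\<bar> \<le> cos l" by (rule cos_monotone_0_pi_le) (use that l in auto)
      then show ?thesis using \<nu>(2) by simp
    qed
    show ?thesis
      by (rule exI[of _ W], rule exI[of _ \<nu>], rule exI[of _ l])
         (use l W0 W0[of l] W0[of "-l"] cosl Wu cW dW in auto)
  qed
qed

text \<open>Adding \<nu> \<phi> is free, as \<phi> has mean zero. Integration by parts then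
  annihilates the part over the droplet, with boundary terms removed by zero slopes or by
  periodicity. On the dry part the integrand is a product of the nonnegative factors \<phi> and -
  \<nu> - cos x. The sign condition is imposed only for \<open>l < pi\<close>, so for a droplet of
  full width the lemma applies to \<phi> and to - \<phi>.\<close>

lemma stationary_first_variation_nonneg:
  assumes l: "0 < l" "l \<le> pi" and uc: "continuous_on {-pi..pi} u" and Wc: "continuous_on {-pi..pi} W"
    and W: "primitive (-l) l W (\<lambda>x. - \<nu> - \<alpha>\<^sup>2 * u x - cos x)"
    and bd: "(W (-l) = 0 \<and> W l = 0) \<or> (l = pi \<and> W (-l) = W l)"
    and off: "\<And>x. x \<in> {-pi..pi} \<Longrightarrow> l \<le> \<bar>x\<bar> \<Longrightarrow> l < pi \<Longrightarrow> u x = 0 \<and> W x = 0 \<and> \<nu> \<le> - cos x"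
    and \<phi>: "primitive (-pi) pi \<phi> \<phi>'" "\<phi> (-pi) = \<phi> pi" "integral {-pi..pi} \<phi> = 0"
    and nn: "\<And>x. x \<in> {-pi..pi} \<Longrightarrow> l < pi \<Longrightarrow> 0 \<le> u x + \<phi> x"
  shows "0 \<le> integral {-pi..pi} (\<lambda>x. W x * \<phi>' x - \<alpha>\<^sup>2 * u x * \<phi> x - \<phi> x * cos x)"
proof -
  define J where "J x = W x * \<phi>' x + \<phi> x * (- \<nu> - \<alpha>\<^sup>2 * u x - cos x)" for x
  have c\<phi>: "continuous_on {-pi..pi} \<phi>" by (rule primitiveD(4)[OF \<phi>(1)])
  have iJ: "J integrable_on {-pi..pi}"
    unfolding J_def
    by (rule integrable_add[OF set_lebesgue_integral_eq_integral(1)[OF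
          absolutely_integrable_continuous_mult[OF Wc primitiveD(1)[OF \<phi>(1)]]]])
       (intro integrable_continuous_real continuous_intros c\<phi> uc)
  have i\<phi>: "\<phi> integrable_on {-pi..pi}" using c\<phi> by (rule integrable_continuous_real)
  have "integral {-pi..pi} (\<lambda>x. W x * \<phi>' x - \<alpha>\<^sup>2 * u x * \<phi> x - \<phi> x * cos x)
    = integral {-pi..pi} (\<lambda>x. J x + \<nu> * \<phi> x)"
    by (simp add: J_def algebra_simps)
  also have "\<dots> = integral {-pi..pi} J + \<nu> * integral {-pi..pi} \<phi>"
    using iJ i\<phi> by (simp add: Henstock_Kurzweil_Integration.integral_add integrable_on_mult_right)
  also have "\<dots> = integral {-pi..pi} J" using \<phi>(3) by simp
  also have "\<dots> = integral {-pi..-l} J + (integral {-l..l} J + integral {l..pi} J)"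
    using Henstock_Kurzweil_Integration.integral_combine[of "-pi" "-l" pi J]
      Henstock_Kurzweil_Integration.integral_combine[of "-l" l pi J]
      integrable_on_subinterval[OF iJ, of "-l" pi] iJ l by auto
  also have "integral {-l..l} J = 0"
  proof -
    have p: "primitive (-l) l (\<lambda>x. W x * \<phi> x) (\<lambda>x. W x * \<phi>' x + \<phi> x * (- \<nu> - \<alpha>\<^sup>2 * u x - cos x))"
      by (rule primitive_mult[OF W primitive_subinterval[OF \<phi>(1)]]) (use l in auto)
    have "integral {-l..l} J = W l * \<phi> l - W (-l) * \<phi> (-l)"
      using primitiveD(5)[OF p, of "-l" l] l by (simp add: J_def [abs_def])
    then show ?thesis using bd \<phi>(2) by auto
  qed
  finally have eq: "integral {-pi..pi} (\<lambda>x. W x * \<phi>' x - \<alpha>\<^sup>2 * u x * \<phi> x - \<phi> x * cos x)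
    = integral {-pi..-l} J + integral {l..pi} J" by simp
  have "0 \<le> integral {c..d} J" if cd: "-pi \<le> c" "d \<le> pi" "\<And>x. x \<in> {c..d} \<Longrightarrow> l \<le> \<bar>x\<bar>" "d - c = pi - l" for c d
  proof (cases "l < pi")
    case True
    show ?thesis
    proof (rule integral_nonneg)
      show "J integrable_on {c..d}" by (rule integrable_on_subinterval[OF iJ]) (use cd in auto)
      fix x assume x: "x \<in> {c..d}"
      then have o: "u x = 0" "W x = 0" "\<nu> \<le> - cos x" using off[of x] cd True by auto
      moreover have "0 \<le> \<phi> x" using nn[of x] o x cd True by auto
      ultimately show "0 \<le> J x" by (simp add: J_def)
    qed
  next
    case False
    then have "c = d" using cd l by simp
    then show ?thesis by simp
  qed
  from this[of "-pi" "-l"] this[of l pi] show ?thesis using eq l by simp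
qed

section \<open>Energy minimizers and dissipation\<close>

lemma C_mass_diff:
  assumes "f \<in> C_mass M" "h \<in> C_mass M" "primitive (-pi) pi f f'" "primitive (-pi) pi h h'"
  shows "primitive (-pi) pi (\<lambda>x. f x - h x) (\<lambda>x. f' x - h' x)" "L2_on (-pi) pi (\<lambda>x. f' x - h' x)"
    "integral {-pi..pi} (\<lambda>x. f x - h x) = 0" "f (-pi) - h (-pi) = f pi - h pi"
proof -
  note f = C_massD[OF assms(1)] and h = C_massD[OF assms(2)]
  show "primitive (-pi) pi (\<lambda>x. f x - h x) (\<lambda>x. f' x - h' x)"
    by (rule primitive_diff[OF assms(3,4)])
  show "L2_on (-pi) pi (\<lambda>x. f' x - h' x)"
    by (rule L2_on_diff[OF weak_deriv_unique_ae(2)[OF f(1) assms(3)] weak_deriv_unique_ae(2)[OF h(1) assms(4)]])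
  have "f integrable_on {-pi..pi}" "h integrable_on {-pi..pi}"
    using H1D(4)[OF f(1)] H1D(4)[OF h(1)] by (auto intro: integrable_continuous_real)
  then show "integral {-pi..pi} (\<lambda>x. f x - h x) = 0"
    using f(3) h(3) by (simp add: Henstock_Kurzweil_Integration.integral_diff)
  show "f (-pi) - h (-pi) = f pi - h pi" using H1D(6)[OF f(1)] H1D(6)[OF h(1)] by simp
qed

lemma periodic_determined:
  assumes "\<And>x. f (x + 2 * pi) = f x" "\<And>x :: real. h (x + 2 * pi) = h x" "\<And>x. x \<in> {-pi..pi} \<Longrightarrow> f x = h x"
  shows "f x = h x"
proof -
  obtain k :: int where k: "x - 2 * pi * of_int k \<in> {-pi..pi}" using int_shift_into_period by blast
  have "f x = f (x - 2 * pi * of_int k)" "h x = h (x - 2 * pi * of_int k)"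
    using periodic_int[of f "x - 2 * pi * of_int k" k, OF assms(1)]
      periodic_int[of h "x - 2 * pi * of_int k" k, OF assms(2)] by simp_all
  then show ?thesis using assms(3)[OF k] by simp
qed

text \<open>The first variation at \<open>u\<close> is nonnegative and the quadratic part is
  coercive, so minimality of \<open>ustar\<close> leaves no room for a difference. The second claim
  mentions only \<open>ustar\<close>, but rests on the equation that \<open>u\<close> brings along:
  for a positive profile the first variation vanishes.\<close>

lemma stationary_eq_minimizer:
  assumes \<alpha>: "0 \<le> \<alpha>" "\<alpha> < 1" and "0 < M" and st: "stationary \<alpha> u u1 \<Lambda>" and mass: "integral {-pi..pi} u = M"
    and s: "ustar \<in> C_mass M" and min: "\<And>f. f \<in> C_mass M \<Longrightarrow> energy \<alpha> ustar \<le> energy \<alpha> f"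
  shows "u x = ustar x"
    "\<lbrakk>\<And>x. 0 < ustar x; f \<in> C_mass M; primitive (-pi) pi f f'; primitive (-pi) pi ustar s'\<rbrakk> \<Longrightarrow>
      energy \<alpha> f = energy \<alpha> ustar + 1 / 2 * (integral {-pi..pi} (\<lambda>x. (f' x - s' x)\<^sup>2)
        - \<alpha>\<^sup>2 * integral {-pi..pi} (\<lambda>x. (f x - ustar x)\<^sup>2))"
proof -
  note S = stationaryD[OF st]
  have \<alpha>2: "\<alpha>\<^sup>2 < 1" using \<alpha> by (simp add: power_less_one_iff)
  have "\<exists>x. 0 < u x"
  proof (rule ccontr)
    assume "\<not> ?thesis"
    then have "u x = 0" for x using S(3)[of x] by (metis less_eq_real_def)
    then have "u = (\<lambda>x. 0)" by auto
    then show False using mass \<open>0 < M\<close> by simp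
  qed
  then obtain x0 where "0 < u x0" by blast
  from stationary_structure[OF st \<alpha> this] obtain W \<nu> l where W: "0 < l" "l \<le> pi" "\<And>a b. primitive a b u W"
    "continuous_on {-pi..pi} W" "primitive (-l) l W (\<lambda>x. - \<nu> - \<alpha>\<^sup>2 * u x - cos x)"
    "(W (-l) = 0 \<and> W l = 0) \<or> (l = pi \<and> W (-l) = W l)"
    "\<And>x. x \<in> {-pi..pi} \<Longrightarrow> l \<le> \<bar>x\<bar> \<Longrightarrow> l < pi \<Longrightarrow> u x = 0 \<and> W x = 0 \<and> \<nu> \<le> - cos x"
    by blast
  have uH: "u \<in> H1"
    by (rule H1I[OF _ W(3) L2_on_continuous[OF W(4)]]) (simp add: periodic_def S(2))
  have uM: "u \<in> C_mass M" by (rule C_massI[OF uH S(3) mass])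
  note var = stationary_first_variation_nonneg[OF W(1,2) S(1) W(4-7)]
  let ?s = "weak_deriv UNIV ustar"
  have sp: "primitive (-pi) pi ustar ?s" by (rule H1D(2)[OF C_massD(1)[OF s]])
  note d = C_mass_diff[OF s uM sp W(3)]
  have L: "0 \<le> integral {-pi..pi} (\<lambda>x. W x * (?s x - W x) - \<alpha>\<^sup>2 * u x * (ustar x - u x) - (ustar x - u x) * cos x)"
    by (rule var[OF _ _ _ d(1,4,3)]) (use C_massD(2)[OF s] in auto)
  have Q: "(1 - \<alpha>\<^sup>2) * integral {-pi..pi} (\<lambda>x. (?s x - W x)\<^sup>2)
     \<le> integral {-pi..pi} (\<lambda>x. (?s x - W x)\<^sup>2) - \<alpha>\<^sup>2 * integral {-pi..pi} (\<lambda>x. (ustar x - u x)\<^sup>2)"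
    by (rule energy_coercive[OF d(1,2,4,3)])
  have "(1 - \<alpha>\<^sup>2) * integral {-pi..pi} (\<lambda>x. (?s x - W x)\<^sup>2) \<le> 0"
  proof -
    have "e \<le> 0" if "a = b + c + 1 / 2 * d" "a \<le> b" "0 \<le> c" "e \<le> d" for a b c d e :: real
      using that by linarith
    from this[OF energy_expand[OF C_massD(1)[OF s] sp uH W(3)] min[OF uM] L Q] show ?thesis .
  qed
  then have "integral {-pi..pi} (\<lambda>x. (?s x - W x)\<^sup>2) \<le> 0"
    using \<alpha>2 by (simp add: mult_le_0_iff)
  then have "(ustar x - u x)\<^sup>2 \<le> 0" if "x \<in> {-pi..pi}" for x
    using sup_bound_mean_zero[OF d(1,2,3) that] pi_gt_zero
    by (meson mult_nonneg_nonpos less_imp_le order_trans zero_le_mult_iff zero_le_numeral)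
  then have "u x = ustar x" if "x \<in> {-pi..pi}" for x using that by force
  then show us: "u x = ustar x" for x
    by (rule periodic_determined[where f = u and h = ustar, OF S(2) H1D(5)[OF C_massD(1)[OF s]]])
  show "energy \<alpha> f = energy \<alpha> ustar + 1 / 2 * (integral {-pi..pi} (\<lambda>x. (f' x - s' x)\<^sup>2)
        - \<alpha>\<^sup>2 * integral {-pi..pi} (\<lambda>x. (f x - ustar x)\<^sup>2))"
    if pos: "\<And>x. 0 < ustar x" and f: "f \<in> C_mass M" "primitive (-pi) pi f f'" and s': "primitive (-pi) pi ustar s'"
  proof -
    have "u = ustar" using us by auto
    then have sW: "primitive (-pi) pi ustar W" using W(3) by auto
    \<comment> \<open>For \<open>l < pi\<close> the point pi would be dry, against
      positivity.\<close>
    have lpi: "l = pi" using W(7)[of pi] W(1,2) us[of pi] pos[of pi] by fastforce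
    note e = C_mass_diff[OF f(1) s f(2) sW]
    have 1: "0 \<le> integral {-pi..pi} (\<lambda>x. W x * (f' x - W x) - \<alpha>\<^sup>2 * u x * (f x - ustar x) - (f x - ustar x) * cos x)"
      by (rule var[OF _ _ _ e(1,4,3)]) (use lpi in auto)
    have "0 \<le> integral {-pi..pi} (\<lambda>x. W x * (- 1 * (f' x - W x)) - \<alpha>\<^sup>2 * u x * (- 1 * (f x - ustar x)) - (- 1 * (f x - ustar x)) * cos x)"
      by (rule var[OF _ _ _ primitive_cmult[OF e(1), of "-1"]]) (use lpi e(4) C_mass_diff(3)[OF s f(1) sW f(2)] in auto)
    also have "\<dots> = integral {-pi..pi} (\<lambda>x. - (W x * (f' x - W x) - \<alpha>\<^sup>2 * u x * (f x - ustar x) - (f x - ustar x) * cos x))"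
      by (rule arg_cong[where f = "integral {-pi..pi}"]) (simp add: fun_eq_iff algebra_simps)
    also have "\<dots> = - integral {-pi..pi} (\<lambda>x. W x * (f' x - W x) - \<alpha>\<^sup>2 * u x * (f x - ustar x) - (f x - ustar x) * cos x)"
      by (rule Henstock_Kurzweil_Integration.integral_neg)
    finally have 2: "integral {-pi..pi} (\<lambda>x. W x * (f' x - W x) - \<alpha>\<^sup>2 * ustar x * (f x - ustar x) - (f x - ustar x) * cos x) = 0"
      using 1 us by simp
    have "integral {-pi..pi} (\<lambda>x. (f' x - W x)\<^sup>2) = integral {-pi..pi} (\<lambda>x. (f' x - s' x)\<^sup>2)"
      by (rule integral_spike[OF primitive_unique[OF sW s']]) auto
    then show ?thesis
      using energy_expand[OF C_massD(1)[OF f(1)] f(2) C_massD(1)[OF s] sW, of \<alpha>] 2 by simp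
  qed
qed

lemma dissipation_density_nonneg: "0 \<le> dissipation_density n \<alpha> f x"
  by (simp add: dissipation_density_def)

text \<open>Cauchy-Schwarz pairs u^(n/2) \<bar>g\<bar>, whose square is the dissipation density,
  with u^(-(n - 3/2)/2), whose square is the integrand bounded by \<open>S\<close>. The exponents
  add up to 3/4, and u >= y lets this weight be pulled out of the integral.\<close>

lemma profile_of_state:
  assumes u: "u \<in> H1" "\<And>x. 0 \<le> u x" and v: "has_weak_deriv UNIV u v" "has_weak_deriv UNIV v w"
    and ex: "\<exists>g. has_weak_deriv {y. 0 < u y} (energy_grad \<alpha> u) g"
    and D: "integrable (lebesgue_on Om) (dissipation_density n \<alpha> u)"
    and S: "(\<integral>\<^sup>+x. neg_power (n - 3 / 2) (u x) \<partial>lebesgue_on Om) \<le> ennreal S" "0 \<le> S"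
    and A: "0 \<le> A" "(LINT x|lebesgue_on Om. dissipation_density n \<alpha> u x) * S \<le> A\<^sup>2"
  shows "profile \<alpha> A u (deriv u) (pressure \<alpha> u)"
  unfolding profile_def
proof (intro conjI allI impI)
  define g where "g = weak_deriv {y. 0 < u y} (energy_grad \<alpha> u)"
  have g: "has_weak_deriv {y. 0 < u y} (energy_grad \<alpha> u) g"
    unfolding g_def weak_deriv_def using ex by (rule someI_ex)
  have cu: "continuous_on T u" for T by (rule H1D(4)[OF u(1)])
  note C = H2_imp_C1[OF u(1) v]
  show "u (x + 2 * pi) = u x" "0 \<le> u x" "(u has_real_derivative deriv u x) (at x)" for x
    using H1D(5)[OF u(1)] u(2) C(1) by auto
  show "0 \<le> A" by fact
  have "isCont (deriv u) x" for x
    using primitiveD(4)[OF C(2)[of "x - 1" "x + 1"]] continuous_on_interior[of "{x - 1..x + 1}" "deriv u" x]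
    by (simp add: continuous_at_imp_continuous_within)
  then show "continuous_on UNIV (deriv u)" by (simp add: continuous_at_imp_continuous_on)
  show "(deriv u has_real_derivative - pressure \<alpha> u x - \<alpha>\<^sup>2 * u x - cos x) (at x)" if "0 < u x" for x
    by (rule pressure_primitive(2)[OF u(1) v g, of x x]) (use that in auto)
  fix r s y
  assume "-pi \<le> r \<and> r \<le> s \<and> s \<le> pi \<and> 0 < y \<and> (\<forall>x\<in>{r..s}. y \<le> u x)"
  then have rs: "-pi \<le> r" "r \<le> s" "s \<le> pi" and y: "0 < y" "\<And>x. x \<in> {r..s} \<Longrightarrow> y \<le> u x" by auto
  have up: "0 < u x" if "x \<in> {r..s}" for x using y(2)[OF that] y(1) by linarith
  have p: "primitive r s (pressure \<alpha> u) g"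
    by (rule pressure_primitive(1)[OF u(1) v g up rs(2)])
  have gi: "(\<lambda>x. \<bar>g x\<bar>) absolutely_integrable_on {r..s}"
    using primitiveD(1)[OF p] by (rule set_integrable_abs)
  define a where "a x = u x powr (n / 2) * \<bar>g x\<bar>" for x
  define b where "b x = u x powr (- (n - 3 / 2) / 2)" for x
  have cpow: "continuous_on {r..s} (\<lambda>x. u x powr c)" for c
    by (intro continuous_on_powr cu continuous_intros) (use up in force)
  have Dai: "dissipation_density n \<alpha> u absolutely_integrable_on {-pi..pi}" by (rule integrable_Om_imp[OF D])
  have Di: "dissipation_density n \<alpha> u integrable_on {-pi..pi}" using Dai by (simp add: absolutely_integrable_on_def)
  have aD: "(a x)\<^sup>2 = dissipation_density n \<alpha> u x" if "x \<in> {r..s}" for x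
    using up[OF that] by (simp add: a_def dissipation_density_def g_def power_mult_distrib powr_power)
  have Drs: "dissipation_density n \<alpha> u integrable_on {r..s}"
    by (rule integrable_on_subinterval[OF Di]) (use rs in auto)
  have La: "L2_on r s a"
    unfolding L2_on_def
  proof
    show "a absolutely_integrable_on {r..s}"
      unfolding a_def by (rule absolutely_integrable_continuous_mult[OF cpow gi])
    show "(\<lambda>x. (a x)\<^sup>2) integrable_on {r..s}"
      by (rule integrable_eq[OF Drs]) (use aD in auto)
  qed
  have Lb: "L2_on r s b" unfolding b_def by (rule L2_on_continuous[OF cpow])
  have a2: "integral {r..s} (\<lambda>x. (a x)\<^sup>2) \<le> (LINT x|lebesgue_on Om. dissipation_density n \<alpha> u x)"
  proof -
    have "integral {r..s} (\<lambda>x. (a x)\<^sup>2) = integral {r..s} (dissipation_density n \<alpha> u)"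
      by (rule Henstock_Kurzweil_Integration.integral_cong) (rule aD)
    also have "\<dots> \<le> integral {-pi..pi} (dissipation_density n \<alpha> u)"
      by (rule integral_subset_le[OF _ Drs Di]) (use rs dissipation_density_nonneg in auto)
    finally show ?thesis using LINT_Om(2)[OF Dai] by simp
  qed
  have b2: "integral {r..s} (\<lambda>x. (b x)\<^sup>2) \<le> S"
  proof (rule integral_le_nn_integral_Om[OF _ _ _ _ S])
    show "continuous_on {r..s} (\<lambda>x. (b x)\<^sup>2)" unfolding b_def by (intro continuous_intros cpow)
    show "ennreal ((b x)\<^sup>2) \<le> neg_power (n - 3 / 2) (u x)" if "x \<in> {r..s}" for x
    proof -
      have "(b x)\<^sup>2 = u x powr (- (n - 3 / 2) / 2 + - (n - 3 / 2) / 2)"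
        unfolding b_def power2_eq_square powr_add ..
      also have "- (n - 3 / 2) / 2 + - (n - 3 / 2) / 2 = - (n - 3 / 2)" by (simp add: field_simps)
      \<comment> \<open>At n = 3/2 the convention that \<open>neg_power 0\<close> is constantly 1
        agrees with \<open>u x powr 0\<close> at positive heights.\<close>
      finally show ?thesis using up[OF that] by (cases "n = 3 / 2") (simp_all add: neg_power_def)
    qed
  qed (use rs in auto)
  have b20: "0 \<le> integral {r..s} (\<lambda>x. (b x)\<^sup>2)" by (rule integral_nonneg[OF L2_onD(3)[OF Lb]]) simp
  have D0: "0 \<le> (LINT x|lebesgue_on Om. dissipation_density n \<alpha> u x)"
    by (rule Bochner_Integration.integral_nonneg) (rule dissipation_density_nonneg)
  have ab: "a x * b x = u x powr (3 / 4) * \<bar>g x\<bar>" if "x \<in> {r..s}" for x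
  proof -
    have "u x powr (n / 2) * u x powr (- (n - 3 / 2) / 2) = u x powr (3 / 4)"
      by (simp add: powr_add[symmetric] field_simps)
    then show ?thesis by (simp add: a_def b_def mult.assoc mult.left_commute)
  qed
  have "(integral {r..s} (\<lambda>x. a x * b x))\<^sup>2 \<le> integral {r..s} (\<lambda>x. (a x)\<^sup>2) * integral {r..s} (\<lambda>x. (b x)\<^sup>2)"
    by (rule Cauchy_Schwarz_integral_Icc[OF La Lb])
  also have "\<dots> \<le> (LINT x|lebesgue_on Om. dissipation_density n \<alpha> u x) * S"
    by (rule mult_mono[OF a2 b2 D0 b20])
  also have "\<dots> \<le> A\<^sup>2" by (rule A(2))
  finally have "integral {r..s} (\<lambda>x. a x * b x) \<le> A" using A(1) by (rule power2_le_imp_le)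
  have "y powr (3 / 4) * \<bar>pressure \<alpha> u r - pressure \<alpha> u s\<bar> = y powr (3 / 4) * \<bar>integral {r..s} g\<bar>"
    using primitiveD(5)[OF p, of r s] rs by (simp add: abs_minus_commute[of "pressure \<alpha> u r"])
  also have "\<dots> \<le> y powr (3 / 4) * integral {r..s} (\<lambda>x. \<bar>g x\<bar>)"
    using integral_norm_bound_integral[OF primitiveD(2)[OF p], of "\<lambda>x. \<bar>g x\<bar>"] gi
    by (intro mult_left_mono) (auto simp: absolutely_integrable_on_def)
  also have "\<dots> = integral {r..s} (\<lambda>x. y powr (3 / 4) * \<bar>g x\<bar>)" by simp
  also have "\<dots> \<le> integral {r..s} (\<lambda>x. a x * b x)"
  proof (rule integral_le)
    show "(\<lambda>x. y powr (3 / 4) * \<bar>g x\<bar>) integrable_on {r..s}"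
      using gi by (intro integrable_on_mult_right) (simp add: absolutely_integrable_on_def)
    show "(\<lambda>x. a x * b x) integrable_on {r..s}" by (rule L2_on_mult(2)[OF La Lb])
    show "y powr (3 / 4) * \<bar>g x\<bar> \<le> a x * b x" if "x \<in> {r..s}" for x
      unfolding ab[OF that] using y(1) y(2)[OF that] by (intro mult_right_mono powr_mono2) auto
  qed
  also have "\<dots> \<le> A" by fact
  finally have "y powr (3 / 4) * \<bar>pressure \<alpha> u r - pressure \<alpha> u s\<bar> \<le> A" .
  then have "y powr (- 3 / 4) * (y powr (3 / 4) * \<bar>pressure \<alpha> u r - pressure \<alpha> u s\<bar>) \<le> y powr (- 3 / 4) * A"
    by (intro mult_left_mono) auto
  then have "(y powr (- 3 / 4) * y powr (3 / 4)) * \<bar>pressure \<alpha> u r - pressure \<alpha> u s\<bar> \<le> A * y powr (- 3 / 4)"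
    unfolding mult.assoc mult.commute[of A] .
  moreover have "y powr (- 3 / 4) * y powr (3 / 4) = 1" using y(1) by (simp add: powr_add[symmetric])
  ultimately show "\<bar>pressure \<alpha> u r - pressure \<alpha> u s\<bar> \<le> A * y powr (- 3 / 4)"
    by (simp only: mult_1)
qed

text \<open>Let w = u - ustar and let e be twice the excess energy. Then e is the integral of p w,
  where the mean of p may be subtracted. Cauchy-Schwarz, the Poincare inequality for p and the
  coercivity bound (1 - \<alpha>^2) times the integral of w^2 <= e give the claim after division by
  e.\<close>

lemma entropy_production_inequality:
  assumes \<alpha>: "0 \<le> \<alpha>" "\<alpha> < 1" and n: "0 < n" and u: "u \<in> C_mass M" and v: "has_weak_deriv UNIV u v" "has_weak_deriv UNIV v w"
    and ex: "\<exists>g. has_weak_deriv {y. 0 < u y} (energy_grad \<alpha> u) g"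
    and D: "integrable (lebesgue_on Om) (dissipation_density n \<alpha> u)"
    and y: "0 < y" "\<And>x. y \<le> u x"
    and s: "ustar \<in> C_mass M" "primitive (-pi) pi ustar s'"
    and EL: "\<And>f f'. f \<in> C_mass M \<Longrightarrow> primitive (-pi) pi f f' \<Longrightarrow> energy \<alpha> f = energy \<alpha> ustar
      + 1 / 2 * (integral {-pi..pi} (\<lambda>x. (f' x - s' x)\<^sup>2) - \<alpha>\<^sup>2 * integral {-pi..pi} (\<lambda>x. (f x - ustar x)\<^sup>2))"
  shows "2 * (1 - \<alpha>\<^sup>2) * y powr n * (energy \<alpha> u - energy \<alpha> ustar) \<le> (LINT x|lebesgue_on Om. dissipation_density n \<alpha> u x)"
proof -
  define g where "g = weak_deriv {y. 0 < u y} (energy_grad \<alpha> u)"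
  have g: "has_weak_deriv {y. 0 < u y} (energy_grad \<alpha> u) g"
    unfolding g_def weak_deriv_def using ex by (rule someI_ex)
  note uC = C_massD[OF u] and C = H2_imp_C1[OF uC(1) v]
  have up: "0 < u x" for x using y(1) y(2)[of x] by linarith
  have per: "u (x + 2 * pi) = u x" for x by (rule H1D(5)[OF uC(1)])
  define p where "p = pressure \<alpha> u"
  define D0 where "D0 = (LINT x|lebesgue_on Om. dissipation_density n \<alpha> u x)"
  have pp: "primitive a b p g" if "a \<le> b" for a b
    unfolding p_def by (rule pressure_primitive(1)[OF uC(1) v g up that])
  have dp: "(deriv u has_real_derivative - p x - \<alpha>\<^sup>2 * u x - cos x) (at x)" for x
    unfolding p_def by (rule pressure_primitive(2)[OF uC(1) v g up, of x x]) auto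
  have d1: "deriv u (x + 2 * pi) = deriv u x" for x
  proof -
    have "((\<lambda>x. u (x + 2 * pi)) has_real_derivative deriv u (x + 2 * pi) * 1) (at x)"
      by (rule DERIV_chain2[OF C(1)]) (auto intro!: derivative_eq_intros)
    then have "(u has_real_derivative deriv u (x + 2 * pi)) (at x)" by (simp add: per)
    then show ?thesis by (rule DERIV_unique[OF _ C(1)])
  qed
  have p1: "p (x + 2 * pi) = p x" for x
  proof -
    have "((\<lambda>x. deriv u (x + 2 * pi)) has_real_derivative (- p (x + 2 * pi) - \<alpha>\<^sup>2 * u (x + 2 * pi) - cos (x + 2 * pi)) * 1) (at x)"
      by (rule DERIV_chain2[OF dp]) (auto intro!: derivative_eq_intros)
    then have "(deriv u has_real_derivative - p (x + 2 * pi) - \<alpha>\<^sup>2 * u x - cos x) (at x)" by (simp add: per d1)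
    from DERIV_unique[OF this dp] show ?thesis by simp
  qed
  have cu: "continuous_on T u" for T by (rule H1D(4)[OF uC(1)])
  have cp: "continuous_on {-pi..pi} p" by (rule primitiveD(4)[OF pp]) simp
  have pu: "primitive (-pi) pi u (deriv u)"
    by (rule primitiveI_C1[OF has_field_derivative_at_within[OF C(1)] primitiveD(4)[OF C(2)]])
  have pd: "primitive (-pi) pi (deriv u) (\<lambda>x. - p x - \<alpha>\<^sup>2 * u x - cos x)"
    by (rule primitiveI_C1[OF has_field_derivative_at_within[OF dp]]) (intro continuous_intros cp cu)
  note W = C_mass_diff[OF s(1) u s(2) pu] and V = C_mass_diff[OF u s(1) pu s(2)]
  define e where "e = integral {-pi..pi} (\<lambda>x. (deriv u x - s' x)\<^sup>2) - \<alpha>\<^sup>2 * integral {-pi..pi} (\<lambda>x. (u x - ustar x)\<^sup>2)"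
  have Ee: "energy \<alpha> u - energy \<alpha> ustar = e / 2" using EL[OF u pu] by (simp add: e_def)
  have cw: "continuous_on {-pi..pi} (\<lambda>x. u x - ustar x)"
    by (intro continuous_intros cu H1D(4)[OF C_massD(1)[OF s(1)]])
  \<comment> \<open>The energy difference is expanded at both states. The expansion at
    \<open>ustar\<close> has no linear term and gives e/2; the one at \<open>u\<close> has minus the
    integral of p w as its linear term. Comparing them yields e.\<close>
  have pw: "integral {-pi..pi} (\<lambda>x. p x * (u x - ustar x)) = e"
  proof -
    have P: "primitive (-pi) pi (\<lambda>x. deriv u x * (ustar x - u x))
        (\<lambda>x. deriv u x * (s' x - deriv u x) + (ustar x - u x) * (- p x - \<alpha>\<^sup>2 * u x - cos x))"
      by (rule primitive_mult[OF pd W(1)])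
    have 0: "integral {-pi..pi} (\<lambda>x. deriv u x * (s' x - deriv u x) + (ustar x - u x) * (- p x - \<alpha>\<^sup>2 * u x - cos x)) = 0"
      using primitiveD(5)[OF P, of "-pi" pi] d1[of "-pi"] W(4) by simp
    have "integral {-pi..pi} (\<lambda>x. deriv u x * (s' x - deriv u x) - \<alpha>\<^sup>2 * u x * (ustar x - u x) - (ustar x - u x) * cos x)
      = integral {-pi..pi} (\<lambda>x. (deriv u x * (s' x - deriv u x) + (ustar x - u x) * (- p x - \<alpha>\<^sup>2 * u x - cos x))
          - p x * (u x - ustar x))"
      by (rule arg_cong[where f = "integral {-pi..pi}"]) (simp add: fun_eq_iff algebra_simps)
    also have "\<dots> = 0 - integral {-pi..pi} (\<lambda>x. p x * (u x - ustar x))"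
      using 0 primitiveD(2)[OF P]
      by (subst Henstock_Kurzweil_Integration.integral_diff)
         (auto intro!: integrable_continuous_real continuous_intros cp cw)
    finally have "energy \<alpha> ustar = energy \<alpha> u - integral {-pi..pi} (\<lambda>x. p x * (u x - ustar x)) + e / 2"
      using energy_expand[OF C_massD(1)[OF s(1)] s(2) uC(1) pu, of \<alpha>] by (simp add: e_def power2_commute)
    then show ?thesis using Ee by (simp add: field_simps)
  qed
  define c where "c = integral {-pi..pi} p / (2 * pi)"
  define q where "q x = p x - c" for x
  have ip: "p integrable_on {-pi..pi}" by (rule integrable_continuous_real[OF cp])
  have iq: "integral {-pi..pi} q = 0"
  proof -
    have "integral {-pi..pi} q = integral {-pi..pi} p - integral {-pi..pi} (\<lambda>x. c)"
      unfolding q_def by (rule Henstock_Kurzweil_Integration.integral_diff[OF ip integrable_const_ivl])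
    then show ?thesis by (simp add: c_def)
  qed
  have pq: "primitive (-pi) pi q g"
    using primitive_diff[OF pp[of "-pi" pi] primitive_const[of "-pi" pi c]] by (simp add: q_def [abs_def])
  have cq: "continuous_on {-pi..pi} q" by (rule primitiveD(4)[OF pq])
  have Dai: "dissipation_density n \<alpha> u absolutely_integrable_on {-pi..pi}" by (rule integrable_Om_imp[OF D])
  have Di: "(\<lambda>x. y powr (- n) * dissipation_density n \<alpha> u x) integrable_on {-pi..pi}"
    using Dai by (intro integrable_on_mult_right) (simp add: absolutely_integrable_on_def)
  have bnd: "(g x)\<^sup>2 \<le> y powr (- n) * dissipation_density n \<alpha> u x" for x
  proof -
    have "1 = y powr (- n) * y powr n" using y(1) by (simp add: powr_add[symmetric])
    also have "\<dots> \<le> y powr (- n) * u x powr n"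
      using y n by (intro mult_left_mono powr_mono2) auto
    finally have "1 * (g x)\<^sup>2 \<le> (y powr (- n) * u x powr n) * (g x)\<^sup>2" by (rule mult_right_mono) simp
    then show ?thesis by (simp add: dissipation_density_def g_def mult.assoc)
  qed
  have gai: "g absolutely_integrable_on {-pi..pi}" by (rule primitiveD(1)[OF pq])
  have g2: "(\<lambda>x. (g x)\<^sup>2) integrable_on {-pi..pi}"
  proof (rule measurable_bounded_by_integrable_imp_integrable[OF _ Di])
    show "(\<lambda>x. (g x)\<^sup>2) \<in> borel_measurable (lebesgue_on {-pi..pi})"
      by (intro borel_measurable_power absolutely_integrable_imp_borel_measurable[OF gai]) auto
    show "{-pi..pi} \<in> sets lebesgue" by auto
    show "norm ((g x)\<^sup>2) \<le> y powr (- n) * dissipation_density n \<alpha> u x" for x using bnd[of x] by simp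
  qed
  have Lg: "L2_on (-pi) pi g" using gai g2 by (simp add: L2_on_def)
  have q2: "integral {-pi..pi} (\<lambda>x. (q x)\<^sup>2) \<le> y powr (- n) * D0"
  proof -
    have "integral {-pi..pi} (\<lambda>x. (q x)\<^sup>2) \<le> integral {-pi..pi} (\<lambda>x. (g x)\<^sup>2)"
      by (rule Poincare_Wirtinger[OF pq Lg _ iq]) (use p1[of "-pi"] in \<open>simp add: q_def\<close>)
    also have "\<dots> \<le> integral {-pi..pi} (\<lambda>x. y powr (- n) * dissipation_density n \<alpha> u x)"
      by (rule integral_le[OF g2 Di]) (rule bnd)
    also have "\<dots> = y powr (- n) * D0" using LINT_Om(2)[OF Dai] by (simp add: D0_def)
    finally show ?thesis .
  qed
  have qw: "integral {-pi..pi} (\<lambda>x. q x * (u x - ustar x)) = e"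
  proof -
    have "integral {-pi..pi} (\<lambda>x. q x * (u x - ustar x)) = integral {-pi..pi} (\<lambda>x. p x * (u x - ustar x) - c * (u x - ustar x))"
      by (simp add: q_def algebra_simps)
    also have "\<dots> = e - c * 0"
      unfolding pw[symmetric] V(3)[symmetric]
      by (subst Henstock_Kurzweil_Integration.integral_diff)
         (auto intro!: integrable_continuous_real continuous_intros cp cw)
    finally show ?thesis by simp
  qed
  have \<alpha>2: "\<alpha>\<^sup>2 < 1" using \<alpha> by (simp add: power_less_one_iff)
  let ?w2 = "integral {-pi..pi} (\<lambda>x. (u x - ustar x)\<^sup>2)"
  have w2: "(1 - \<alpha>\<^sup>2) * ?w2 \<le> e"
    using Poincare_Wirtinger[OF V(1,2,4,3)] by (simp add: e_def algebra_simps)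
  have w20: "0 \<le> ?w2" by (rule integral_nonneg) (auto intro!: integrable_continuous_real continuous_intros cw)
  have D00: "0 \<le> D0" unfolding D0_def
    by (rule Bochner_Integration.integral_nonneg) (rule dissipation_density_nonneg)
  have e0: "0 \<le> e" using w2 w20 \<alpha>2 by (meson diff_ge_0_iff_ge less_imp_le mult_nonneg_nonneg order_trans)
  have "e\<^sup>2 \<le> integral {-pi..pi} (\<lambda>x. (q x)\<^sup>2) * ?w2"
    using Cauchy_Schwarz_integral_Icc[OF L2_on_continuous[OF cq] L2_on_continuous[OF cw]] qw by simp
  also have "\<dots> \<le> (y powr (- n) * D0) * ?w2" by (rule mult_right_mono[OF q2 w20])
  finally have "(1 - \<alpha>\<^sup>2) * e\<^sup>2 \<le> (1 - \<alpha>\<^sup>2) * ((y powr (- n) * D0) * ?w2)"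
    using \<alpha>2 by (intro mult_left_mono) auto
  also have "\<dots> = (y powr (- n) * D0) * ((1 - \<alpha>\<^sup>2) * ?w2)" by simp
  also have "\<dots> \<le> (y powr (- n) * D0) * e" using w2 D00 by (intro mult_left_mono) auto
  finally have "((1 - \<alpha>\<^sup>2) * e) * e \<le> (y powr (- n) * D0) * e" by (simp add: power2_eq_square mult.assoc)
  then have "(1 - \<alpha>\<^sup>2) * e \<le> y powr (- n) * D0"
    using e0 D00 by (cases "e = 0") (auto simp: mult_le_cancel_right)
  then have "y powr n * ((1 - \<alpha>\<^sup>2) * e) \<le> y powr n * (y powr (- n) * D0)" by (intro mult_left_mono) auto
  also have "\<dots> = D0" using y(1) by (simp add: mult.assoc[symmetric] powr_add[symmetric])
  finally have "y powr n * ((1 - \<alpha>\<^sup>2) * e) \<le> D0" .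
  moreover have "2 * (1 - \<alpha>\<^sup>2) * y powr n * (e / 2) = y powr n * ((1 - \<alpha>\<^sup>2) * e)" by simp
  ultimately show ?thesis unfolding Ee D0_def[symmetric] by (simp only:)
qed

section \<open>Exponential decay\<close>

text \<open>With N equal steps the hypothesis yields the factor (1 + \<kappa> (b - a)/N)^N, whose
  limit is the exponential. No differentiability of \<open>F\<close> in time enters.\<close>

lemma exponential_decay_of_discrete:
  fixes F :: "real \<Rightarrow> real"
  assumes "a \<le> b" "0 \<le> \<kappa>" and nn: "\<And>t. a \<le> t \<Longrightarrow> t \<le> b \<Longrightarrow> 0 \<le> F t"
    and step: "\<And>s t. a \<le> s \<Longrightarrow> s \<le> t \<Longrightarrow> t \<le> b \<Longrightarrow> F t * (1 + \<kappa> * (t - s)) \<le> F s"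
  shows "F b \<le> F a * exp (- \<kappa> * (b - a))"
proof -
  have N: "F b * (1 + \<kappa> * (b - a) / real N) ^ N \<le> F a" if "0 < N" for N :: nat
  proof -
    define h where "h = (b - a) / real N"
    have h: "0 \<le> h" "real N * h = b - a" using assms(1) that by (auto simp: h_def)
    have "F (a + real j * h) * (1 + \<kappa> * h) ^ j \<le> F a" if "j \<le> N" for j
      using that
    proof (induction j)
      case (Suc j)
      have jb: "a + real (Suc j) * h \<le> b" "a + real j * h \<le> b"
        using mult_right_mono[of "real (Suc j)" "real N" h] mult_right_mono[of "real j" "real N" h] Suc.prems h by auto
      have "F (a + real (Suc j) * h) * (1 + \<kappa> * (a + real (Suc j) * h - (a + real j * h))) \<le> F (a + real j * h)"
        by (rule step) (use h jb in \<open>auto simp: algebra_simps\<close>)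
      then have "F (a + real (Suc j) * h) * (1 + \<kappa> * h) \<le> F (a + real j * h)"
        by (simp add: algebra_simps)
      then have "F (a + real (Suc j) * h) * (1 + \<kappa> * h) * (1 + \<kappa> * h) ^ j \<le> F (a + real j * h) * (1 + \<kappa> * h) ^ j"
        using h assms(2) by (intro mult_right_mono) auto
      also have "\<dots> \<le> F a" using Suc by simp
      finally show ?case by (simp add: mult_ac)
    qed simp
    from this[of N] show ?thesis using h(2) by (simp add: h_def)
  qed
  have "(\<lambda>N. F b * (1 + \<kappa> * (b - a) / real N) ^ N) \<longlonglongrightarrow> F b * exp (\<kappa> * (b - a))"
    by (intro tendsto_intros tendsto_exp_limit_sequentially)
  then have "F b * exp (\<kappa> * (b - a)) \<le> F a"
    by (rule LIMSEQ_le_const2) (use N in \<open>auto intro!: exI[of _ 1]\<close>)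
  then have "F b * exp (\<kappa> * (b - a)) * exp (- \<kappa> * (b - a)) \<le> F a * exp (- \<kappa> * (b - a))"
    by (rule mult_right_mono) simp
  then show ?thesis by (simp add: mult.assoc exp_add[symmetric])
qed

text \<open>A Bernoulli type bound that covers n < 1 and n >= 1 alike. The factor 2 comes from exp
  (- 2 x) <= 1 - x on [0, 1/2].\<close>

lemma powr_one_minus_ge:
  fixes n x :: real
  assumes "0 < n" "0 \<le> x" "x \<le> 1 / 2"
  shows "1 - 2 * n * x \<le> (1 - x) powr n"
proof -
  have "exp (- 2 * x) \<le> 1 - x"
  proof -
    have "1 / (1 - x) = 1 + x / (1 - x)" using assms by (simp add: field_simps)
    also have "\<dots> \<le> exp (x / (1 - x))" by simp
    also have "\<dots> \<le> exp (2 * x)"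
    proof -
      have "x * 1 \<le> x * (2 * (1 - x))" using assms by (intro mult_left_mono) auto
      then show ?thesis using assms by (simp add: pos_divide_le_eq mult_ac)
    qed
    finally show ?thesis using assms by (simp add: exp_minus field_simps)
  qed
  then have "exp (- 2 * x) powr n \<le> (1 - x) powr n" using assms by (intro powr_mono2) auto
  moreover have "exp (- 2 * x) powr n = exp (- (2 * n * x))" by (simp add: powr_def mult_ac)
  moreover have "1 + - (2 * n * x) \<le> exp (- (2 * n * x))" by (rule exp_ge_add_one_self)
  ultimately show ?thesis by linarith
qed

text \<open>The rate \<open>c y\<^sup>n\<close> available at time \<open>t\<close> tends to \<open>c m\<^sup>n\<close> exponentially fast, so that the limiting
  rate is attained up to a constant factor.\<close>

lemma sharp_exponential_decay:
  fixes F :: "real \<Rightarrow> real" and c m n C :: real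
  assumes pos: "0 < c" "0 < m" "0 < n" "0 < C"
    and nn: "\<And>t. 0 \<le> t \<Longrightarrow> 0 \<le> F t" and mono: "\<And>s t. 0 \<le> s \<Longrightarrow> s \<le> t \<Longrightarrow> F t \<le> F s"
    and step: "\<And>s t y. 0 \<le> s \<Longrightarrow> s \<le> t \<Longrightarrow> 0 < y \<Longrightarrow> y \<le> m - C * sqrt (F s) \<Longrightarrow> F t * (1 + c * y powr n * (t - s)) \<le> F s"
    and small: "\<And>e. 0 < e \<Longrightarrow> \<exists>T\<ge>0. F T < e"
  shows "\<exists>K. 0 \<le> K \<and> (\<forall>t\<ge>0. F t \<le> K * exp (- (c * m powr n) * t))"
proof -
  \<comment> \<open>From \<open>T\<close> on the deficit C sqrt F is at most m/2, so that the step
    inequality applies with y = m/2.\<close>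
  obtain T where T: "0 \<le> T" "F T < (m / (2 * C))\<^sup>2"
    using small[of "(m / (2 * C))\<^sup>2"] pos by auto
  have dec: "F t \<le> F s * exp (- (c * y powr n) * (t - s))" if "0 \<le> s" "s \<le> t" "0 < y" "y \<le> m - C * sqrt (F s)" for s t y
  proof (rule exponential_decay_of_discrete[OF that(2)])
    fix r r' assume r: "s \<le> r" "r \<le> r'" "r' \<le> t"
    have "C * sqrt (F r) \<le> C * sqrt (F s)" using mono[of s r] that r pos by simp
    then show "F r' * (1 + c * y powr n * (r' - r)) \<le> F r"
      using step[of r r' y] that r by simp
  qed (use pos nn that in auto)
  define \<delta> where "\<delta> t = C * sqrt (F t) / m" for t
  have CF: "m - C * sqrt (F t) = m * (1 - \<delta> t)" for t using pos by (simp add: \<delta>_def field_simps)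
  have \<delta>0: "0 \<le> \<delta> t" if "0 \<le> t" for t using nn[OF that] pos by (simp add: \<delta>_def)
  have \<delta>T: "\<delta> T \<le> 1 / 2"
  proof -
    have "sqrt (F T) \<le> m / (2 * C)" using T pos nn[of T] by (intro real_le_lsqrt) auto
    then have "C * sqrt (F T) \<le> C * (m / (2 * C))" using pos by (intro mult_left_mono) auto
    then show ?thesis using pos by (simp add: \<delta>_def field_simps)
  qed
  have \<delta>mono: "\<delta> t \<le> \<delta> s" if "0 \<le> s" "s \<le> t" for s t
    using mono[OF that] pos by (simp add: \<delta>_def divide_right_mono mult_left_mono)
  define \<kappa>1 where "\<kappa>1 = c * (m / 2) powr n"
  have \<kappa>1: "0 < \<kappa>1" using pos by (simp add: \<kappa>1_def)
  have phase1: "F t \<le> F T * exp (- \<kappa>1 * (t - T))" if "T \<le> t" for t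
    unfolding \<kappa>1_def
  proof (rule dec)
    have "m * (1 / 2) \<le> m * (1 - \<delta> T)" using \<delta>T pos by (intro mult_left_mono) auto
    then show "m / 2 \<le> m - C * sqrt (F T)" by (simp add: CF)
  qed (use T that pos in auto)
  \<comment> \<open>The square root of the decay factor of \<open>F\<close> over unit time, since
    the relative deficit \<delta> is proportional to sqrt F.\<close>
  define q where "q = exp (- \<kappa>1 / 2)"
  have q: "0 < q" "q < 1" using \<kappa>1 by (auto simp: q_def)
  have \<delta>j: "\<delta> (T + real j) \<le> q ^ j" for j
  proof -
    have "sqrt (F (T + real j)) \<le> sqrt (F T * exp (- \<kappa>1 * real j))"
      using phase1[of "T + real j"] by simp
    also have "\<dots> = sqrt (F T) * q ^ j"
    proof -
      have "exp (- \<kappa>1 * real j) = (q ^ j)\<^sup>2"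
        by (simp add: q_def exp_of_nat_mult[symmetric] exp_double[symmetric] mult.commute)
      then show ?thesis using q by (simp add: real_sqrt_mult)
    qed
    finally have "C / m * sqrt (F (T + real j)) \<le> C / m * (sqrt (F T) * q ^ j)"
      using pos by (intro mult_left_mono) auto
    then have "\<delta> (T + real j) \<le> \<delta> T * q ^ j" by (simp add: \<delta>_def)
    also have "\<dots> \<le> 1 * q ^ j" using \<delta>T q by (intro mult_right_mono) auto
    finally show ?thesis by simp
  qed
  define \<kappa> where "\<kappa> = c * m powr n"
  have \<kappa>: "0 < \<kappa>" using pos by (simp add: \<kappa>_def)
  have onestep: "F (T + real (Suc j)) \<le> F (T + real j) * exp (- \<kappa> + 2 * n * \<kappa> * q ^ j)" for j
  proof -
    define d where "d = \<delta> (T + real j)"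
    have d: "0 \<le> d" "d \<le> 1 / 2" "d \<le> q ^ j" using \<delta>0[of "T + real j"] \<delta>mono[of T "T + real j"] \<delta>T \<delta>j[of j] T
      by (auto simp: d_def)
    have "F (T + real (Suc j)) \<le> F (T + real j) * exp (- (c * (m * (1 - d)) powr n) * (T + real (Suc j) - (T + real j)))"
      by (rule dec) (use T d pos in \<open>auto simp: CF d_def\<close>)
    then have "F (T + real (Suc j)) \<le> F (T + real j) * exp (- (c * (m * (1 - d)) powr n))" by simp
    also have "\<dots> \<le> F (T + real j) * exp (- \<kappa> + 2 * n * \<kappa> * q ^ j)"
    proof (intro mult_left_mono)
      have "\<kappa> * (1 - 2 * n * d) \<le> \<kappa> * (1 - d) powr n"
        using powr_one_minus_ge[OF pos(3) d(1,2)] \<kappa> by (intro mult_left_mono) auto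
      also have "\<dots> = c * (m * (1 - d)) powr n"
        using pos d by (simp add: \<kappa>_def powr_mult)
      finally have 1: "\<kappa> - 2 * n * \<kappa> * d \<le> c * (m * (1 - d)) powr n" by (simp add: algebra_simps)
      have "2 * n * \<kappa> * d \<le> 2 * n * \<kappa> * q ^ j" using d pos \<kappa> by (intro mult_left_mono) auto
      with 1 show "exp (- (c * (m * (1 - d)) powr n)) \<le> exp (- \<kappa> + 2 * n * \<kappa> * q ^ j)" by simp
    qed (use nn T in auto)
    finally show ?thesis .
  qed
  \<comment> \<open>The total loss in the exponent against the sharp rate: the sum of the geometric
    series of the losses in the unit steps.\<close>
  define B where "B = 2 * n * \<kappa> / (1 - q)"
  have B: "0 \<le> B" using pos \<kappa> q by (simp add: B_def)
  have iter: "F (T + real j) \<le> F T * exp (- \<kappa> * real j + 2 * n * \<kappa> * (\<Sum>i<j. q ^ i))" for j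
  proof (induction j)
    case (Suc j)
    have "F (T + real (Suc j)) \<le> F (T + real j) * exp (- \<kappa> + 2 * n * \<kappa> * q ^ j)" by (rule onestep)
    also have "\<dots> \<le> F T * exp (- \<kappa> * real j + 2 * n * \<kappa> * (\<Sum>i<j. q ^ i)) * exp (- \<kappa> + 2 * n * \<kappa> * q ^ j)"
      using Suc by (intro mult_right_mono) auto
    also have "\<dots> = F T * exp (- \<kappa> * real (Suc j) + 2 * n * \<kappa> * (\<Sum>i<Suc j. q ^ i))"
      by (simp add: mult.assoc exp_add[symmetric] algebra_simps)
    finally show ?case .
  qed simp
  have geo: "2 * n * \<kappa> * (\<Sum>i<j. q ^ i) \<le> B" for j
  proof -
    have "(\<Sum>i<j. q ^ i) = (1 - q ^ j) / (1 - q)" using q by (simp add: sum_gp_strict)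
    also have "\<dots> \<le> 1 / (1 - q)" using q by (intro divide_right_mono) auto
    finally have "2 * n * \<kappa> * (\<Sum>i<j. q ^ i) \<le> 2 * n * \<kappa> * (1 / (1 - q))"
      using pos \<kappa> by (intro mult_left_mono) auto
    then show ?thesis by (simp add: B_def)
  qed
  \<comment> \<open>The first summand serves the times up to \<open>T\<close>, the second the later
    ones; the 1 in \<open>T + 1\<close> pays for rounding t - T down to an integer.\<close>
  define K where "K = F 0 * exp (\<kappa> * T) + F T * exp (\<kappa> * (T + 1) + B)"
  have K0: "0 \<le> F 0 * exp (\<kappa> * T)" "0 \<le> F T * exp (\<kappa> * (T + 1) + B)" using nn T by auto
  show ?thesis
  proof (intro exI[of _ K] conjI allI impI)
    show "0 \<le> K" using K0 by (simp add: K_def)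
    fix t :: real assume t: "0 \<le> t"
    show "F t \<le> K * exp (- (c * m powr n) * t)"
    proof (cases "t \<le> T")
      case True
      have "F t \<le> F 0 * 1" using mono[of 0 t] t by simp
      also have "\<dots> \<le> F 0 * exp (\<kappa> * T - \<kappa> * t)" using True \<kappa> nn[of 0] by (intro mult_left_mono) auto
      also have "\<dots> = F 0 * exp (\<kappa> * T) * exp (- \<kappa> * t)" by (simp add: mult.assoc exp_add[symmetric])
      also have "\<dots> \<le> K * exp (- \<kappa> * t)" using K0 by (intro mult_right_mono) (auto simp: K_def)
      finally show ?thesis by (simp add: \<kappa>_def)
    next
      case False
      define j where "j = nat \<lfloor>t - T\<rfloor>"
      have j: "real j \<le> t - T" "t - T < real j + 1" using False by (auto simp: j_def)
      have "F t \<le> F (T + real j)" using mono[of "T + real j" t] T j by simp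
      also have "\<dots> \<le> F T * exp (- \<kappa> * real j + 2 * n * \<kappa> * (\<Sum>i<j. q ^ i))" by (rule iter)
      also have "\<dots> \<le> F T * exp (\<kappa> * (T + 1) + B - \<kappa> * t)"
      proof (intro mult_left_mono)
        have "\<kappa> * (t - T - 1) \<le> \<kappa> * real j" using j \<kappa> by (intro mult_left_mono) auto
        then show "exp (- \<kappa> * real j + 2 * n * \<kappa> * (\<Sum>i<j. q ^ i)) \<le> exp (\<kappa> * (T + 1) + B - \<kappa> * t)"
          using geo[of j] by (simp add: algebra_simps)
      qed (use nn T in auto)
      also have "\<dots> = F T * exp (\<kappa> * (T + 1) + B) * exp (- \<kappa> * t)" by (simp add: mult.assoc exp_add[symmetric])
      also have "\<dots> \<le> K * exp (- \<kappa> * t)" using K0 by (intro mult_right_mono) (auto simp: K_def)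
      finally show ?thesis by (simp add: \<kappa>_def)
    qed
  qed
qed

section \<open>Lower bounds from the integral of a negative power\<close>

text \<open>In the variable x = ln (y/k) both powers are exponentials. Each is bounded below by its
  tangent at 0, and the weights are those for which the linear terms cancel.\<close>

lemma weighted_AM_GM_neg_power:
  fixes y k \<beta> :: real
  assumes "0 < y" "0 < k" "0 < \<beta>"
  shows "1 \<le> \<beta> / (2 + \<beta>) * (y / k)\<^sup>2 + 2 / (2 + \<beta>) * (k powr \<beta> * y powr (- \<beta>))"
proof -
  define x where "x = ln (y / k)"
  have 1: "(y / k)\<^sup>2 = exp (2 * x)"
    using assms by (simp add: x_def exp_double power2_eq_square)
  have 2: "k powr \<beta> * y powr (- \<beta>) = exp (- \<beta> * x)"
    using assms by (simp add: x_def powr_def exp_add[symmetric] ln_div algebra_simps)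
  have "2 + \<beta> \<noteq> 0" using assms by simp
  moreover have "\<beta> * (1 + 2 * x) + 2 * (1 + - \<beta> * x) = 2 + \<beta>" by (simp add: algebra_simps)
  ultimately have "1 = (\<beta> * (1 + 2 * x) + 2 * (1 + - \<beta> * x)) / (2 + \<beta>)" by simp
  also have "\<dots> = \<beta> / (2 + \<beta>) * (1 + 2 * x) + 2 / (2 + \<beta>) * (1 + - \<beta> * x)"
    by (simp add: add_divide_distrib)
  also have "\<dots> \<le> \<beta> / (2 + \<beta>) * exp (2 * x) + 2 / (2 + \<beta>) * exp (- \<beta> * x)"
    using assms by (intro add_mono mult_left_mono exp_ge_add_one_self) auto
  finally show ?thesis unfolding 1 2 .
qed

text \<open>This is Hoelder's inequality on \<open>J\<close> for u^2 and u^-\<beta>. It is proved by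
  integrating the weighted inequality with a free parameter k and optimizing afterwards, which copes
  with the value infinity at zeros of u. \<open>J\<close> is an arbitrary measurable set because a
  dry interval may be cut in two by the end of the period.\<close>

lemma L2_lower_bound_from_neg_power:
  fixes u :: "real \<Rightarrow> real"
  assumes cu: "continuous_on UNIV u" and u0: "\<And>x. 0 \<le> u x" and \<beta>: "0 < \<beta>"
    and S: "(\<integral>\<^sup>+x. neg_power \<beta> (u x) \<partial>lebesgue_on Om) \<le> ennreal S"
    and J: "J \<in> sets lebesgue" "J \<subseteq> Om" "measure lebesgue J = L" "0 < L"
  shows "0 < S" "L * (L / S) powr (2 / \<beta>) \<le> (LINT x|lebesgue_on Om. indicator J x * (u x)\<^sup>2)"
proof -
  let ?M = "lebesgue_on Om"
  have [measurable]: "u \<in> borel_measurable ?M"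
    using continuous_imp_measurable_on_sets_lebesgue[OF continuous_on_subset[OF cu]] by auto
  have JM [measurable]: "J \<in> sets ?M" using J by (simp add: sets_restrict_space_iff)
  have eJ: "emeasure ?M J = ennreal L"
  proof -
    have "emeasure lebesgue J \<le> emeasure lebesgue Om" by (rule emeasure_mono) (use J in auto)
    then have "emeasure lebesgue J \<noteq> \<infinity>" by (auto simp: top_unique)
    then have "emeasure lebesgue J = ennreal L" using J(3) by (simp add: emeasure_eq_ennreal_measure)
    then show ?thesis using J by (simp add: emeasure_restrict_space)
  qed
  have [measurable]: "(\<lambda>x. neg_power \<beta> (u x)) \<in> borel_measurable ?M"
    unfolding neg_power_def by measurable
  define X where "X = (LINT x|?M. indicator J x * (u x)\<^sup>2)"
  have iX: "integrable ?M (\<lambda>x. indicator J x * (u x)\<^sup>2)"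
  proof -
    have "integrable ?M (\<lambda>x. (u x)\<^sup>2)"
      by (rule LINT_Om(1), rule absolutely_integrable_continuous_real)
         (intro continuous_intros continuous_on_subset[OF cu], auto)
    from integrable_mult_indicator[OF JM this] show ?thesis unfolding real_scaleR_def .
  qed
  have X0: "0 \<le> X" unfolding X_def by (rule Bochner_Integration.integral_nonneg) auto
  \<comment> \<open>\<open>ennreal\<close> sends a negative \<open>S\<close> to 0, so the hypothesis
    is first read with this real bound; positivity of \<open>S\<close> itself comes out at the
    end.\<close>
  define S' where "S' = max S 0"
  have S': "0 \<le> S'" "ennreal S = ennreal S'" by (auto simp: S'_def max_def ennreal_neg)
  define \<theta> where "\<theta> = \<beta> / (2 + \<beta>)"
  define \<eta> where "\<eta> = 2 / (2 + \<beta>)"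
  have \<theta>: "0 < \<theta>" "0 < \<eta>" "\<theta> + \<eta> = 1" using \<beta> by (auto simp: \<theta>_def \<eta>_def add_divide_distrib[symmetric])
  have key: "L \<le> \<theta> * X / k\<^sup>2 + \<eta> * k powr \<beta> * S'" if k: "0 < k" for k
  proof -
    have pw: "indicator J x \<le> ennreal (\<theta> / k\<^sup>2 * (indicator J x * (u x)\<^sup>2)) + ennreal (\<eta> * k powr \<beta>) * neg_power \<beta> (u x)" for x
    proof (cases "x \<in> J")
      case True
      show ?thesis
      proof (cases "u x = 0")
        case True
        have "0 < \<eta> * k powr \<beta>" using \<theta> k by simp
        then have "ennreal (\<eta> * k powr \<beta>) * neg_power \<beta> (u x) = top"
          using True \<beta> \<theta> k by (simp add: neg_power_def ennreal_mult_top)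
        then show ?thesis by simp
      next
        case False
        then have up: "0 < u x" using u0[of x] by simp
        have "1 \<le> \<theta> / k\<^sup>2 * (u x)\<^sup>2 + \<eta> * k powr \<beta> * u x powr (- \<beta>)"
          using weighted_AM_GM_neg_power[OF up k \<beta>] by (simp add: \<theta>_def \<eta>_def power_divide mult.assoc)
        then have "ennreal 1 \<le> ennreal (\<theta> / k\<^sup>2 * (u x)\<^sup>2 + \<eta> * k powr \<beta> * u x powr (- \<beta>))"
          by (rule ennreal_leI)
        also have "\<dots> = ennreal (\<theta> / k\<^sup>2 * (u x)\<^sup>2) + ennreal (\<eta> * k powr \<beta>) * ennreal (u x powr (- \<beta>))"
          using \<theta> k by (simp add: ennreal_plus ennreal_mult')
        finally show ?thesis using \<open>x \<in> J\<close> False \<beta> by (simp add: neg_power_def)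
      qed
    qed simp
    have "ennreal L = (\<integral>\<^sup>+x. indicator J x \<partial>?M)" using eJ JM by simp
    also have "\<dots> \<le> (\<integral>\<^sup>+x. ennreal (\<theta> / k\<^sup>2 * (indicator J x * (u x)\<^sup>2)) + ennreal (\<eta> * k powr \<beta>) * neg_power \<beta> (u x) \<partial>?M)"
      by (rule nn_integral_mono) (rule pw)
    also have "\<dots> = (\<integral>\<^sup>+x. ennreal (\<theta> / k\<^sup>2 * (indicator J x * (u x)\<^sup>2)) \<partial>?M) + ennreal (\<eta> * k powr \<beta>) * (\<integral>\<^sup>+x. neg_power \<beta> (u x) \<partial>?M)"
      by (subst nn_integral_add) (auto simp: nn_integral_cmult)
    also have "(\<integral>\<^sup>+x. ennreal (\<theta> / k\<^sup>2 * (indicator J x * (u x)\<^sup>2)) \<partial>?M) = ennreal (\<theta> / k\<^sup>2 * X)"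
      unfolding X_def
      by (subst nn_integral_eq_integral) (use iX \<theta> in auto)
    also have "ennreal (\<theta> / k\<^sup>2 * X) + ennreal (\<eta> * k powr \<beta>) * (\<integral>\<^sup>+x. neg_power \<beta> (u x) \<partial>?M)
      \<le> ennreal (\<theta> / k\<^sup>2 * X) + ennreal (\<eta> * k powr \<beta>) * ennreal S'"
      using S unfolding S'(2) by (intro add_left_mono mult_left_mono) auto
    also have "\<dots> = ennreal (\<theta> / k\<^sup>2 * X + \<eta> * k powr \<beta> * S')"
      using \<theta> k X0 S' by (simp add: ennreal_plus ennreal_mult')
    finally show ?thesis
      using \<theta> k X0 S' by (subst (asm) ennreal_le_iff) auto
  qed
  have "X \<noteq> 0"
  proof
    assume X: "X = 0"
    \<comment> \<open>Chosen so that with k^\<beta> = Q the second term of \<open>key\<close> is at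
      most L/2, a contradiction when X = 0.\<close>
    define Q where "Q = L / (2 * \<eta> * (S' + 1))"
    define k where "k = Q powr (1 / \<beta>)"
    have p: "0 < Q" unfolding Q_def using J(4) \<theta> S' by (intro divide_pos_pos mult_pos_pos) auto
    then have "0 < k" by (simp add: k_def)
    have "k powr \<beta> = Q" using p \<beta> by (simp add: k_def powr_powr)
    then have "k powr \<beta> = L / (2 * \<eta> * (S' + 1))" by (simp add: Q_def)
    moreover have "L \<le> \<eta> * k powr \<beta> * S'" using key[OF \<open>0 < k\<close>] X by simp
    moreover have "\<eta> * (L / (2 * \<eta> * (S' + 1))) * S' = L / 2 * (S' / (S' + 1))" using \<theta>(2) by simp
    ultimately have "L \<le> L / 2 * (S' / (S' + 1))" by simp
    also have "\<dots> \<le> L / 2 * 1" using S' J(4) by (intro mult_left_mono) auto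
    finally show False using J(4) by simp
  qed
  then have "0 < X" using X0 by simp
  \<comment> \<open>The root mean square of u over \<open>J\<close>, which turns the first term of
    \<open>key\<close> into \<theta> L.\<close>
  define k where "k = sqrt (X / L)"
  have k: "0 < k" "k\<^sup>2 = X / L" using \<open>0 < X\<close> J(4) by (auto simp: k_def)
  have "\<theta> * X / k\<^sup>2 = \<theta> * L" using k \<open>0 < X\<close> J(4) by simp
  then have "L \<le> \<theta> * L + \<eta> * k powr \<beta> * S'" using key[OF k(1)] by simp
  moreover have "\<theta> * L + \<eta> * L = L" using \<theta>(3) by (simp add: distrib_right[symmetric])
  ultimately have "\<eta> * L \<le> \<eta> * (k powr \<beta> * S')" unfolding mult.assoc by linarith
  then have kS: "L \<le> k powr \<beta> * S'" using \<theta> by simp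
  then have "S' \<noteq> 0" using J(4) by auto
  then show S0: "0 < S" using S' by (auto simp: S'_def max_def split: if_splits)
  then have "S' = S" by (simp add: S'_def)
  then have "L / S \<le> k powr \<beta>" using kS S0 by (simp add: field_simps)
  then have "(L / S) powr (2 / \<beta>) \<le> (k powr \<beta>) powr (2 / \<beta>)"
    using \<beta> S0 J(4) by (intro powr_mono2) auto
  also have "\<dots> = k\<^sup>2" using \<beta> k by (simp add: powr_powr powr_numeral)
  finally have "L * (L / S) powr (2 / \<beta>) \<le> L * k\<^sup>2" using J(4) by (intro mult_left_mono) auto
  then show "L * (L / S) powr (2 / \<beta>) \<le> (LINT x|lebesgue_on Om. indicator J x * (u x)\<^sup>2)"
    using k(2) J(4) by (simp add: X_def)
qed

text \<open>Shifted to the basic period, the interval may stick out at pi; the overhang is moved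
  back by 2 pi. The two pieces are disjoint because L < 2 pi, as otherwise \<open>f\<close> would
  have integral 0.\<close>

lemma dry_interval_in_period:
  fixes f :: "real \<Rightarrow> real"
  assumes per: "\<And>x. f (x + 2 * pi) = f x" and L: "0 < L" and 0: "\<And>x. x \<in> {a<..<a + L} \<Longrightarrow> f x = 0"
    and int: "integral {-pi..pi} f \<noteq> 0"
  shows "\<exists>J. J \<in> sets lebesgue \<and> J \<subseteq> Om \<and> measure lebesgue J = L \<and> (\<forall>x\<in>J. f x = 0)"
proof -
  obtain k :: int where k: "a - 2 * pi * of_int k \<in> {-pi..pi}" using int_shift_into_period by blast
  define a0 where "a0 = a - 2 * pi * of_int k"
  have a0: "-pi \<le> a0" "a0 \<le> pi" using k by (auto simp: a0_def)
  have z1: "f x = 0" if "a0 < x" "x < a0 + L" for x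
    using periodic_int[of f x k, OF per] 0[of "x + 2 * pi * of_int k"] that by (simp add: a0_def)
  have z2: "f x = 0" if "a0 - 2 * pi < x" "x < a0 + L - 2 * pi" for x
    using z1[of "x + 2 * pi"] per[of x] that by simp
  have L2: "L < 2 * pi"
  proof (rule ccontr)
    assume "\<not> L < 2 * pi"
    then have "f x = 0" if "x \<in> {-pi..pi} - {-pi, pi, a0}" for x
      using z1[of x] z2[of x] that a0 by (cases "a0 < x") auto
    then have "integral {-pi..pi} f = integral {-pi..pi} (\<lambda>x. 0)"
      by (intro integral_spike[of "{-pi, pi, a0}"]) auto
    then show False using int by simp
  qed
  let ?I = "{a0<..<min (a0 + L) pi}" and ?K = "{-pi<..<a0 + L - 2 * pi}"
  show ?thesis
  proof (intro exI[of _ "?I \<union> ?K"] conjI ballI)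
    have "?I \<inter> ?K = {}" using L2 by auto
    then have "measure lebesgue (?I \<union> ?K) = measure lebesgue ?I + measure lebesgue ?K"
      using fmeasurableD2[OF lmeasurable_box[of a0 "min (a0 + L) pi"]]
        fmeasurableD2[OF lmeasurable_box[of "-pi" "a0 + L - 2 * pi"]]
      by (intro measure_Union) auto
    also have "\<dots> = L"
      using a0 L L2 by (cases "a0 + L \<le> pi") (auto simp: min_def)
    finally show "measure lebesgue (?I \<union> ?K) = L" .
    show "f x = 0" if "x \<in> ?I \<union> ?K" for x
      using z1[of x] z2[of x] that a0 by auto
  qed (use a0 L2 in auto)
qed

text \<open>The general bound uses u^2 <= 2 (u - s)^2 + 2 s^2. Where s vanishes the factor 2 is
  spared, and the exact constant of part (ii) needs this.\<close>

lemma L2_norm_le_if_vanishing: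
  assumes u: "continuous_on UNIV u" "continuous_on UNIV s" and J: "J \<in> sets lebesgue" "J \<subseteq> Om"
    and b: "\<And>x. x \<in> J \<Longrightarrow> \<bar>s x\<bar> \<le> b"
  shows "(LINT x|lebesgue_on Om. indicator J x * (u x)\<^sup>2) \<le> 2 * (L2_norm (\<lambda>x. u x - s x))\<^sup>2 + 2 * b\<^sup>2 * measure lebesgue J"
    "(\<And>x. x \<in> J \<Longrightarrow> s x = 0) \<Longrightarrow> (LINT x|lebesgue_on Om. indicator J x * (u x)\<^sup>2) \<le> (L2_norm (\<lambda>x. u x - s x))\<^sup>2"
proof -
  let ?M = "lebesgue_on Om"
  have JM: "J \<in> sets ?M" using J by (simp add: sets_restrict_space_iff)
  have c: "integrable ?M h" if "continuous_on {-pi..pi} h" for h :: "real \<Rightarrow> real"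
    by (rule LINT_Om(1)[OF absolutely_integrable_continuous_real[OF that]])
  have i1: "integrable ?M (\<lambda>x. indicator J x * (u x)\<^sup>2)"
  proof -
    have "integrable ?M (\<lambda>x. (u x)\<^sup>2)" by (intro c continuous_intros continuous_on_subset[OF u(1)]) simp
    from integrable_mult_indicator[OF JM this] show ?thesis unfolding real_scaleR_def .
  qed
  have i2: "integrable ?M (\<lambda>x. (u x - s x)\<^sup>2)"
    by (rule c) (intro continuous_intros continuous_on_subset[OF u(1)] continuous_on_subset[OF u(2)]; simp)
  have i3: "integrable ?M (\<lambda>x. 2 * b\<^sup>2 * indicator J x)"
    using integrable_mult_indicator[OF JM c[of "\<lambda>x. 2 * b\<^sup>2"]] by (simp add: mult.commute)
  have N: "(L2_norm (\<lambda>x. u x - s x))\<^sup>2 = (LINT x|?M. (u x - s x)\<^sup>2)"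
    unfolding L2_norm_def by (simp add: Bochner_Integration.integral_nonneg)
  have "measure ?M J = measure lebesgue J" using J by (simp add: measure_restrict_space)
  then have m: "(LINT x|?M. 2 * b\<^sup>2 * indicator J x) = 2 * b\<^sup>2 * measure lebesgue J" using JM J(2) by (simp add: Int_absorb2)
  have "(LINT x|?M. indicator J x * (u x)\<^sup>2) \<le> (LINT x|?M. 2 * (u x - s x)\<^sup>2 + 2 * b\<^sup>2 * indicator J x)"
  proof (rule Bochner_Integration.integral_mono[OF i1])
    show "integrable ?M (\<lambda>x. 2 * (u x - s x)\<^sup>2 + 2 * b\<^sup>2 * indicator J x)" using i2 i3 by simp
    show "indicator J x * (u x)\<^sup>2 \<le> 2 * (u x - s x)\<^sup>2 + 2 * b\<^sup>2 * indicator J x" for x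
    proof (cases "x \<in> J")
      case True
      have "(s x)\<^sup>2 \<le> b\<^sup>2" using power_mono[OF b[OF True], of 2] by simp
      moreover have "(u x)\<^sup>2 \<le> 2 * (u x - s x)\<^sup>2 + 2 * (s x)\<^sup>2"
        using zero_le_power2[of "u x - 2 * s x"] by (simp add: power2_eq_square algebra_simps)
      ultimately show ?thesis using True by simp
    qed simp
  qed
  also have "\<dots> = 2 * (L2_norm (\<lambda>x. u x - s x))\<^sup>2 + 2 * b\<^sup>2 * measure lebesgue J"
    unfolding N m[symmetric] using i2 i3 by simp
  finally show "(LINT x|lebesgue_on Om. indicator J x * (u x)\<^sup>2) \<le> 2 * (L2_norm (\<lambda>x. u x - s x))\<^sup>2 + 2 * b\<^sup>2 * measure lebesgue J" .
  show "(LINT x|lebesgue_on Om. indicator J x * (u x)\<^sup>2) \<le> (L2_norm (\<lambda>x. u x - s x))\<^sup>2" if "\<And>x. x \<in> J \<Longrightarrow> s x = 0"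
    unfolding N
    by (rule Bochner_Integration.integral_mono[OF i1 i2]) (use that in \<open>auto simp: indicator_def\<close>)
qed

text \<open>Only intervals to the left of \<open>x0\<close> are used: the touchdown point may be pi
  itself, and a short left interval still lies in the open period.\<close>

lemma quadratic_touchdown_bound:
  assumes "vanishes_quadratically_at_point f" "\<And>x. 0 \<le> f x"
  shows "\<exists>x0 c r0. 0 < c \<and> 0 < r0 \<and> (\<forall>r. 0 < r \<and> r < r0 \<longrightarrow> {x0 - r<..<x0} \<subseteq> Om \<and> (\<forall>x\<in>{x0 - r<..<x0}. \<bar>f x\<bar> \<le> 2 * c * r\<^sup>2))"
proof -
  obtain x0 c where x0: "0 < c" "{x \<in> {-pi<..pi}. f x = 0} = {x0}" "f \<sim>[at x0] (\<lambda>x. c * (x - x0)\<^sup>2)"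
    using assms(1) unfolding vanishes_quadratically_at_point_def by blast
  have x0pi: "-pi < x0" "x0 \<le> pi" using x0(2) by auto
  have "((\<lambda>x. if f x = 0 \<and> c * (x - x0)\<^sup>2 = 0 then 1 else f x / (c * (x - x0)\<^sup>2)) \<longlongrightarrow> 1) (at x0)"
    using x0(3) unfolding asymp_equiv_def .
  then have "\<forall>\<^sub>F x in at x0. (if f x = 0 \<and> c * (x - x0)\<^sup>2 = 0 then 1 else f x / (c * (x - x0)\<^sup>2)) < 2"
    by (rule order_tendstoD(2)) simp
  then obtain d where d: "d > 0" "\<And>x. x \<noteq> x0 \<Longrightarrow> dist x x0 < d \<Longrightarrow>
      (if f x = 0 \<and> c * (x - x0)\<^sup>2 = 0 then 1 else f x / (c * (x - x0)\<^sup>2)) < 2"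
    unfolding eventually_at by auto
  define r0 where "r0 = min d (x0 + pi)"
  show ?thesis
  proof (rule exI[of _ x0], rule exI[of _ c], rule exI[of _ r0], intro conjI allI impI)
    fix r assume r: "0 < r \<and> r < r0"
    show "{x0 - r<..<x0} \<subseteq> Om" using r x0pi by (auto simp: r0_def)
    show "\<forall>x\<in>{x0 - r<..<x0}. \<bar>f x\<bar> \<le> 2 * c * r\<^sup>2"
    proof
      fix x assume x: "x \<in> {x0 - r<..<x0}"
      then have "f x / (c * (x - x0)\<^sup>2) < 2"
        using d(2)[of x] r x0(1) by (auto simp: dist_real_def r0_def)
      then have "f x < 2 * (c * (x - x0)\<^sup>2)" using x x0(1) by (simp add: pos_divide_less_eq)
      also have "(x - x0)\<^sup>2 \<le> r\<^sup>2" using x by (intro power2_le_iff_abs_le[THEN iffD2]) auto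
      then have "2 * (c * (x - x0)\<^sup>2) \<le> 2 * c * r\<^sup>2" using x0(1) by simp
      finally show "\<bar>f x\<bar> \<le> 2 * c * r\<^sup>2" using assms(2)[of x] by simp
    qed
  qed (use d x0 x0pi in \<open>auto simp: r0_def\<close>)
qed

text \<open>Balancing the two powers of the width \<open>r\<close> gives a decay exponent \<open>5 / (4\<beta> - 2)\<close>, which is
  smaller than the claimed one; the choice of \<open>r\<close> below yields the latter directly.\<close>

lemma touchdown_rate:
  fixes \<beta> c r0 :: real
  assumes "1 < \<beta>" "0 < c" "0 < r0"
  shows "\<exists>A\<ge>1. \<forall>S Z d. 0 < S \<longrightarrow> 0 \<le> d \<longrightarrow> A * S \<le> Z \<longrightarrow> A \<le> Z \<longrightarrow>
    (\<forall>r. 0 < r \<and> r < r0 \<longrightarrow> r * (r / S) powr (2 / \<beta>) \<le> 2 * d\<^sup>2 + 2 * (2 * c * r\<^sup>2)\<^sup>2 * r) \<longrightarrow>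
    Z powr (- 3 / (2 * (\<beta> - 1))) \<le> d"
proof -
  define \<gamma> where "\<gamma> = 3 / (2 * (\<beta> - 1))"
  have \<gamma>: "0 < \<gamma>" using assms by (simp add: \<gamma>_def)
  \<comment> \<open>Normalized by 4 c^2 \<rho>^5 = 1, so that 4 c^2 r^5 is exactly the square of the
    claimed lower bound.\<close>
  define \<rho> where "\<rho> = (2 * c) powr (- 2 / 5)"
  have \<rho>: "0 < \<rho>" using assms by (simp add: \<rho>_def)
  define G where "G = 16 * c\<^sup>2 * \<rho> powr (4 - 2 / \<beta>)"
  have G: "0 < G" using assms \<rho> by (simp add: G_def)
  \<comment> \<open>The middle summand yields \<open>cond\<close>, the last one yields
    \<open>r < r0\<close>, and the 1 ensures Z >= 1, so that powers of Z are monotone in the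
    exponent.\<close>
  define A where "A = 1 + G powr (\<beta> / 2) + (2 * \<rho> / r0) powr (5 / (2 * \<gamma>))"
  have A: "1 \<le> A" "G powr (\<beta> / 2) \<le> A" "(2 * \<rho> / r0) powr (5 / (2 * \<gamma>)) \<le> A"
    by (auto simp: A_def)
  show ?thesis
  proof (intro exI[of _ A] conjI allI impI)
    fix S Z d :: real
    assume S: "0 < S" and d: "0 \<le> d" and Z: "A * S \<le> Z" "A \<le> Z"
      and H: "\<forall>r. 0 < r \<and> r < r0 \<longrightarrow> r * (r / S) powr (2 / \<beta>) \<le> 2 * d\<^sup>2 + 2 * (2 * c * r\<^sup>2)\<^sup>2 * r"
    have Z1: "1 \<le> Z" using Z A by linarith
    define r where "r = \<rho> * Z powr (- (2 * \<gamma> / 5))"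
    have r: "0 < r" using \<rho> Z1 by (simp add: r_def)
    have rr0: "r < r0"
    proof -
      have "2 * \<rho> / r0 = ((2 * \<rho> / r0) powr (5 / (2 * \<gamma>))) powr (2 * \<gamma> / 5)"
        using \<rho> assms \<gamma> by (simp add: powr_powr)
      also have "\<dots> \<le> Z powr (2 * \<gamma> / 5)" using A Z \<gamma> by (intro powr_mono2) auto
      finally have "2 * \<rho> \<le> r0 * Z powr (2 * \<gamma> / 5)" using assms by (simp add: field_simps)
      moreover have "r * Z powr (2 * \<gamma> / 5) = \<rho>"
        using Z1 by (simp add: r_def mult.assoc powr_add[symmetric])
      ultimately have "2 * r * Z powr (2 * \<gamma> / 5) \<le> r0 * Z powr (2 * \<gamma> / 5)" by (simp add: mult.assoc)
      then have "2 * r \<le> r0" using Z1 by simp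
      then show ?thesis using r by simp
    qed
    have r5: "4 * c\<^sup>2 * r ^ 5 = Z powr (- (2 * \<gamma>))"
    proof -
      have "r ^ 5 = \<rho> ^ 5 * (Z powr (- (2 * \<gamma> / 5))) ^ 5" by (simp add: r_def power_mult_distrib)
      also have "(Z powr (- (2 * \<gamma> / 5))) ^ 5 = Z powr (- (2 * \<gamma>))" using Z1 by (simp add: powr_power)
      also have "\<rho> ^ 5 = (2 * c) powr (- 2)" using assms by (simp add: \<rho>_def powr_power)
      also have "(2 * c) powr (- 2) = 1 / (4 * c\<^sup>2)" using assms by (simp add: powr_minus powr_numeral power_mult_distrib field_simps)
      finally show ?thesis using assms by simp
    qed
    \<comment> \<open>Multiplied by r, the left side is twice the error term 8 c^2 r^5 of
      \<open>H\<close>, so the error uses up at most half of the main term.\<close>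
    have cond: "16 * c\<^sup>2 * r ^ 4 \<le> (r / S) powr (2 / \<beta>)"
    proof -
      \<comment> \<open>Here the claimed exponent enters: the inequality reduces to 12 \<beta> - 6
        >= 10 \<beta> - 10.\<close>
      have e: "2 / \<beta> \<le> 2 * \<gamma> / 5 * (4 - 2 / \<beta>)"
      proof -
        have "2 * \<gamma> / 5 * (4 - 2 / \<beta>) = (12 * \<beta> - 6) / (5 * (\<beta> - 1)) / \<beta>"
          using assms by (simp add: \<gamma>_def divide_simps) (simp add: algebra_simps)?
        also have "\<dots> \<ge> 2 / \<beta>"
          using assms by (intro divide_right_mono) (auto simp: pos_le_divide_eq algebra_simps)
        finally show ?thesis .
      qed
      have "16 * c\<^sup>2 * r powr (4 - 2 / \<beta>) = G * Z powr (- (2 * \<gamma> / 5 * (4 - 2 / \<beta>)))"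
        using \<rho> Z1 by (simp add: r_def G_def powr_mult powr_powr)
      also have "\<dots> \<le> G * Z powr (- (2 / \<beta>))"
        using e G Z1 by (intro mult_left_mono powr_mono) auto
      also have "\<dots> \<le> G * (A * S) powr (- (2 / \<beta>))"
        using G A S Z assms by (intro mult_left_mono powr_mono2') auto
      also have "\<dots> = (G * A powr (- (2 / \<beta>))) * S powr (- (2 / \<beta>))" using A S by (simp add: powr_mult)
      also have "\<dots> \<le> 1 * S powr (- (2 / \<beta>))"
      proof (intro mult_right_mono)
        have "G = (G powr (\<beta> / 2)) powr (2 / \<beta>)" using G assms by (simp add: powr_powr)
        also have "\<dots> \<le> A powr (2 / \<beta>)" using A assms by (intro powr_mono2) auto
        finally have "G * A powr (- (2 / \<beta>)) \<le> A powr (2 / \<beta>) * A powr (- (2 / \<beta>))" by (intro mult_right_mono) auto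
        also have "\<dots> = 1" using A by (simp add: powr_add[symmetric])
        finally show "G * A powr (- (2 / \<beta>)) \<le> 1" .
      qed simp
      finally have "16 * c\<^sup>2 * r powr (4 - 2 / \<beta>) \<le> S powr (- (2 / \<beta>))" by simp
      then have "16 * c\<^sup>2 * r powr (4 - 2 / \<beta>) * r powr (2 / \<beta>) \<le> S powr (- (2 / \<beta>)) * r powr (2 / \<beta>)"
        by (rule mult_right_mono) simp
      moreover have "r powr (4 - 2 / \<beta>) * r powr (2 / \<beta>) = r ^ 4"
        using r by (simp add: powr_add[symmetric] powr_numeral)
      moreover have "S powr (- (2 / \<beta>)) * r powr (2 / \<beta>) = (r / S) powr (2 / \<beta>)"
        using r S by (simp add: powr_divide powr_minus field_simps)
      ultimately show ?thesis by (simp add: mult.assoc)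
    qed
    have "16 * c\<^sup>2 * r ^ 5 = r * (16 * c\<^sup>2 * r ^ 4)" by (simp add: eval_nat_numeral)
    also have "\<dots> \<le> r * (r / S) powr (2 / \<beta>)" using cond r by (intro mult_left_mono) auto
    also have "\<dots> \<le> 2 * d\<^sup>2 + 2 * (2 * c * r\<^sup>2)\<^sup>2 * r" using H r rr0 by blast
    also have "\<dots> = 2 * d\<^sup>2 + 8 * c\<^sup>2 * r ^ 5" by (simp add: power_mult_distrib eval_nat_numeral)
    finally have "Z powr (- (2 * \<gamma>)) \<le> d\<^sup>2" using r5 by linarith
    moreover have "Z powr (- (2 * \<gamma>)) = (Z powr (- \<gamma>))\<^sup>2" using Z1 by (simp add: powr_power)
    ultimately have "(Z powr (- \<gamma>))\<^sup>2 \<le> d\<^sup>2" by (simp only:)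
    then have "Z powr (- \<gamma>) \<le> d" using d by (rule power2_le_imp_le)
    then show "Z powr (- 3 / (2 * (\<beta> - 1))) \<le> d" by (simp add: \<gamma>_def)
  qed (rule A(1))
qed

section \<open>Convergence to a positive minimizer\<close>

lemma AE_lebesgue_on_imp_negligible:
  assumes "AE t in lebesgue_on S. P t" "S \<in> sets lebesgue"
  shows "negligible {t \<in> S. \<not> P t}"
proof -
  have "AE t in lebesgue. t \<in> S \<longrightarrow> P t"
    using assms AE_restrict_space_iff[of S lebesgue P] by simp
  then obtain N where "negligible N" "{t. \<not> (t \<in> S \<longrightarrow> P t)} \<subseteq> N"
    using eventually_ae_filter_negligible[of "\<lambda>t. t \<in> S \<longrightarrow> P t"] by auto
  moreover have "{t \<in> S. \<not> P t} = {t. \<not> (t \<in> S \<longrightarrow> P t)}" by auto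
  ultimately show ?thesis using negligible_subset by metis
qed

definition regular_state :: "real \<Rightarrow> real \<Rightarrow> (real \<Rightarrow> real) \<Rightarrow> bool" where
  "regular_state n \<alpha> f \<longleftrightarrow> (\<exists>v w. has_weak_deriv UNIV f v \<and> has_weak_deriv UNIV v w) \<and>
     (\<exists>g. has_weak_deriv {y. 0 < f y} (energy_grad \<alpha> f) g) \<and>
     integrable (lebesgue_on Om) (dissipation_density n \<alpha> f)"

definition dissipation :: "real \<Rightarrow> real \<Rightarrow> (real \<Rightarrow> real) \<Rightarrow> real" where
  "dissipation n \<alpha> f = (LINT x|lebesgue_on Om. dissipation_density n \<alpha> f x)"

lemma dissipation_nonneg: "0 \<le> dissipation n \<alpha> f"
  unfolding dissipation_def by (rule Bochner_Integration.integral_nonneg) (rule dissipation_density_nonneg)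

lemma regular_state_ae:
  assumes sol: "is_solution n \<alpha> u" and dis: "dissipates_energy n \<alpha> u"
  shows "negligible {t \<in> {0..}. \<not> regular_state n \<alpha> (u t)}"
proof -
  obtain v w where vw: "\<And>T. 0 < T \<Longrightarrow> in_L2_H2 T u v w"
    using sol unfolding is_solution_def by blast
  let ?P = "\<lambda>t. has_weak_deriv UNIV (u t) (v t) \<and> has_weak_deriv UNIV (v t) (w t)"
  let ?Q = "\<lambda>t. (\<exists>g. has_weak_deriv {y. 0 < u t y} (energy_grad \<alpha> (u t)) g) \<and>
        integrable (lebesgue_on Om) (dissipation_density n \<alpha> (u t))"
  have N1: "negligible {t \<in> {0<..<real (Suc j)}. \<not> ?P t}" for j
  proof (rule AE_lebesgue_on_imp_negligible)
    have "AE t in lebesgue_on {0<..<real (Suc j)}. periodic (u t) \<and> ?P t"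
      using vw[of "real (Suc j)"] unfolding in_L2_H2_def by simp
    then show "AE t in lebesgue_on {0<..<real (Suc j)}. ?P t"
      by eventually_elim simp
  qed auto
  have N2: "negligible {t \<in> {0..}. \<not> ?Q t}"
    by (rule AE_lebesgue_on_imp_negligible) (use dis in \<open>auto simp: dissipates_energy_def\<close>)
  have "negligible (\<Union>j. {t \<in> {0<..<real (Suc j)}. \<not> ?P t})"
    by (rule negligible_countable_Union) (use N1 in auto)
  then have "negligible ((\<Union>j. {t \<in> {0<..<real (Suc j)}. \<not> ?P t}) \<union> {t \<in> {0..}. \<not> ?Q t} \<union> {0})"
    using N2 by simp
  moreover have "{t \<in> {0..}. \<not> regular_state n \<alpha> (u t)} \<subseteq>
     (\<Union>j. {t \<in> {0<..<real (Suc j)}. \<not> ?P t}) \<union> {t \<in> {0..}. \<not> ?Q t} \<union> {0}"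
  proof
    fix t assume t: "t \<in> {t \<in> {0..}. \<not> regular_state n \<alpha> (u t)}"
    obtain j where "t < real (Suc j)" using reals_Archimedean2[of t] by (metis less_SucI of_nat_less_iff less_trans lessI)
    moreover have "\<not> ?P t \<or> \<not> ?Q t" using t unfolding regular_state_def by blast
    ultimately show "t \<in> (\<Union>j. {t \<in> {0<..<real (Suc j)}. \<not> ?P t}) \<union> {t \<in> {0..}. \<not> ?Q t} \<union> {0}"
      using t by (cases "t = 0") auto
  qed
  ultimately show ?thesis by (rule negligible_subset)
qed

lemma energy_dissipation_interval:
  assumes dis: "dissipates_energy n \<alpha> u" and "0 \<le> a" "a \<le> b"
  shows "((\<lambda>s. dissipation n \<alpha> (u s)) has_integral (energy \<alpha> (u a) - energy \<alpha> (u b))) {a..b}"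
proof -
  let ?D = "\<lambda>s. dissipation n \<alpha> (u s)"
  have 0: "(?D has_integral (energy \<alpha> (u 0) - energy \<alpha> (u t))) {0..t}" if "0 \<le> t" for t
  proof -
    have "((\<lambda>s. - ?D s) has_integral (energy \<alpha> (u t) - energy \<alpha> (u 0))) {0..t}"
      using dis that unfolding dissipates_energy_def dissipation_def by blast
    from has_integral_neg[OF this] show ?thesis by simp
  qed
  have b: "?D integrable_on {0..b}" using 0[of b] assms by auto
  then have "?D integrable_on {a..b}" by (rule integrable_on_subinterval) (use assms in auto)
  moreover have "integral {0..a} ?D + integral {a..b} ?D = integral {0..b} ?D"
    using Henstock_Kurzweil_Integration.integral_combine[OF assms(2,3) b] .
  then have "integral {a..b} ?D = energy \<alpha> (u a) - energy \<alpha> (u b)"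
    using integral_unique[OF 0[of a]] integral_unique[OF 0[of b]] assms by simp
  ultimately show ?thesis by (metis integrable_integral)
qed

lemma energy_drop_lower_bound:
  assumes sol: "is_solution n \<alpha> u" and dis: "dissipates_energy n \<alpha> u" and ab: "0 \<le> a" "a \<le> b"
    and f: "(f has_integral I) {a..b}"
      "\<And>t. t \<in> {a..b} \<Longrightarrow> regular_state n \<alpha> (u t) \<Longrightarrow> f t \<le> dissipation n \<alpha> (u t)"
  shows "I \<le> energy \<alpha> (u a) - energy \<alpha> (u b)"
proof (rule has_integral_le)
  \<comment> \<open>Bounds for the dissipation are known only at regular times. On the exceptional
    null set the comparison function is replaced by the dissipation itself.\<close>
  let ?g = "\<lambda>t. if regular_state n \<alpha> (u t) then f t else dissipation n \<alpha> (u t)"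
  show "(?g has_integral I) {a..b}"
    by (rule has_integral_spike[OF regular_state_ae[OF sol dis] _ f(1)]) (use ab in auto)
  show "((\<lambda>s. dissipation n \<alpha> (u s)) has_integral (energy \<alpha> (u a) - energy \<alpha> (u b))) {a..b}"
    by (rule energy_dissipation_interval[OF dis ab])
  show "?g t \<le> dissipation n \<alpha> (u t)" if "t \<in> {a..b}" for t using f(2)[OF that] by simp
qed

lemma energy_antimono:
  assumes sol: "is_solution n \<alpha> u" and dis: "dissipates_energy n \<alpha> u" and ab: "0 \<le> a" "a \<le> b"
  shows "energy \<alpha> (u b) \<le> energy \<alpha> (u a)"
  using energy_drop_lower_bound[OF sol dis ab has_integral_0] dissipation_nonneg by simp

text \<open>Otherwise the dissipation would be at least e/(1 + t) at almost all times, and the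
  energy would fall below every bound, since the integral of 1/(1 + t) diverges.\<close>

lemma small_dissipation_times:
  assumes sol: "is_solution n \<alpha> u" and dis: "dissipates_energy n \<alpha> u"
    and lower: "\<And>t. 0 \<le> t \<Longrightarrow> E0 \<le> energy \<alpha> (u t)" and "0 < e"
  shows "\<exists>t\<ge>0. regular_state n \<alpha> (u t) \<and> dissipation n \<alpha> (u t) * (1 + t) < e"
proof (rule ccontr)
  assume no: "\<not> ?thesis"
  \<comment> \<open>The time at which the drop e ln (1 + X) would exceed the available energy by
    1.\<close>
  define X where "X = exp ((energy \<alpha> (u 0) - E0 + 1) / e) - 1"
  have X: "0 \<le> X" using lower[of 0] \<open>0 < e\<close> by (simp add: X_def)
  have "((\<lambda>t. e * (1 / (1 + t))) has_integral e * (ln (1 + X) - ln (1 + 0))) {0..X}"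
  proof (rule has_integral_mult_right, rule fundamental_theorem_of_calculus[OF X])
    fix t assume "t \<in> {0..X}"
    then have "((\<lambda>t. ln (1 + t)) has_real_derivative 1 / (1 + t)) (at t)"
      by (auto intro!: derivative_eq_intros)
    then show "((\<lambda>t. ln (1 + t)) has_vector_derivative 1 / (1 + t)) (at t within {0..X})"
      using has_field_derivative_at_within has_real_derivative_iff_has_vector_derivative by blast
  qed
  from energy_drop_lower_bound[OF sol dis _ X this]
  have "e * (ln (1 + X) - ln (1 + 0)) \<le> energy \<alpha> (u 0) - energy \<alpha> (u X)"
    using no by (force simp: not_less field_simps)
  moreover have "e * (ln (1 + X) - ln (1 + 0)) = energy \<alpha> (u 0) - E0 + 1"
    using \<open>0 < e\<close> by (simp add: X_def)
  ultimately show False using lower[OF X] by simp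
qed

section \<open>Compactness of states of bounded energy\<close>

lemma C_mass_mean:
  assumes f: "f \<in> C_mass M" "primitive (-pi) pi f f'"
  shows "primitive (-pi) pi (\<lambda>x. f x - M / (2 * pi)) f'" "integral {-pi..pi} (\<lambda>x. f x - M / (2 * pi)) = 0"
proof -
  note F = C_massD[OF f(1)]
  show "primitive (-pi) pi (\<lambda>x. f x - M / (2 * pi)) f'"
    using primitive_diff[OF f(2) primitive_const[of "-pi" pi "M / (2 * pi)"]] by simp
  have "f integrable_on {-pi..pi}" by (rule integrable_continuous_real[OF H1D(4)[OF F(1)]])
  then have "integral {-pi..pi} (\<lambda>x. f x - M / (2 * pi)) = integral {-pi..pi} f - integral {-pi..pi} (\<lambda>x. M / (2 * pi))"
    by (rule Henstock_Kurzweil_Integration.integral_diff[OF _ integrable_const_ivl])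
  then show "integral {-pi..pi} (\<lambda>x. f x - M / (2 * pi)) = 0" by (simp add: F(3))
qed

text \<open>Split \<open>f\<close> into its mean and a part of mean zero. The latter is absorbed by
  the Poincare inequality, the mean contributes the term with M^2, and the gravity term is at most M
  since f >= 0 and cos <= 1.\<close>

lemma derivative_bound_by_energy:
  assumes \<alpha>: "0 \<le> \<alpha>" "\<alpha> < 1" and f: "f \<in> C_mass M" "primitive (-pi) pi f f'"
  shows "(1 - \<alpha>\<^sup>2) * integral {-pi..pi} (\<lambda>x. (f' x)\<^sup>2) \<le> 2 * energy \<alpha> f + \<alpha>\<^sup>2 * M\<^sup>2 / (2 * pi) + 2 * M"
proof -
  note F = C_massD[OF f(1)]
  have cf: "continuous_on {-pi..pi} f" by (rule H1D(4)[OF F(1)])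
  define b where "b = M / (2 * pi)"
  define z where "z x = f x - b" for x
  have pz: "primitive (-pi) pi z f'" and iz: "integral {-pi..pi} z = 0"
    using C_mass_mean[OF f] by (simp_all add: z_def [abs_def] b_def)
  have fi: "f integrable_on {-pi..pi}" by (rule integrable_continuous_real[OF cf])
  have cz: "continuous_on {-pi..pi} z" by (rule primitiveD(4)[OF pz])
  have P: "integral {-pi..pi} (\<lambda>x. (z x)\<^sup>2) \<le> integral {-pi..pi} (\<lambda>x. (f' x)\<^sup>2)"
    by (rule Poincare_Wirtinger[OF pz weak_deriv_unique_ae(2)[OF F(1) f(2)] _ iz]) (simp add: z_def H1D(6)[OF F(1)])
  have zi: "z integrable_on {-pi..pi}" "(\<lambda>x. (z x)\<^sup>2) integrable_on {-pi..pi}"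
    using cz by (auto intro!: integrable_continuous_real continuous_intros)
  have "((\<lambda>x. ((z x)\<^sup>2 + (2 * b) * z x) + b\<^sup>2) has_integral
      (integral {-pi..pi} (\<lambda>x. (z x)\<^sup>2) + (2 * b) * integral {-pi..pi} z) + (pi - (-pi)) *\<^sub>R b\<^sup>2) {-pi..pi}"
    by (intro has_integral_add has_integral_mult_right integrable_integral zi has_integral_const_real[THEN has_integral_eq_rhs])
       simp_all
  then have "integral {-pi..pi} (\<lambda>x. ((z x)\<^sup>2 + (2 * b) * z x) + b\<^sup>2) = integral {-pi..pi} (\<lambda>x. (z x)\<^sup>2) + 2 * pi * b\<^sup>2"
    using iz by (simp add: integral_unique)
  moreover have "(f x)\<^sup>2 = ((z x)\<^sup>2 + (2 * b) * z x) + b\<^sup>2" for x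
    by (simp add: z_def power2_eq_square algebra_simps)
  ultimately have f2: "integral {-pi..pi} (\<lambda>x. (f x)\<^sup>2) = integral {-pi..pi} (\<lambda>x. (z x)\<^sup>2) + 2 * pi * b\<^sup>2"
    by simp
  have "integral {-pi..pi} (\<lambda>x. f x * cos x) \<le> integral {-pi..pi} f"
    by (rule integral_le)
       (use F(2) in \<open>auto intro!: integrable_continuous_real continuous_intros cf fi mult_left_le\<close>)
  then have c: "integral {-pi..pi} (\<lambda>x. f x * cos x) \<le> M" by (simp add: F(3))
  have "2 * pi * b\<^sup>2 = M\<^sup>2 / (2 * pi)" by (simp add: b_def power2_eq_square)
  then have e: "2 * energy \<alpha> f = integral {-pi..pi} (\<lambda>x. (f' x)\<^sup>2) - \<alpha>\<^sup>2 * integral {-pi..pi} (\<lambda>x. (z x)\<^sup>2)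
      - \<alpha>\<^sup>2 * M\<^sup>2 / (2 * pi) - 2 * integral {-pi..pi} (\<lambda>x. f x * cos x)"
    unfolding energy_eq[OF F(1) f(2)] f2 by (simp add: algebra_simps)
  have "\<alpha>\<^sup>2 * integral {-pi..pi} (\<lambda>x. (z x)\<^sup>2) \<le> \<alpha>\<^sup>2 * integral {-pi..pi} (\<lambda>x. (f' x)\<^sup>2)"
    by (rule mult_left_mono[OF P]) simp
  then show ?thesis using e c by (simp add: left_diff_distrib)
qed

text \<open>Arzela-Ascoli on one period, with equicontinuity from Hoelder exponent 1/2. Periodicity
  makes the convergence uniform on the whole line, as \<open>profile_limit\<close> requires.\<close>

lemma uniform_limit_of_periodic:
  fixes U :: "nat \<Rightarrow> real \<Rightarrow> real"
  assumes per: "\<And>k x. U k (x + 2 * pi) = U k x" and cont: "\<And>k. continuous_on UNIV (U k)"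
    and B: "0 \<le> B" "\<And>k x y. x \<in> {-pi..pi} \<Longrightarrow> y \<in> {-pi..pi} \<Longrightarrow> (U k x - U k y)\<^sup>2 \<le> B * \<bar>x - y\<bar>"
    and C: "\<And>k x. x \<in> {-pi..pi} \<Longrightarrow> \<bar>U k x\<bar> \<le> C"
  shows "\<exists>u r. strict_mono r \<and> continuous_on UNIV u \<and> (\<forall>x. u (x + 2 * pi) = u x) \<and>
    (\<forall>e>0. \<forall>\<^sub>F k in sequentially. \<forall>x. \<bar>U (r k) x - u x\<bar> \<le> e)"
proof -
  have equi: "\<exists>d>0. \<forall>n y. y \<in> {-pi..pi} \<and> norm (x - y) < d \<longrightarrow> norm (U n x - U n y) < e"
    if x: "x \<in> {-pi..pi}" and e: "0 < e" for x e
  proof (intro exI[of _ "e\<^sup>2 / (B + 1)"] conjI allI impI)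
    show "0 < e\<^sup>2 / (B + 1)" using e B(1) by simp
    fix n y assume y: "y \<in> {-pi..pi} \<and> norm (x - y) < e\<^sup>2 / (B + 1)"
    have "(U n x - U n y)\<^sup>2 \<le> B * \<bar>x - y\<bar>" using B(2) x y by blast
    also have "\<dots> \<le> (B + 1) * \<bar>x - y\<bar>" by (rule mult_right_mono) auto
    also have "\<dots> < e\<^sup>2" using y B(1) by (simp add: pos_less_divide_eq mult.commute)
    finally have "\<bar>U n x - U n y\<bar>\<^sup>2 < e\<^sup>2" by simp
    then show "norm (U n x - U n y) < e" using e by (simp add: power2_less_imp_less)
  qed
  have bd: "norm (U k x) \<le> C" if "x \<in> {-pi..pi}" for k x using C[OF that] by simp
  obtain g r where "continuous_on {-pi..pi} g" and g: "strict_mono (r :: nat \<Rightarrow> nat)"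
    "\<And>e. 0 < e \<Longrightarrow> \<exists>N. \<forall>n x. n \<ge> N \<and> x \<in> {-pi..pi} \<longrightarrow> norm (U (r n) x - g x) < e"
    by (rule Arzela_Ascoli[OF compact_Icc bd equi]) blast+
  \<comment> \<open>At odd multiples of pi two shifts are possible. Either will do, since the
    periodic functions \<open>U (r k)\<close> have the same limit at both ends.\<close>
  define sh where "sh x = (SOME k :: int. x - 2 * pi * of_int k \<in> {-pi..pi})" for x
  have sh: "x - 2 * pi * of_int (sh x) \<in> {-pi..pi}" for x
    unfolding sh_def by (rule someI_ex[OF int_shift_into_period])
  define u where "u x = g (x - 2 * pi * of_int (sh x))" for x
  have unif: "\<forall>\<^sub>F k in sequentially. \<forall>x. \<bar>U (r k) x - u x\<bar> \<le> e" if e: "0 < e" for e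
  proof -
    obtain N where N: "\<And>n x. n \<ge> N \<Longrightarrow> x \<in> {-pi..pi} \<Longrightarrow> norm (U (r n) x - g x) < e"
      using g(2)[OF e] by blast
    show ?thesis
      unfolding eventually_sequentially
    proof (intro exI[of _ N] allI impI)
      fix n x assume "N \<le> n"
      then have "norm (U (r n) (x - 2 * pi * of_int (sh x)) - u x) < e"
        unfolding u_def by (rule N[OF _ sh])
      moreover have "U (r n) x = U (r n) (x - 2 * pi * of_int (sh x))"
        using periodic_int[of "U (r n)" "x - 2 * pi * of_int (sh x)" "sh x", OF per] by simp
      ultimately show "\<bar>U (r n) x - u x\<bar> \<le> e" by simp
    qed
  qed
  have "uniform_limit UNIV (\<lambda>k. U (r k)) u sequentially"
  proof (rule uniform_limitI)
    fix e :: real assume "0 < e"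
    then have "\<forall>\<^sub>F k in sequentially. \<forall>x. \<bar>U (r k) x - u x\<bar> \<le> e / 2" by (intro unif) simp
    then show "\<forall>\<^sub>F k in sequentially. \<forall>x\<in>UNIV. dist (U (r k) x) (u x) < e"
    proof eventually_elim
      case (elim k)
      show ?case
      proof
        fix x show "dist (U (r k) x) (u x) < e"
          using elim[rule_format, of x] \<open>0 < e\<close> unfolding dist_real_def by linarith
      qed
    qed
  qed
  then have lim: "continuous_on UNIV u" "\<And>x. (\<lambda>k. U (r k) x) \<longlonglongrightarrow> u x"
    by (auto intro: uniform_limit_theorem[OF always_eventually] tendsto_uniform_limitI cont)
  have "u (x + 2 * pi) = u x" for x
    using LIMSEQ_unique[OF lim(2)[of "x + 2 * pi"]] lim(2)[of x] by (simp add: per)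
  then show ?thesis using g(1) lim(1) unif by blast
qed

text \<open>At times with small (1 + t) D the states are profiles with \<open>A\<close> tending to
  0. A uniform limit of them is stationary, hence equals \<open>ustar\<close>. So at some such time
  the film is at least half as high as the minimum of \<open>ustar\<close>, and there small
  dissipation means small excess energy. The expansion of the energy at \<open>ustar\<close> is a
  by-product of having this stationary limit.\<close>

lemma positive_minimizer_attracts:
  fixes \<alpha> n M S0 K0 :: real and u :: "real \<Rightarrow> real \<Rightarrow> real" and ustar :: "real \<Rightarrow> real"
  assumes \<alpha>: "0 \<le> \<alpha>" "\<alpha> < 1" and n: "0 < n" and M: "0 < M"
    and sol: "is_solution n \<alpha> u" and dis: "dissipates_energy n \<alpha> u" and uM: "\<And>t. 0 \<le> t \<Longrightarrow> u t \<in> C_mass M"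
    and ent: "\<And>t. 0 \<le> t \<Longrightarrow> (\<integral>\<^sup>+x. neg_power (n - 3 / 2) (u t x) \<partial>lebesgue_on Om) \<le> ennreal (S0 + K0 * t)"
    and s: "ustar \<in> C_mass M" and min: "\<And>f. f \<in> C_mass M \<Longrightarrow> energy \<alpha> ustar \<le> energy \<alpha> f"
    and pos: "\<And>x. 0 < ustar x" and s': "primitive (-pi) pi ustar s'"
  shows "\<And>f f'. f \<in> C_mass M \<Longrightarrow> primitive (-pi) pi f f' \<Longrightarrow> energy \<alpha> f = energy \<alpha> ustar
      + 1 / 2 * (integral {-pi..pi} (\<lambda>x. (f' x - s' x)\<^sup>2) - \<alpha>\<^sup>2 * integral {-pi..pi} (\<lambda>x. (f x - ustar x)\<^sup>2))"
    "0 < e \<Longrightarrow> \<exists>T\<ge>0. energy \<alpha> (u T) - energy \<alpha> ustar < e"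
proof -
  have \<alpha>2: "0 < 1 - \<alpha>\<^sup>2" using \<alpha> by (simp add: power_less_one_iff)
  have low: "energy \<alpha> ustar \<le> energy \<alpha> (u t)" if "0 \<le> t" for t by (rule min[OF uM[OF that]])
  have "\<exists>t\<ge>0. regular_state n \<alpha> (u t) \<and> dissipation n \<alpha> (u t) * (1 + t) < 1 / real (Suc k)" for k
    by (rule small_dissipation_times[OF sol dis low]) auto
  then obtain \<tau> where \<tau>: "\<And>k. 0 \<le> \<tau> k" "\<And>k. regular_state n \<alpha> (u (\<tau> k))"
    "\<And>k. dissipation n \<alpha> (u (\<tau> k)) * (1 + \<tau> k) < 1 / real (Suc k)" by metis
  \<comment> \<open>With this constant S0 + K0 t <= C (1 + t) whatever the signs, so that
    dissipation times entropy bound is at most C/(k + 1).\<close>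
  define C where "C = \<bar>S0\<bar> + \<bar>K0\<bar>"
  define A where "A k = sqrt (C * (1 / real (Suc k)))" for k
  note UM = C_massD[OF uM[OF \<tau>(1)]]
  have prof: "profile \<alpha> (A k) (u (\<tau> k)) (deriv (u (\<tau> k))) (pressure \<alpha> (u (\<tau> k)))" for k
  proof -
    obtain v w where v: "has_weak_deriv UNIV (u (\<tau> k)) v" "has_weak_deriv UNIV v w"
      using \<tau>(2)[of k] unfolding regular_state_def by blast
    show ?thesis
    proof (rule profile_of_state[where n = n and S = "C * (1 + \<tau> k)", OF UM(1,2) v])
      have "K0 * \<tau> k \<le> \<bar>K0\<bar> * \<tau> k" "0 \<le> \<bar>S0\<bar> * \<tau> k" using \<tau>(1)[of k] by (auto intro: mult_right_mono)
      then have "S0 + K0 * \<tau> k \<le> C * (1 + \<tau> k)" by (simp add: C_def algebra_simps)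
      then show "(\<integral>\<^sup>+x. neg_power (n - 3 / 2) (u (\<tau> k) x) \<partial>lebesgue_on Om) \<le> ennreal (C * (1 + \<tau> k))"
        using ent[OF \<tau>(1)] ennreal_leI order_trans by blast
      have "C * (dissipation n \<alpha> (u (\<tau> k)) * (1 + \<tau> k)) \<le> C * (1 / real (Suc k))"
        using \<tau>(3)[of k] by (intro mult_left_mono) (auto simp: C_def)
      then show "(LINT x|lebesgue_on Om. dissipation_density n \<alpha> (u (\<tau> k)) x) * (C * (1 + \<tau> k)) \<le> (A k)\<^sup>2"
        by (simp add: A_def C_def dissipation_def mult_ac)
    qed (use \<tau> in \<open>auto simp: regular_state_def C_def A_def\<close>)
  qed
  have A0: "A \<longlonglongrightarrow> 0"
  proof -
    have "(\<lambda>k. sqrt (C * inverse (real (Suc k)))) \<longlonglongrightarrow> sqrt (C * 0)"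
      by (intro tendsto_intros LIMSEQ_inverse_real_of_nat)
    then show ?thesis by (simp add: A_def [abs_def] inverse_eq_divide)
  qed
  define B where "B = \<bar>2 * energy \<alpha> (u 0) + \<alpha>\<^sup>2 * M\<^sup>2 / (2 * pi) + 2 * M\<bar> / (1 - \<alpha>\<^sup>2)"
  have B: "0 \<le> B" using \<alpha>2 by (simp add: B_def)
  have pU: "primitive (-pi) pi (u (\<tau> k)) (weak_deriv UNIV (u (\<tau> k)))" for k by (rule H1D(2)[OF UM(1)])
  have IB: "integral {-pi..pi} (\<lambda>x. (weak_deriv UNIV (u (\<tau> k)) x)\<^sup>2) \<le> B" for k
  proof -
    have "(1 - \<alpha>\<^sup>2) * integral {-pi..pi} (\<lambda>x. (weak_deriv UNIV (u (\<tau> k)) x)\<^sup>2)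
        \<le> 2 * energy \<alpha> (u (\<tau> k)) + \<alpha>\<^sup>2 * M\<^sup>2 / (2 * pi) + 2 * M"
      by (rule derivative_bound_by_energy[OF \<alpha> uM[OF \<tau>(1)] pU])
    also have "\<dots> \<le> \<bar>2 * energy \<alpha> (u 0) + \<alpha>\<^sup>2 * M\<^sup>2 / (2 * pi) + 2 * M\<bar>"
      using energy_antimono[OF sol dis order_refl \<tau>(1)[of k]] by linarith
    finally show ?thesis using \<alpha>2 by (simp add: B_def pos_le_divide_eq mult.commute)
  qed
  obtain w r where wr: "strict_mono r" "continuous_on UNIV w" "\<And>x. w (x + 2 * pi) = w x"
    "\<And>e. 0 < e \<Longrightarrow> \<forall>\<^sub>F k in sequentially. \<forall>x. \<bar>u (\<tau> (r k)) x - w x\<bar> \<le> e"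
  proof -
    have "\<exists>w r. strict_mono r \<and> continuous_on UNIV w \<and> (\<forall>x. w (x + 2 * pi) = w x) \<and>
      (\<forall>e>0. \<forall>\<^sub>F k in sequentially. \<forall>x. \<bar>u (\<tau> (r k)) x - w x\<bar> \<le> e)"
    proof (rule uniform_limit_of_periodic[OF _ _ B])
      show "u (\<tau> k) (x + 2 * pi) = u (\<tau> k) x" "continuous_on UNIV (u (\<tau> k))" for k x
        using H1D(4,5)[OF UM(1)] by auto
      show "(u (\<tau> k) x - u (\<tau> k) y)\<^sup>2 \<le> B * \<bar>x - y\<bar>" if "x \<in> {-pi..pi}" "y \<in> {-pi..pi}" for k x y
      proof -
        have "(u (\<tau> k) x - u (\<tau> k) y)\<^sup>2 \<le> \<bar>x - y\<bar> * integral {-pi..pi} (\<lambda>x. (weak_deriv UNIV (u (\<tau> k)) x)\<^sup>2)"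
          by (rule primitive_Hoelder[OF pU H1D(3)[OF UM(1)] that])
        also have "\<dots> \<le> \<bar>x - y\<bar> * B" by (intro mult_left_mono IB) auto
        finally show ?thesis by (simp add: mult.commute)
      qed
      show "\<bar>u (\<tau> k) x\<bar> \<le> M / (2 * pi) + sqrt (2 * pi * B)" if "x \<in> {-pi..pi}" for k x
      proof -
        have "(u (\<tau> k) x - M / (2 * pi))\<^sup>2 \<le> 2 * pi * integral {-pi..pi} (\<lambda>x. (weak_deriv UNIV (u (\<tau> k)) x)\<^sup>2)"
          by (rule sup_bound_mean_zero[OF C_mass_mean(1)[OF uM[OF \<tau>(1)] pU] H1D(3)[OF UM(1)]
                C_mass_mean(2)[OF uM[OF \<tau>(1)] pU] that])
        also have "\<dots> \<le> 2 * pi * B" by (intro mult_left_mono IB) auto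
        finally have "\<bar>u (\<tau> k) x - M / (2 * pi)\<bar> \<le> sqrt (2 * pi * B)" by (simp add: real_le_rsqrt)
        then show ?thesis using M UM(2)[of k x] by simp
      qed
    qed
    then show ?thesis using that by blast
  qed
  have "\<exists>u1 \<Lambda>. \<forall>x. 0 < w x \<longrightarrow> (w has_real_derivative u1 x) (at x) \<and>
    (u1 has_real_derivative - \<Lambda> x - \<alpha>\<^sup>2 * w x - cos x) (at x) \<and>
    (\<Lambda> has_real_derivative 0) (at x) \<and> (u1 x)\<^sup>2 \<le> 2 * w x * (\<bar>\<Lambda> x\<bar> + 1 + \<alpha>\<^sup>2 * w x)"
  proof (rule profile_limit[OF prof])
    show "(\<lambda>k. A (r k)) \<longlonglongrightarrow> 0" using LIMSEQ_subseq_LIMSEQ[OF A0 wr(1)] by (simp add: o_def)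
  qed (use wr in auto)
  then obtain u1 \<Lambda> where lim: "\<And>x. 0 < w x \<Longrightarrow> (w has_real_derivative u1 x) (at x) \<and>
    (u1 has_real_derivative - \<Lambda> x - \<alpha>\<^sup>2 * w x - cos x) (at x) \<and>
    (\<Lambda> has_real_derivative 0) (at x) \<and> (u1 x)\<^sup>2 \<le> 2 * w x * (\<bar>\<Lambda> x\<bar> + 1 + \<alpha>\<^sup>2 * w x)" by blast
  have close: "\<exists>k. \<forall>x. \<bar>u (\<tau> (r k)) x - w x\<bar> \<le> d" if "0 < d" for d
    using eventually_happens[OF wr(4)[OF that]] by auto
  have w0: "0 \<le> w x" for x
  proof (rule field_le_epsilon)
    fix d :: real assume "0 < d"
    then obtain k where "\<bar>u (\<tau> (r k)) x - w x\<bar> \<le> d" using close by blast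
    then show "0 \<le> w x + d" using UM(2)[of "r k" x] by linarith
  qed
  have wM: "integral {-pi..pi} w = M"
  proof -
    have iw: "w integrable_on {-pi..pi}" by (rule integrable_continuous_real[OF continuous_on_subset[OF wr(2)]]) simp
    have "\<bar>M - integral {-pi..pi} w\<bar> \<le> 0 + d" if d: "0 < d" for d
    proof -
      obtain k where k: "\<And>x. \<bar>u (\<tau> (r k)) x - w x\<bar> \<le> d / (2 * pi)" using close[of "d / (2 * pi)"] d by auto
      have iu: "u (\<tau> (r k)) integrable_on {-pi..pi}" by (rule integrable_continuous_real[OF H1D(4)[OF UM(1)]])
      have "norm (integral {-pi..pi} (\<lambda>x. u (\<tau> (r k)) x - w x)) \<le> integral {-pi..pi} (\<lambda>x. d / (2 * pi))"
        by (rule integral_norm_bound_integral) (use k iw iu in \<open>auto intro: integrable_diff\<close>)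
      then show ?thesis
        using iu iw UM(3)[of "r k"] by (simp add: Henstock_Kurzweil_Integration.integral_diff)
    qed
    then have "\<bar>M - integral {-pi..pi} w\<bar> \<le> 0" by (rule field_le_epsilon)
    then show ?thesis by simp
  qed
  have st: "stationary \<alpha> w u1 \<Lambda>" unfolding stationary_def using wr(2,3) w0 lim by blast
  have ws: "w x = ustar x" for x by (rule stationary_eq_minimizer(1)[OF \<alpha> M st wM s min])
  show EL: "\<And>f f'. f \<in> C_mass M \<Longrightarrow> primitive (-pi) pi f f' \<Longrightarrow> energy \<alpha> f = energy \<alpha> ustar
      + 1 / 2 * (integral {-pi..pi} (\<lambda>x. (f' x - s' x)\<^sup>2) - \<alpha>\<^sup>2 * integral {-pi..pi} (\<lambda>x. (f x - ustar x)\<^sup>2))"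
    by (rule stationary_eq_minimizer(2)[OF \<alpha> M st wM s min pos _ _ s'])
  show "\<exists>T\<ge>0. energy \<alpha> (u T) - energy \<alpha> ustar < e" if e: "0 < e"
  proof -
    have "\<exists>x\<in>{-pi..pi}. \<forall>y\<in>{-pi..pi}. ustar x \<le> ustar y"
      by (rule continuous_attains_inf[OF compact_Icc _ H1D(4)[OF C_massD(1)[OF s]]]) simp
    then obtain x0 where x0: "\<And>x. x \<in> {-pi..pi} \<Longrightarrow> ustar x0 \<le> ustar x" by blast
    have m: "ustar x0 \<le> ustar x" for x
    proof -
      obtain k :: int where k: "x - 2 * pi * of_int k \<in> {-pi..pi}" using int_shift_into_period by blast
      then show ?thesis
        using x0[OF k] periodic_int[of ustar "x - 2 * pi * of_int k" k, OF H1D(5)[OF C_massD(1)[OF s]]] by simp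
    qed
    define y where "y = ustar x0 / 2"
    have y: "0 < y" using pos by (simp add: y_def)
    define c where "c = 2 * (1 - \<alpha>\<^sup>2) * y powr n"
    have c: "0 < c" using \<alpha>2 y by (simp add: c_def)
    obtain N :: nat where N: "1 / (c * e) < real N" using reals_Archimedean2 by blast
    have "\<forall>\<^sub>F k in sequentially. N \<le> k \<and> (\<forall>x. \<bar>u (\<tau> (r k)) x - w x\<bar> \<le> y)"
      using wr(4)[OF y] eventually_ge_at_top[of N] by eventually_elim blast
    then obtain k where k: "N \<le> k" "\<And>x. \<bar>u (\<tau> (r k)) x - w x\<bar> \<le> y"
      using eventually_happens by fastforce
    let ?t = "\<tau> (r k)"
    have uy: "y \<le> u ?t x" for x using k(2)[of x] m[of x] ws[of x] unfolding y_def by linarith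
    obtain v v' where v: "has_weak_deriv UNIV (u ?t) v" "has_weak_deriv UNIV v v'"
      using \<tau>(2)[of "r k"] unfolding regular_state_def by blast
    have "c * (energy \<alpha> (u ?t) - energy \<alpha> ustar) \<le> dissipation n \<alpha> (u ?t)"
      unfolding c_def dissipation_def
      by (rule entropy_production_inequality[OF \<alpha> n uM[OF \<tau>(1)] v _ _ y uy s s' EL])
         (use \<tau>(2)[of "r k"] in \<open>auto simp: regular_state_def\<close>)
    also have "\<dots> \<le> dissipation n \<alpha> (u ?t) * (1 + ?t)"
      using \<tau>(1)[of "r k"] dissipation_nonneg[of n \<alpha> "u ?t"] by (simp add: mult_le_cancel_left1)
    also have "\<dots> < 1 / real (Suc (r k))" by (rule \<tau>(3))
    also have "\<dots> \<le> 1 / real (Suc N)"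
      using seq_suble[OF wr(1), of k] k(1) by (intro divide_left_mono) auto
    also have "\<dots> < c * e"
    proof -
      have ce: "0 < c * e" by (rule mult_pos_pos[OF c e])
      have "1 < real N * (c * e)" using N by (simp only: pos_divide_less_eq[OF ce])
      then have "1 < real (Suc N) * (c * e)" using ce unfolding of_nat_Suc distrib_right by linarith
      then show ?thesis by (simp only: pos_divide_less_eq[of "real (Suc N)"] of_nat_0_less_iff zero_less_Suc mult.commute)
    qed
    finally show ?thesis using c \<tau>(1)[of "r k"] by (auto simp: mult_less_cancel_left)
  qed
qed

text \<open>The excess energy bounds the squared sup distance to \<open>ustar\<close>, hence the
  rate available to it improves as it decays, up to 2 (1 - \<alpha>^2) m^n. Taking the square root
  gives half of this for the norm.\<close>

lemma positive_minimizer_convergence: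
  fixes \<alpha> n M S0 K0 :: real and u :: "real \<Rightarrow> real \<Rightarrow> real" and ustar :: "real \<Rightarrow> real"
  assumes \<alpha>: "0 \<le> \<alpha>" "\<alpha> < 1" and n: "0 < n" and M: "0 < M"
    and sol: "is_solution n \<alpha> u" and dis: "dissipates_energy n \<alpha> u" and uM: "\<And>t. 0 \<le> t \<Longrightarrow> u t \<in> C_mass M"
    and ent: "\<And>t. 0 \<le> t \<Longrightarrow> (\<integral>\<^sup>+x. neg_power (n - 3 / 2) (u t x) \<partial>lebesgue_on Om) \<le> ennreal (S0 + K0 * t)"
    and s: "ustar \<in> C_mass M" and min: "\<And>f. f \<in> C_mass M \<Longrightarrow> energy \<alpha> ustar \<le> energy \<alpha> f"
    and pos: "\<And>x. 0 < ustar x"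
  shows "\<exists>K1. \<forall>t\<ge>0. H1_norm (\<lambda>x. u t x - ustar x)
      \<le> K1 * exp (- ((1 - \<alpha>\<^sup>2) * (INF x\<in>{-pi..pi}. ustar x) powr n) * t)"
proof -
  have \<alpha>2: "0 < 1 - \<alpha>\<^sup>2" using \<alpha> by (simp add: power_less_one_iff)
  let ?s = "weak_deriv UNIV ustar"
  have sp: "primitive (-pi) pi ustar ?s" by (rule H1D(2)[OF C_massD(1)[OF s]])
  note att = positive_minimizer_attracts[OF \<alpha> n M sol dis uM ent s min pos sp]
  have EL: "energy \<alpha> f = energy \<alpha> ustar + 1 / 2 * (integral {-pi..pi} (\<lambda>x. (f' x - ?s x)\<^sup>2)
      - \<alpha>\<^sup>2 * integral {-pi..pi} (\<lambda>x. (f x - ustar x)\<^sup>2))" if "f \<in> C_mass M" "primitive (-pi) pi f f'" for f f'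
    by (rule att(1)) (use that in auto)
  obtain x0 where x0: "x0 \<in> {-pi..pi}" "\<And>x. x \<in> {-pi..pi} \<Longrightarrow> ustar x0 \<le> ustar x"
    using continuous_attains_inf[OF compact_Icc _ H1D(4)[OF C_massD(1)[OF s]], of "-pi" pi] by auto
  have INF: "(INF x\<in>{-pi..pi}. ustar x) = ustar x0"
    by (rule cInf_eq_minimum) (use x0 in auto)
  define m where "m = ustar x0"
  define F where "F t = energy \<alpha> (u t) - energy \<alpha> ustar" for t
  \<comment> \<open>It combines the factor 2 pi of the sup bound with the factor 2/(1 - \<alpha>^2)
    from coercivity.\<close>
  define C where "C = sqrt (4 * pi / (1 - \<alpha>\<^sup>2))"
  have C: "0 < C" using \<alpha>2 by (simp add: C_def)
  have m: "m \<le> ustar x" for x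
  proof -
    obtain k :: int where k: "x - 2 * pi * of_int k \<in> {-pi..pi}" using int_shift_into_period by blast
    then show ?thesis
      using x0(2)[OF k] periodic_int[of ustar "x - 2 * pi * of_int k" k, OF H1D(5)[OF C_massD(1)[OF s]]]
      by (simp add: m_def)
  qed
  have F0: "0 \<le> F t" if "0 \<le> t" for t using min[OF uM[OF that]] by (simp add: F_def)
  have Fmono: "F b \<le> F a" if "0 \<le> a" "a \<le> b" for a b
    using energy_antimono[OF sol dis that] by (simp add: F_def)
  have wd: "primitive (-pi) pi (u t) (weak_deriv UNIV (u t))" if "0 \<le> t" for t
    by (rule H1D(2)[OF C_massD(1)[OF uM[OF that]]])
  let ?I = "\<lambda>t. integral {-pi..pi} (\<lambda>x. (weak_deriv UNIV (u t) x - ?s x)\<^sup>2)"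
  have I: "(1 - \<alpha>\<^sup>2) * ?I t \<le> 2 * F t" if "0 \<le> t" for t
    using energy_coercive[OF C_mass_diff(1,2,4,3)[OF uM[OF that] s wd[OF that] sp], of \<alpha>]
      EL[OF uM[OF that] wd[OF that]] by (simp add: F_def)
  have I': "?I t \<le> 2 * F t / (1 - \<alpha>\<^sup>2)" if "0 \<le> t" for t
    using I[OF that] \<alpha>2 by (simp add: pos_le_divide_eq mult.commute)
  have lower: "m - C * sqrt (F t) \<le> u t x" if t: "0 \<le> t" for t x
  proof -
    obtain k :: int where k: "x - 2 * pi * of_int k \<in> {-pi..pi}" using int_shift_into_period by blast
    define y where "y = x - 2 * pi * of_int k"
    have yx: "u t x = u t y"
      using periodic_int[of "u t" y k, OF H1D(5)[OF C_massD(1)[OF uM[OF t]]]] by (simp add: y_def)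
    have "(u t y - ustar y)\<^sup>2 \<le> 2 * pi * ?I t"
      by (rule sup_bound_mean_zero[OF C_mass_diff(1,2,3)[OF uM[OF t] s wd[OF t] sp]]) (use k in \<open>simp add: y_def\<close>)
    also have "\<dots> \<le> 2 * pi * (2 * F t / (1 - \<alpha>\<^sup>2))" using I'[OF t] by (intro mult_left_mono) auto
    also have "\<dots> = 4 * pi / (1 - \<alpha>\<^sup>2) * F t" by simp
    finally have "\<bar>u t y - ustar y\<bar> \<le> sqrt (4 * pi / (1 - \<alpha>\<^sup>2) * F t)" by (simp add: real_le_rsqrt)
    then have "\<bar>u t y - ustar y\<bar> \<le> C * sqrt (F t)" by (simp only: C_def real_sqrt_mult)
    then show ?thesis using m[of y] yx by linarith
  qed
  have step: "F t * (1 + 2 * (1 - \<alpha>\<^sup>2) * y powr n * (t - a)) \<le> F a"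
    if a: "0 \<le> a" "a \<le> t" and y: "0 < y" "y \<le> m - C * sqrt (F a)" for a t y
  proof -
    let ?c = "2 * (1 - \<alpha>\<^sup>2) * y powr n"
    have c: "0 \<le> ?c" using \<alpha>2 by simp
    \<comment> \<open>As F decreases and the lower bound for u persists, the dissipation on the
      whole interval is at least a constant multiple of the final value F t. Integrating this
      constant gives an implicit Euler step.\<close>
    have "(t - a) *\<^sub>R (?c * F t) \<le> energy \<alpha> (u a) - energy \<alpha> (u t)"
    proof (rule energy_drop_lower_bound[OF sol dis a])
      show "((\<lambda>r. ?c * F t) has_integral (t - a) *\<^sub>R (?c * F t)) {a..t}"
        using has_integral_const_real[of "?c * F t" a t] a by simp
      fix r assume r: "r \<in> {a..t}" "regular_state n \<alpha> (u r)"
      have r0: "0 \<le> r" "a \<le> r" "r \<le> t" using r a by auto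
      have "C * sqrt (F r) \<le> C * sqrt (F a)" using Fmono[OF a(1) r0(2)] C by simp
      then have uy: "y \<le> u r x" for x using lower[OF r0(1), of x] y(2) by linarith
      obtain v v' where v: "has_weak_deriv UNIV (u r) v" "has_weak_deriv UNIV v v'"
        using r(2) unfolding regular_state_def by blast
      have "?c * F t \<le> ?c * F r" using c Fmono[OF r0(1,3)] by (rule mult_left_mono[rotated])
      also have "\<dots> \<le> dissipation n \<alpha> (u r)"
        unfolding F_def dissipation_def
        by (rule entropy_production_inequality[OF \<alpha> n uM[OF r0(1)] v _ _ y(1) uy s sp EL])
           (use r(2) in \<open>auto simp: regular_state_def\<close>)
      finally show "?c * F t \<le> dissipation n \<alpha> (u r)" .
    qed
    then show ?thesis by (simp add: F_def algebra_simps)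
  qed
  have "\<exists>K. 0 \<le> K \<and> (\<forall>t\<ge>0. F t \<le> K * exp (- (2 * (1 - \<alpha>\<^sup>2) * m powr n) * t))"
  proof (rule sharp_exponential_decay[OF _ _ n C F0 Fmono step])
    show "\<exists>T\<ge>0. F T < e" if "0 < e" for e unfolding F_def by (rule att(2)) (use that in auto)
  qed (use \<alpha>2 pos in \<open>auto simp: m_def\<close>)
  then obtain K where K: "0 \<le> K" "\<And>t. 0 \<le> t \<Longrightarrow> F t \<le> K * exp (- (2 * (1 - \<alpha>\<^sup>2) * m powr n) * t)" by blast
  define \<mu> where "\<mu> = (1 - \<alpha>\<^sup>2) * m powr n"
  have "H1_norm (\<lambda>x. u t x - ustar x) \<le> sqrt (4 * K / (1 - \<alpha>\<^sup>2)) * exp (- \<mu> * t)" if t: "0 \<le> t" for t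
  proof -
    note d = C_mass_diff[OF uM[OF t] s wd[OF t] sp]
    have "H1_norm (\<lambda>x. u t x - ustar x) = sqrt (integral {-pi..pi} (\<lambda>x. (u t x - ustar x)\<^sup>2) + ?I t)"
      by (rule H1_norm_eq[OF H1_diff[OF C_massD(1)[OF uM[OF t]] C_massD(1)[OF s]] d(1)])
    also have "\<dots> \<le> sqrt (4 * K / (1 - \<alpha>\<^sup>2) * (exp (- \<mu> * t))\<^sup>2)"
    proof (rule real_sqrt_le_mono)
      have "integral {-pi..pi} (\<lambda>x. (u t x - ustar x)\<^sup>2) + ?I t \<le> 2 * ?I t"
        using Poincare_Wirtinger[OF d(1,2,4,3)] by simp
      also have "\<dots> \<le> 2 * (2 * F t / (1 - \<alpha>\<^sup>2))" using I'[OF t] by simp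
      also have "\<dots> \<le> 2 * (2 * (K * exp (- (2 * (1 - \<alpha>\<^sup>2) * m powr n) * t)) / (1 - \<alpha>\<^sup>2))"
        using K(2)[OF t] \<alpha>2 by (intro mult_left_mono divide_right_mono) auto
      also have "exp (- (2 * (1 - \<alpha>\<^sup>2) * m powr n) * t) = (exp (- \<mu> * t))\<^sup>2"
        by (simp add: \<mu>_def exp_double[symmetric] mult.assoc)
      finally show "integral {-pi..pi} (\<lambda>x. (u t x - ustar x)\<^sup>2) + ?I t \<le> 4 * K / (1 - \<alpha>\<^sup>2) * (exp (- \<mu> * t))\<^sup>2"
        by simp
    qed
    also have "\<dots> = sqrt (4 * K / (1 - \<alpha>\<^sup>2)) * exp (- \<mu> * t)"
      unfolding real_sqrt_mult[of _ "(exp (- \<mu> * t))\<^sup>2"] by simp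
    finally show ?thesis .
  qed
  then show ?thesis unfolding INF m_def[symmetric] \<mu>_def by blast
qed

section \<open>The main theorem\<close>

lemma dry_interval_rate:
  assumes f: "f \<in> C_mass M" and s: "s \<in> C_mass M" and "0 < M" "0 < \<beta>"
    and S: "(\<integral>\<^sup>+x. neg_power \<beta> (f x) \<partial>lebesgue_on Om) \<le> ennreal S"
    and L: "0 < L" "\<And>x. x \<in> {a<..<a + L} \<Longrightarrow> s x = 0"
  shows "L powr (1 / \<beta> + 1 / 2) * S powr (- 1 / \<beta>) \<le> L2_norm (\<lambda>x. f x - s x)"
proof -
  note F = C_massD[OF f] and G = C_massD[OF s]
  obtain J where J: "J \<in> sets lebesgue" "J \<subseteq> Om" "measure lebesgue J = L" "\<And>x. x \<in> J \<Longrightarrow> s x = 0"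
    using dry_interval_in_period[where f = s and a = a, OF H1D(5)[OF G(1)] L] G(3) \<open>0 < M\<close> by auto
  note B = L2_lower_bound_from_neg_power[OF H1D(4)[OF F(1)] F(2) \<open>0 < \<beta>\<close> S J(1-3) L(1)]
  have "(L powr (1 / \<beta> + 1 / 2) * S powr (- 1 / \<beta>))\<^sup>2 = L powr (2 * (1 / \<beta> + 1 / 2)) * S powr (2 * (- 1 / \<beta>))"
    using L(1) B(1) by (simp add: power_mult_distrib powr_power mult.commute)
  also have "\<dots> = L * (L / S) powr (2 / \<beta>)"
  proof -
    have e: "2 * (1 / \<beta> + 1 / 2) = 1 + 2 / \<beta>" "2 * (- 1 / \<beta>) = - (2 / \<beta>)" by simp_all
    show ?thesis
      unfolding e powr_add powr_minus using L(1) B(1) by (simp add: powr_divide field_simps)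
  qed
  also have "\<dots> \<le> (L2_norm (\<lambda>x. f x - s x))\<^sup>2"
    using B(2) L2_norm_le_if_vanishing(2)[OF H1D(4)[OF F(1)] H1D(4)[OF G(1)] J(1,2), of 0] J(4) by auto
  finally show ?thesis by (rule power2_le_imp_le) (simp add: L2_norm_def Bochner_Integration.integral_nonneg)
qed

lemma touchdown_point_rate:
  fixes u :: "real \<Rightarrow> real \<Rightarrow> real"
  assumes u: "\<And>t. 0 \<le> t \<Longrightarrow> u t \<in> C_mass M" and s: "s \<in> C_mass M" and "1 < \<beta>"
    and S: "\<And>t. 0 \<le> t \<Longrightarrow> (\<integral>\<^sup>+x. neg_power \<beta> (u t x) \<partial>lebesgue_on Om) \<le> ennreal (S0 + K0 * t)"
    and van: "vanishes_quadratically_at_point s"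
  shows "\<exists>K2>0. \<exists>K3>0. \<forall>t\<ge>0. (K2 + K3 * t) powr (- 3 / (2 * (\<beta> - 1))) \<le> L2_norm (\<lambda>x. u t x - s x)"
proof -
  note G = C_massD[OF s]
  obtain x0 c r0 where x0: "0 < c" "0 < r0" "\<And>r. 0 < r \<Longrightarrow> r < r0 \<Longrightarrow> {x0 - r<..<x0} \<subseteq> Om"
    "\<And>r x. 0 < r \<Longrightarrow> r < r0 \<Longrightarrow> x \<in> {x0 - r<..<x0} \<Longrightarrow> \<bar>s x\<bar> \<le> 2 * c * r\<^sup>2"
    using quadratic_touchdown_bound[OF van G(2)] by blast
  obtain A where A: "1 \<le> A" "\<And>S Z d. \<lbrakk>0 < S; 0 \<le> d; A * S \<le> Z; A \<le> Z;
     \<And>r. 0 < r \<Longrightarrow> r < r0 \<Longrightarrow> r * (r / S) powr (2 / \<beta>) \<le> 2 * d\<^sup>2 + 2 * (2 * c * r\<^sup>2)\<^sup>2 * r\<rbrakk>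
     \<Longrightarrow> Z powr (- 3 / (2 * (\<beta> - 1))) \<le> d"
    using touchdown_rate[OF \<open>1 < \<beta>\<close> x0(1,2)] by blast
  show ?thesis
  \<comment> \<open>Absolute values and the added 1 make both constants positive whatever the signs,
    and K2 + K3 t is at least \<open>A\<close> and at least A (S0 + K0 t), as the choice of
    \<open>A\<close> demands.\<close>
  proof (rule exI[of _ "A * (1 + \<bar>S0\<bar>)"], intro conjI, goal_cases)
    case 2
    show ?case
    proof (rule exI[of _ "A * (1 + \<bar>K0\<bar>)"], intro conjI allI impI, goal_cases)
      case (2 t)
      let ?S = "S0 + K0 * t" and ?d = "L2_norm (\<lambda>x. u t x - s x)"
      note F = C_massD[OF u[OF 2]]
      have low: "0 < ?S \<and> r * (r / ?S) powr (2 / \<beta>) \<le> 2 * ?d\<^sup>2 + 2 * (2 * c * r\<^sup>2)\<^sup>2 * r" if r: "0 < r" "r < r0" for r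
      proof -
        have J: "{x0 - r<..<x0} \<in> sets lebesgue" "measure lebesgue {x0 - r<..<x0} = r" using r by auto
        have \<beta>: "0 < \<beta>" using \<open>1 < \<beta>\<close> by simp
        note B = L2_lower_bound_from_neg_power[OF H1D(4)[OF F(1)] F(2) \<beta> S[OF 2] J(1) x0(3)[OF r] J(2) r(1)]
        have "(LINT x|lebesgue_on Om. indicator {x0 - r<..<x0} x * (u t x)\<^sup>2) \<le> 2 * ?d\<^sup>2 + 2 * (2 * c * r\<^sup>2)\<^sup>2 * r"
          using L2_norm_le_if_vanishing(1)[OF H1D(4)[OF F(1)] H1D(4)[OF G(1)] J(1) x0(3)[OF r] x0(4)[OF r]]
          unfolding J(2) .
        with B show ?thesis by linarith
      qed
      have S0: "0 < ?S" using low[of "r0 / 2"] x0(2) by simp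
      have Kt: "K0 * t \<le> \<bar>K0\<bar> * t" "0 \<le> \<bar>K0\<bar> * t" using 2 by (auto intro: mult_right_mono)
      have e: "A * (1 + \<bar>S0\<bar>) + A * (1 + \<bar>K0\<bar>) * t = A * (1 + \<bar>S0\<bar> + (1 + \<bar>K0\<bar>) * t)" by (simp add: algebra_simps)
      show ?case
      proof (rule A(2)[OF S0])
        show "0 \<le> ?d" by (simp add: L2_norm_def Bochner_Integration.integral_nonneg)
        have "?S \<le> 1 + \<bar>S0\<bar> + (1 + \<bar>K0\<bar>) * t" using Kt 2 by (simp add: distrib_right)
        then show "A * ?S \<le> A * (1 + \<bar>S0\<bar>) + A * (1 + \<bar>K0\<bar>) * t"
          unfolding e using A(1) by (intro mult_left_mono) auto
        have "A * 1 \<le> A * (1 + \<bar>S0\<bar> + (1 + \<bar>K0\<bar>) * t)"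
          using A(1) 2 by (intro mult_left_mono) auto
        then show "A \<le> A * (1 + \<bar>S0\<bar>) + A * (1 + \<bar>K0\<bar>) * t" unfolding e by simp
      qed (use low in blast)
    qed (use A in auto)
  qed (use A in auto)
qed

theorem theorem2:
  fixes \<alpha> n \<beta> M S0 K0 :: real
    and u :: "real \<Rightarrow> real \<Rightarrow> real"
    and ustar :: "real \<Rightarrow> real"
  assumes "0 \<le> \<alpha>" and "0 < n" and "\<beta> = n - 3 / 2" and "0 < M"
    and "is_solution n \<alpha> u"
    and "\<forall>t\<ge>0. u t \<in> C_mass M"
    and "dissipates_energy n \<alpha> u"
    and "\<forall>t\<ge>0. (\<integral>\<^sup>+ x. neg_power \<beta> (u t x) \<partial>lebesgue_on Om) \<le> ennreal (S0 + K0 * t)"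
    and "is_arg_min (energy \<alpha>) (\<lambda>f. f \<in> C_mass M) ustar"
  shows
    "((\<forall>x. 0 < ustar x) \<longrightarrow>
        (let m = (INF x\<in>{-pi..pi}. ustar x);
             \<mu> = (1 - \<alpha>\<^sup>2) * m powr n;
             \<epsilon>0 = (1 - \<alpha>\<^sup>2) * pi / 2 * m\<^sup>2
         in energy \<alpha> (u 0) < energy \<alpha> ustar + \<epsilon>0 \<longrightarrow>
            (\<exists>K1. \<forall>t\<ge>0. H1_norm (\<lambda>x. u t x - ustar x) \<le> K1 * exp (- \<mu> * t))))
     \<and> (\<forall>a L. 0 < L \<and> (\<forall>x\<in>{a<..<a + L}. ustar x = 0) \<and> n > 3 / 2 \<longrightarrow>
          (\<forall>t\<ge>0. L2_norm (\<lambda>x. u t x - ustar x)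
                   \<ge> L powr (1 / \<beta> + 1 / 2) * (S0 + K0 * t) powr (- 1 / \<beta>)))
     \<and> (vanishes_quadratically_at_point ustar \<and> n > 5 / 2 \<longrightarrow>
          (\<exists>K2>0. \<exists>K3>0. \<forall>t\<ge>0. L2_norm (\<lambda>x. u t x - ustar x)
                   \<ge> (K2 + K3 * t) powr (- 3 / (2 * (\<beta> - 1)))))"
proof -
  have s: "ustar \<in> C_mass M" and min: "\<And>f. f \<in> C_mass M \<Longrightarrow> energy \<alpha> ustar \<le> energy \<alpha> f"
    using assms(9) unfolding is_arg_min_def by (auto simp: not_less)
  have u: "\<And>t. 0 \<le> t \<Longrightarrow> u t \<in> C_mass M"
    and ent: "\<And>t. 0 \<le> t \<Longrightarrow> (\<integral>\<^sup>+ x. neg_power \<beta> (u t x) \<partial>lebesgue_on Om) \<le> ennreal (S0 + K0 * t)"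
    using assms(6,8) by auto
  show ?thesis
  proof (intro conjI impI allI, goal_cases)
    case 1
    let ?m = "INF x\<in>{-pi..pi}. ustar x"
    have "\<exists>K1. \<forall>t\<ge>0. H1_norm (\<lambda>x. u t x - ustar x) \<le> K1 * exp (- ((1 - \<alpha>\<^sup>2) * ?m powr n) * t)"
      if E: "energy \<alpha> (u 0) < energy \<alpha> ustar + (1 - \<alpha>\<^sup>2) * pi / 2 * ?m\<^sup>2"
    proof -
      have "\<alpha> < 1"
      proof (rule ccontr)
        assume "\<not> \<alpha> < 1"
        then have "1 \<le> \<alpha>\<^sup>2" by (simp add: one_le_power)
        then have "(1 - \<alpha>\<^sup>2) * (pi / 2 * ?m\<^sup>2) \<le> 0" by (intro mult_nonpos_nonneg) auto
        then show False using E min[OF u[of 0]] by simp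
      qed
      then show ?thesis
        using positive_minimizer_convergence[OF assms(1) _ assms(2,4,5,7) u ent[unfolded assms(3)] s min] 1 by blast
    qed
    then show ?case unfolding Let_def by blast
  next
    case (2 a L t)
    have "0 < \<beta>" using 2 assms(3) by simp
    then show ?case
      by (intro dry_interval_rate[OF u s assms(4) _ ent]) (use 2 in auto)
  next
    case 3
    have "1 < \<beta>" using 3 assms(3) by simp
    then show ?case
      by (intro touchdown_point_rate[OF u s _ ent]) (use 3 in auto)
  qed
qed

end
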